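(* Let $J^0$ be a doubly-infinite complex $p$-periodic quasi-symmetric Jacobi matrix and let $J$ be an asymptotically $p$-periodic doubly-infinite complex Jacobi matrix with background $J^0$. If $J\in\mathcal{P}(\frac12,J^0)$, then the spectrum $\sigma(J)$ of $J$ on $\ell^2(\mathbb{Z})$ is the union of $p$ algebraic arcs (those constituting $\sigma(J^0)$) and a finite number of eigenvalues of finite algebraic multiplicity off these arcs.
   Context: A doubly-infinite complex Jacobi matrix $J$ is a tridiagonal matrix indexed by $\mathbb{Z}\times\mathbb{Z}$ whose $n$-th row has entries $a_n,b_n,c_{n+1}$ in columns $n-1,n,n+1$ respectively (zero elsewhere), with $a_n,b_n,c_n\in\mathbb{C}$ and $a_nc_n\neq0$ for all $n$. The matrix $J^0$, with entries $a_n^0,b_n^0,c_n^0$, is $p$-periodic if $a^0_{n+p}=a^0_n$, $b^0_{n+p}=b^0_n$, $c^0_{n+p}=c^0_n$ for all $n\in\mathbb{Z}$; it is quasi-symmetric if $\prod_{k=1}^pa_k^0=\prod_{k=1}^pc_k^0$. $J$ is asymptotically $p$-periodic with background $J^0$ if $$\omega_n:=|a_n-a_n^0|+|b_n-b_n^0|+|c_{n+1}-c_{n+1}^0|\to0,\qquad n\to\pm\infty.$$ For $0<\beta<1$, $J$ belongs to the class $\mathcal{P}(\beta,J^0)$ if there are constants $C_1,C_2>0$ with $\omega_n\le C_1\exp(-C_2|n|^\beta)$ for all $n\in\mathbb{Z}$. The $p$ algebraic arcs: for a quasi-symmetric $p$-periodic $J^0$ there is a polynomial $Q$ of degree $p$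 such that $Q(J^0)$ is the doubly-infinite matrix with entries $1$ for $|i-j|=p$ and $0$ otherwise (known theorem of Naiman), and $\sigma(J^0)=Q^{-1}([-2,2])=\{z\in\mathbb{C}:Q(z)\in[-2,2]\}$. This set is the union of the $p$ (possibly touching) algebraic arcs given by the branches of $Q^{-1}$ over $[-2,2]$. The complement of $\sigma(J^0)$ is connected, and $\sigma(J)=\sigma(J^0)\cup\sigma_{\rm d}(J)$ with $\sigma_{\rm d}(J)$ an at most countable set of eigenvalues of finite algebraic multiplicity off $\sigma(J^0)$. *)

theory Defs
  imports "HOL-Analysis.Analysis" "HOL-Library.Function_Algebras"
    "HOL-Computational_Algebra.Polynomial"
begin

type_synonym bimatrix = "int \<Rightarrow> int \<Rightarrow> complex"
type_synonym bisequence = "int \<Rightarrow> complex"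

definition jacobi_matrix :: "bisequence \<Rightarrow> bisequence \<Rightarrow> bisequence \<Rightarrow> bimatrix" where
  "jacobi_matrix a b c i j =
     (if j = i - 1 then a i else if j = i then b i else if j = i + 1 then c (i + 1) else 0)"

definition periodic_seq :: "nat \<Rightarrow> bisequence \<Rightarrow> bool" where
  "periodic_seq p a \<longleftrightarrow> (\<forall>n. a (n + int p) = a n)"

definition quasi_symmetric :: "nat \<Rightarrow> bisequence \<Rightarrow> bisequence \<Rightarrow> bool" where
  "quasi_symmetric p a c \<longleftrightarrow> (\<Prod>k=1..int p. a k) = (\<Prod>k=1..int p. c k)"

definition deviation ::
  "bisequence \<Rightarrow> bisequence \<Rightarrow> bisequence \<Rightarrow> bisequence \<Rightarrow> bisequence \<Rightarrow> bisequence \<Rightarrow> int \<Rightarrow> real" where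
  "deviation a b c a0 b0 c0 n =
     cmod (a n - a0 n) + cmod (b n - b0 n) + cmod (c (n + 1) - c0 (n + 1))"

definition asymptotic_to ::
  "bisequence \<Rightarrow> bisequence \<Rightarrow> bisequence \<Rightarrow> bisequence \<Rightarrow> bisequence \<Rightarrow> bisequence \<Rightarrow> bool" where
  "asymptotic_to a b c a0 b0 c0 \<longleftrightarrow>
     (deviation a b c a0 b0 c0 \<longlongrightarrow> 0) at_top \<and> (deviation a b c a0 b0 c0 \<longlongrightarrow> 0) at_bot"

definition class_P ::
  "real \<Rightarrow> bisequence \<Rightarrow> bisequence \<Rightarrow> bisequence \<Rightarrow> bisequence \<Rightarrow> bisequence \<Rightarrow> bisequence \<Rightarrow> bool" where
  "class_P \<beta> a b c a0 b0 c0 \<longleftrightarrow>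
     (\<exists>C1>0. \<exists>C2>0. \<forall>n.
        deviation a b c a0 b0 c0 n \<le> C1 * exp (- C2 * \<bar>real_of_int n\<bar> powr \<beta>))"

text \<open>All infinite sums in the following matrix operations have only finitely many nonzero
  terms when they are applied to banded matrices, so no convergence question arises.\<close>

definition mat_apply :: "bimatrix \<Rightarrow> bisequence \<Rightarrow> bisequence" where
  "mat_apply A x i = (\<Sum>\<^sub>\<infinity>j. A i j * x j)"

definition mat_mult :: "bimatrix \<Rightarrow> bimatrix \<Rightarrow> bimatrix" where
  "mat_mult A B i j = (\<Sum>\<^sub>\<infinity>k. A i k * B k j)"

definition mat_one :: bimatrix where
  "mat_one i j = (if i = j then 1 else 0)"

primrec mat_power :: "bimatrix \<Rightarrow> nat \<Rightarrow> bimatrix" where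
  "mat_power A 0 = mat_one"
| "mat_power A (Suc k) = mat_mult A (mat_power A k)"

definition mat_poly :: "complex poly \<Rightarrow> bimatrix \<Rightarrow> bimatrix" where
  "mat_poly Q A i j = (\<Sum>k\<le>degree Q. coeff Q k * mat_power A k i j)"

definition free_matrix :: "nat \<Rightarrow> bimatrix" where
  "free_matrix p i j = (if \<bar>i - j\<bar> = int p then 1 else 0)"

definition seq_scale :: "complex \<Rightarrow> bisequence \<Rightarrow> bisequence" where
  "seq_scale z x = (\<lambda>n. z * x n)"

interpretation seq: vector_space seq_scale
  by unfold_locales (auto simp: seq_scale_def fun_eq_iff algebra_simps)

definition l2 :: "bisequence set" where
  "l2 = {x. (\<lambda>n. (cmod (x n))\<^sup>2) summable_on UNIV}"

definition l2_norm :: "bisequence \<Rightarrow> real" where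
  "l2_norm x = sqrt (\<Sum>\<^sub>\<infinity>n. (cmod (x n))\<^sup>2)"

text \<open>Operators on the Hilbert space are maps on all bi-infinite sequences of which only the
  behaviour on the carrier \<open>l2\<close> matters.\<close>

definition bounded_l2_operator :: "(bisequence \<Rightarrow> bisequence) \<Rightarrow> bool" where
  "bounded_l2_operator T \<longleftrightarrow>
     (\<forall>x\<in>l2. T x \<in> l2) \<and>
     (\<forall>x\<in>l2. \<forall>y\<in>l2. T (x + y) = T x + T y) \<and>
     (\<forall>z. \<forall>x\<in>l2. T (seq_scale z x) = seq_scale z (T x)) \<and>
     (\<exists>K. \<forall>x\<in>l2. l2_norm (T x) \<le> K * l2_norm x)"

definition minus_scalar :: "(bisequence \<Rightarrow> bisequence) \<Rightarrow> complex \<Rightarrow> bisequence \<Rightarrow> bisequence" where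
  "minus_scalar T z x = T x - seq_scale z x"

text \<open>The spectrum is meant for bounded \<open>T\<close>; a Jacobi matrix with bounded entries, such as an
  asymptotically periodic one, acts as a bounded operator.\<close>

definition l2_resolvent_set :: "(bisequence \<Rightarrow> bisequence) \<Rightarrow> complex set" where
  "l2_resolvent_set T =
     {z. \<exists>R. bounded_l2_operator R \<and>
        (\<forall>x\<in>l2. R (minus_scalar T z x) = x \<and> minus_scalar T z (R x) = x)}"

definition l2_spectrum :: "(bisequence \<Rightarrow> bisequence) \<Rightarrow> complex set" where
  "l2_spectrum T = - l2_resolvent_set T"

definition l2_eigenvalue :: "(bisequence \<Rightarrow> bisequence) \<Rightarrow> complex \<Rightarrow> bool" where
  "l2_eigenvalue T z \<longleftrightarrow> (\<exists>x\<in>l2. x \<noteq> 0 \<and> T x = seq_scale z x)"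

text \<open>The algebraic multiplicity of an eigenvalue is the dimension of its root subspace,
  the space of all generalized eigenvectors of arbitrary order.\<close>

definition root_subspace :: "(bisequence \<Rightarrow> bisequence) \<Rightarrow> complex \<Rightarrow> bisequence set" where
  "root_subspace T z = {x \<in> l2. \<exists>k. (minus_scalar T z ^^ k) x = 0}"

definition finite_algebraic_multiplicity :: "(bisequence \<Rightarrow> bisequence) \<Rightarrow> complex \<Rightarrow> bool" where
  "finite_algebraic_multiplicity T z \<longleftrightarrow>
     (\<exists>B. finite B \<and> root_subspace T z \<subseteq> seq.span B)"

text \<open>The functions \<open>\<gamma> 0, \<dots>, \<gamma> (degree Q - 1)\<close> are the continuous branches of the inverse of
  \<open>Q\<close> over \<open>[-2,2]\<close>: at every \<open>t\<close> they list all zeros of \<open>Q - t\<close> with multiplicity. Every branch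
  is injective because \<open>poly Q (\<gamma> k t) = t\<close>, so its image is an arc; different arcs can only meet
  over the finitely many critical values of \<open>Q\<close>.\<close>

definition inverse_branches :: "complex poly \<Rightarrow> (nat \<Rightarrow> real \<Rightarrow> complex) \<Rightarrow> bool" where
  "inverse_branches Q \<gamma> \<longleftrightarrow>
     (\<forall>k<degree Q. continuous_on {-2..2} (\<gamma> k)) \<and>
     (\<forall>t\<in>{-2..2}.
        Q - [:complex_of_real t:] = smult (lead_coeff Q) (\<Prod>k<degree Q. [:- \<gamma> k t, 1:]))"

end

theory Submission
  imports Defs "HOL-Complex_Analysis.Complex_Analysis" "HOL-Computational_Algebra.Fundamental_Theorem_Algebra"
    "Jordan_Normal_Form.Determinant"
begin

text \<open>With \<open>Q\<close> the polynomial satisfying \<open>Q(J\<^sup>0) = S\<^sup>p + S\<^sup>-\<^sup>p\<close>, \<open>S\<close> the shift, the banded matrix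
  \<open>B = Q(J)\<close> deviates from \<open>S\<^sup>p + S\<^sup>-\<^sup>p\<close> in row \<open>n\<close> by \<open>O(exp (-c \<surd>|n|))\<close>, and \<open>Q\<close> maps eigenvalues of
  \<open>J\<close> off the arcs to eigenvalues of \<open>B\<close> off \<open>[-2,2]\<close>. Uniformize the latter by \<open>\<mu> = \<kappa> + 1/\<kappa>\<close> with
  \<open>|\<kappa>| < 1\<close>. Left Jost solutions at both ends are power series in \<open>\<kappa>\<close> whose coefficients decay like
  \<open>exp (-c \<surd>n)\<close>; such series form an algebra. Pairing an eigenvector with the Jost solutions
  yields a finite linear system with the power series \<open>D(\<kappa>)\<close> as determinant, where \<open>D(0) \<noteq> 0\<close> and \<open>D\<close> vanishes
  at all eigenvalues, to an order that bounds the length of Jordan chains. If the zeros of \<open>D\<close>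
  accumulated at a point \<open>\<zeta>\<close> of the unit circle, all derivatives of \<open>D\<close> would vanish there, and the
  coefficient decay would give \<open>|D(\<kappa>)| \<le> C exp (-a/|\<kappa> - \<zeta>|)\<close>, which the maximum principle
  excludes. Off the arcs \<open>J - z\<close> is a finite-rank modification of an invertible operator, so the spectrum
  there consists of eigenvalues; on the arcs, truncated Bloch solutions are Weyl sequences.\<close>

section \<open>Bounded operators on square-summable sequences\<close>

text \<open>Passing to \<open>Q(J)\<close> trades the p-periodic background for one with constant
  coefficients, whose Green kernel is an explicit polynomial in \<kappa>. The price is bandwidth
  \<open>2 p + 1\<close>: each end has p Jost solutions, so a determinant replaces the scalar Jost
  function. Jost solutions acting from the left only have to be paired with a vector; the vector
  itself need not be continued or even solve the equation exactly, and tolerating a residual is what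
  later measures multiplicity. The exponent 1/2 is where two rates meet. With weight
  \<open>exp (c * sqrt n)\<close>, dividing out n zeros costs a factor of size n to the power n, and
  n zeros within distance d of \<zeta> gain d to the power n; the best n is of order 1/d and leaves
  exp(-a/d). Under the map z to 2/(1 - z) onto a half-plane this is exponential decay exp(-a |w|/2)
  in all directions, which only the zero function survives. Rates exp(-a/d^g) with g < 1 would not
  suffice: exp(-(1/(1 - z))^g) has such decay and is nonzero.\<close>

lemma L2_set_le_l2_norm:
  assumes "x \<in> l2" "finite F"
  shows "L2_set (\<lambda>i. cmod (x i)) F \<le> l2_norm x"
  unfolding L2_set_def l2_norm_def using assms
  by (intro real_sqrt_le_mono finite_sum_le_infsum) (auto simp: l2_def)

text \<open>One uniform bound on finite sections yields membership and the norm bound together. Norm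
  estimates for sums, multiplications and shifts thereby become statements about
  \<open>L2_set\<close> on a finite set.\<close>

lemma l2_normI:
  assumes "\<And>F. finite F \<Longrightarrow> L2_set (\<lambda>i. cmod (x i)) F \<le> M"
  shows "x \<in> l2" "l2_norm x \<le> M"
proof -
  have M: "0 \<le> M" using assms[of "{}"] by simp
  have b: "(\<Sum>i\<in>F. (cmod (x i))\<^sup>2) \<le> M\<^sup>2" if "finite F" for F
    using assms[OF that] unfolding L2_set_def by (rule sqrt_le_D)
  then show x: "x \<in> l2"
    unfolding l2_def mem_Collect_eq
    by (intro nonneg_bdd_above_summable_on bdd_aboveI2[where M = "M\<^sup>2"]) (use b in auto)
  then have "(\<Sum>\<^sub>\<infinity>n. (cmod (x n))\<^sup>2) \<le> M\<^sup>2"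
    by (intro infsum_le_finite_sums b) (auto simp: l2_def)
  then show "l2_norm x \<le> M" unfolding l2_norm_def using M by (intro real_le_lsqrt) auto
qed

lemma l2_norm_nonneg [simp]: "0 \<le> l2_norm x"
  by (simp add: l2_norm_def infsum_nonneg)

lemma l2_0 [simp]: "0 \<in> l2" "l2_norm 0 = 0"
  using l2_normI[of 0 0] l2_norm_nonneg[of 0] by (auto simp: L2_set_def)

lemma norm_le_l2_norm: "x \<in> l2 \<Longrightarrow> cmod (x i) \<le> l2_norm x"
  using L2_set_le_l2_norm[of x "{i}"] by simp

lemma l2_norm_eq_0: "x \<in> l2 \<Longrightarrow> l2_norm x = 0 \<Longrightarrow> x = 0"
  using norm_le_l2_norm by fastforce

lemma l2_add:
  assumes "x \<in> l2" "y \<in> l2"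
  shows "x + y \<in> l2" "l2_norm (x + y) \<le> l2_norm x + l2_norm y"
proof -
  have *: "L2_set (\<lambda>i. cmod ((x + y) i)) F \<le> l2_norm x + l2_norm y" if F: "finite F" for F
  proof -
    have "L2_set (\<lambda>i. cmod ((x + y) i)) F \<le> L2_set (\<lambda>i. cmod (x i) + cmod (y i)) F"
      by (intro L2_set_mono) (auto simp: norm_triangle_ineq)
    also have "\<dots> \<le> L2_set (\<lambda>i. cmod (x i)) F + L2_set (\<lambda>i. cmod (y i)) F"
      by (rule L2_set_triangle_ineq)
    also have "\<dots> \<le> l2_norm x + l2_norm y"
      by (intro add_mono L2_set_le_l2_norm assms F)
    finally show ?thesis .
  qed
  show "x + y \<in> l2" by (rule l2_normI(1)[OF *])
  show "l2_norm (x + y) \<le> l2_norm x + l2_norm y" by (rule l2_normI(2)[OF *])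
qed

lemma l2_mult:
  assumes "x \<in> l2" "\<And>i. cmod (m i) \<le> M"
  shows "(\<lambda>i. m i * x i) \<in> l2" "l2_norm (\<lambda>i. m i * x i) \<le> M * l2_norm x"
proof -
  have M: "0 \<le> M" using order_trans[OF norm_ge_zero assms(2)] .
  have "L2_set (\<lambda>i. cmod (m i * x i)) F \<le> M * l2_norm x" if F: "finite F" for F
  proof -
    have "L2_set (\<lambda>i. cmod (m i * x i)) F \<le> L2_set (\<lambda>i. M * cmod (x i)) F"
      using assms(2) by (intro L2_set_mono) (auto simp: norm_mult mult_right_mono)
    also have "\<dots> = M * L2_set (\<lambda>i. cmod (x i)) F"
      using M by (simp add: L2_set_right_distrib)
    also have "\<dots> \<le> M * l2_norm x" by (intro mult_left_mono L2_set_le_l2_norm assms F M)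
    finally show ?thesis .
  qed
  from l2_normI[OF this] show "(\<lambda>i. m i * x i) \<in> l2" "l2_norm (\<lambda>i. m i * x i) \<le> M * l2_norm x" by auto
qed

lemma l2_scale:
  assumes "x \<in> l2"
  shows "seq_scale z x \<in> l2" "l2_norm (seq_scale z x) \<le> cmod z * l2_norm x"
  unfolding seq_scale_def using l2_mult[of x "\<lambda>_. z" "cmod z", OF assms] by auto

lemma l2_uminus: "x \<in> l2 \<Longrightarrow> - x \<in> l2" "x \<in> l2 \<Longrightarrow> l2_norm (- x) \<le> l2_norm x"
proof -
  have "- x = seq_scale (-1) x" by (auto simp: seq_scale_def)
  then show "x \<in> l2 \<Longrightarrow> - x \<in> l2" "x \<in> l2 \<Longrightarrow> l2_norm (- x) \<le> l2_norm x"
    using l2_scale[of x "-1"] by auto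
qed

lemma l2_diff:
  assumes "x \<in> l2" "y \<in> l2"
  shows "x - y \<in> l2" "l2_norm (x - y) \<le> l2_norm x + l2_norm y"
  using l2_add[OF assms(1) l2_uminus(1)[OF assms(2)]] l2_uminus(2)[OF assms(2)] by auto

lemma l2_shift:
  assumes "x \<in> l2"
  shows "(\<lambda>i. x (i + k)) \<in> l2" "l2_norm (\<lambda>i. x (i + k)) \<le> l2_norm x"
proof -
  have "L2_set (\<lambda>i. cmod (x (i + k))) F \<le> l2_norm x" if F: "finite F" for F
  proof -
    have "L2_set (\<lambda>i. cmod (x (i + k))) F = L2_set (\<lambda>i. cmod (x i)) ((\<lambda>i. i + k) ` F)"
      unfolding L2_set_def by (subst sum.reindex) auto
    also have "\<dots> \<le> l2_norm x" by (intro L2_set_le_l2_norm assms finite_imageI F)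
    finally show ?thesis .
  qed
  from l2_normI[OF this] show "(\<lambda>i. x (i + k)) \<in> l2" "l2_norm (\<lambda>i. x (i + k)) \<le> l2_norm x" by auto
qed

lemma l2_finite_support:
  assumes "finite W" "\<And>i. i \<notin> W \<Longrightarrow> x i = 0"
  shows "x \<in> l2" "l2_norm x = L2_set (\<lambda>i. cmod (x i)) W"
proof -
  have *: "L2_set (\<lambda>i. cmod (x i)) F \<le> L2_set (\<lambda>i. cmod (x i)) W" if F: "finite F" for F
  proof -
    have "L2_set (\<lambda>i. cmod (x i)) F = L2_set (\<lambda>i. cmod (x i)) (F \<inter> W)"
      unfolding L2_set_def using assms F by (intro arg_cong[where f = sqrt] sum.mono_neutral_right) auto
    also have "\<dots> \<le> L2_set (\<lambda>i. cmod (x i)) W"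
      unfolding L2_set_def using assms by (intro real_sqrt_le_mono sum_mono2) auto
    finally show ?thesis .
  qed
  show "x \<in> l2" by (rule l2_normI(1)[OF *])
  then show "l2_norm x = L2_set (\<lambda>i. cmod (x i)) W"
    using l2_normI(2)[OF *] L2_set_le_l2_norm[OF _ assms(1)] by (simp add: order_antisym)
qed

lemma l2_sum:
  assumes "\<And>k. k \<in> A \<Longrightarrow> y k \<in> l2"
  shows "(\<lambda>i. \<Sum>k\<in>A. y k i) \<in> l2" "l2_norm (\<lambda>i. \<Sum>k\<in>A. y k i) \<le> (\<Sum>k\<in>A. l2_norm (y k))"
proof -
  have "(\<lambda>i. \<Sum>k\<in>A. y k i) \<in> l2 \<and> l2_norm (\<lambda>i. \<Sum>k\<in>A. y k i) \<le> (\<Sum>k\<in>A. l2_norm (y k))"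
    using assms
  proof (induction A rule: infinite_finite_induct)
    case (insert k A)
    have e: "(\<lambda>i. \<Sum>k\<in>insert k A. y k i) = y k + (\<lambda>i. \<Sum>k\<in>A. y k i)"
      using insert by (auto simp: fun_eq_iff)
    show ?case unfolding e using l2_add[of "y k" "\<lambda>i. \<Sum>k\<in>A. y k i"] insert by auto
  qed (auto simp flip: zero_fun_def)
  then show "(\<lambda>i. \<Sum>k\<in>A. y k i) \<in> l2" "l2_norm (\<lambda>i. \<Sum>k\<in>A. y k i) \<le> (\<Sum>k\<in>A. l2_norm (y k))" by auto
qed

text \<open>Completeness of \<open>l2\<close> in the form the Neumann series asks for: coordinates
  converge because each is dominated by the norm, and on a finite set of coordinates the bound on
  partial sums passes to the limit.\<close>

lemma l2_suminf:
  fixes y :: "nat \<Rightarrow> bisequence"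
  assumes "\<And>k. y k \<in> l2" "summable (\<lambda>k. l2_norm (y k))"
  shows "(\<lambda>i. \<Sum>k. y k i) \<in> l2" "l2_norm (\<lambda>i. \<Sum>k. y k i) \<le> (\<Sum>k. l2_norm (y k))"
    "summable (\<lambda>k. y k i)"
proof -
  show s: "summable (\<lambda>k. y k i)" for i
    by (rule summable_comparison_test'[OF assms(2), of 0]) (use norm_le_l2_norm assms in auto)
  have "L2_set (\<lambda>i. cmod (\<Sum>k. y k i)) F \<le> (\<Sum>k. l2_norm (y k))" if F: "finite F" for F
  proof (rule tendsto_le[OF _ tendsto_const])
    show "(\<lambda>n. L2_set (\<lambda>i. cmod (\<Sum>k<n. y k i)) F) \<longlonglongrightarrow> L2_set (\<lambda>i. cmod (\<Sum>k. y k i)) F"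
      unfolding L2_set_def by (intro tendsto_intros summable_LIMSEQ s)
    have "L2_set (\<lambda>i. cmod (\<Sum>k<n. y k i)) F \<le> (\<Sum>k. l2_norm (y k))" for n
    proof -
      have "L2_set (\<lambda>i. cmod (\<Sum>k<n. y k i)) F \<le> l2_norm (\<lambda>i. \<Sum>k<n. y k i)"
        by (intro L2_set_le_l2_norm l2_sum assms F)
      also have "\<dots> \<le> (\<Sum>k<n. l2_norm (y k))" by (intro l2_sum assms)
      also have "\<dots> \<le> (\<Sum>k. l2_norm (y k))" by (intro sum_le_suminf assms) auto
      finally show ?thesis .
    qed
    then show "\<forall>\<^sub>F n in sequentially. L2_set (\<lambda>i. cmod (\<Sum>k<n. y k i)) F \<le> (\<Sum>k. l2_norm (y k))"
      by simp
  qed auto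
  from l2_normI[OF this] show "(\<lambda>i. \<Sum>k. y k i) \<in> l2" "l2_norm (\<lambda>i. \<Sum>k. y k i) \<le> (\<Sum>k. l2_norm (y k))" by auto
qed

lemma bounded_l2_operatorE:
  assumes "bounded_l2_operator T"
  obtains K where "K > 0" "\<And>x. x \<in> l2 \<Longrightarrow> T x \<in> l2" "\<And>x. x \<in> l2 \<Longrightarrow> l2_norm (T x) \<le> K * l2_norm x"
    "\<And>x y. x \<in> l2 \<Longrightarrow> y \<in> l2 \<Longrightarrow> T (x + y) = T x + T y"
    "\<And>z x. x \<in> l2 \<Longrightarrow> T (seq_scale z x) = seq_scale z (T x)"
proof -
  obtain K where K: "\<And>x. x \<in> l2 \<Longrightarrow> l2_norm (T x) \<le> K * l2_norm x"
    using assms unfolding bounded_l2_operator_def by blast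
  have "l2_norm (T x) \<le> max K 1 * l2_norm x" if "x \<in> l2" for x
    using order_trans[OF K[OF that] mult_right_mono[of K "max K 1" "l2_norm x"]] by simp
  with that[of "max K 1"] assms show ?thesis
    unfolding bounded_l2_operator_def by auto
qed

lemma bounded_l2_operatorI:
  assumes "\<And>x. x \<in> l2 \<Longrightarrow> T x \<in> l2" "\<And>x. x \<in> l2 \<Longrightarrow> l2_norm (T x) \<le> K * l2_norm x"
    "\<And>x y. x \<in> l2 \<Longrightarrow> y \<in> l2 \<Longrightarrow> T (x + y) = T x + T y"
    "\<And>z x. x \<in> l2 \<Longrightarrow> T (seq_scale z x) = seq_scale z (T x)"
  shows "bounded_l2_operator T"
  using assms unfolding bounded_l2_operator_def by blast

lemma bounded_l2_operator_l2: "bounded_l2_operator T \<Longrightarrow> x \<in> l2 \<Longrightarrow> T x \<in> l2"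
  by (simp add: bounded_l2_operator_def)

lemma bounded_l2_operator_diff:
  assumes "bounded_l2_operator T" "x \<in> l2" "y \<in> l2"
  shows "T (x - y) = T x - T y"
proof -
  have "T ((x - y) + y) = T (x - y) + T y"
    using assms l2_diff(1) unfolding bounded_l2_operator_def by blast
  then show ?thesis by simp
qed

lemma bounded_l2_operator_0: "bounded_l2_operator T \<Longrightarrow> T 0 = 0"
  using bounded_l2_operator_diff[of T 0 0] by simp

lemma bounded_l2_operator_comp:
  assumes "bounded_l2_operator S" "bounded_l2_operator T"
  shows "bounded_l2_operator (\<lambda>x. S (T x))"
proof -
  obtain K where K: "K > 0" "\<And>x. x \<in> l2 \<Longrightarrow> l2_norm (S x) \<le> K * l2_norm x"
    using bounded_l2_operatorE[OF assms(1)] by metis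
  obtain L where L: "\<And>x. x \<in> l2 \<Longrightarrow> l2_norm (T x) \<le> L * l2_norm x"
    using bounded_l2_operatorE[OF assms(2)] by metis
  have "l2_norm (S (T x)) \<le> (K * L) * l2_norm x" if "x \<in> l2" for x
  proof -
    have "l2_norm (S (T x)) \<le> K * l2_norm (T x)" using K assms that by (simp add: bounded_l2_operator_l2)
    also have "\<dots> \<le> K * (L * l2_norm x)" using K L that by (intro mult_left_mono) auto
    finally show ?thesis by (simp add: mult.assoc)
  qed
  then show ?thesis using assms
    by (intro bounded_l2_operatorI[where K = "K * L"]) (auto simp: bounded_l2_operator_def)
qed

lemma bounded_l2_operator_add:
  assumes "bounded_l2_operator S" "bounded_l2_operator T"
  shows "bounded_l2_operator (\<lambda>x. S x + T x)"
proof -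
  obtain K where K: "\<And>x. x \<in> l2 \<Longrightarrow> l2_norm (S x) \<le> K * l2_norm x"
    using bounded_l2_operatorE[OF assms(1)] by metis
  obtain L where L: "\<And>x. x \<in> l2 \<Longrightarrow> l2_norm (T x) \<le> L * l2_norm x"
    using bounded_l2_operatorE[OF assms(2)] by metis
  have "l2_norm (S x + T x) \<le> (K + L) * l2_norm x" if "x \<in> l2" for x
    using l2_add(2)[of "S x" "T x"] K[OF that] L[OF that] assms that
    by (auto simp: bounded_l2_operator_l2 distrib_right)
  then show ?thesis using assms l2_add(1)
    by (intro bounded_l2_operatorI[where K = "K + L"])
       (auto simp: bounded_l2_operator_def seq.scale_right_distrib)
qed

lemma bounded_l2_operator_scale: "bounded_l2_operator (seq_scale z)"
  by (rule bounded_l2_operatorI[where K = "cmod z"])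
     (auto simp: l2_scale seq.scale_right_distrib seq.scale_left_commute)

lemma bounded_l2_operator_id: "bounded_l2_operator (\<lambda>x. x)"
  by (rule bounded_l2_operatorI[where K = 1]) auto

lemma bounded_l2_operator_zero: "bounded_l2_operator (\<lambda>x. 0)"
  by (rule bounded_l2_operatorI[where K = 0]) auto

lemma bounded_l2_operator_minus:
  assumes "bounded_l2_operator S" "bounded_l2_operator T"
  shows "bounded_l2_operator (\<lambda>x. S x - T x)"
proof -
  have "(\<lambda>x. S x - T x) = (\<lambda>x. S x + seq_scale (-1) (T x))" by (simp add: fun_eq_iff)
  then show ?thesis
    using bounded_l2_operator_add[OF assms(1) bounded_l2_operator_comp[OF bounded_l2_operator_scale[of "-1"] assms(2)]]
    by simp
qed

lemma bounded_l2_operator_minus_scalar: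
  "bounded_l2_operator T \<Longrightarrow> bounded_l2_operator (minus_scalar T z)"
  unfolding minus_scalar_def[abs_def] by (intro bounded_l2_operator_minus bounded_l2_operator_scale)

section \<open>Bounded inverses and the Neumann series\<close>

definition l2_invertible :: "(bisequence \<Rightarrow> bisequence) \<Rightarrow> bool" where
  "l2_invertible T \<longleftrightarrow> (\<exists>R. bounded_l2_operator R \<and> (\<forall>x\<in>l2. R (T x) = x \<and> T (R x) = x))"

lemma l2_resolvent_set_eq: "l2_resolvent_set T = {z. l2_invertible (minus_scalar T z)}"
  by (simp add: l2_resolvent_set_def l2_invertible_def)

text \<open>The lower bound \<open>bd\<close> does double duty: it gives injectivity, so that a
  pointwise choice of preimages is linear, and it is the norm bound of the resulting
  inverse.\<close>

lemma l2_invertibleI: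
  assumes T: "bounded_l2_operator T"
    and ex: "\<And>y. y \<in> l2 \<Longrightarrow> \<exists>x\<in>l2. T x = y"
    and bd: "\<And>x. x \<in> l2 \<Longrightarrow> l2_norm x \<le> K * l2_norm (T x)"
  shows "l2_invertible T"
proof -
  have inj: "x = y" if "x \<in> l2" "y \<in> l2" "T x = T y" for x y
  proof -
    have "l2_norm (x - y) \<le> K * l2_norm (T (x - y))" using that by (intro bd l2_diff)
    moreover have "T (x - y) = 0"
      unfolding bounded_l2_operator_diff[OF T that(1,2)] that(3) by (rule diff_self)
    ultimately have "l2_norm (x - y) = 0" using l2_norm_nonneg[of "x - y"] by simp
    then show ?thesis using l2_norm_eq_0[of "x - y"] that by (simp add: l2_diff)
  qed
  define R where "R y = (SOME x. x \<in> l2 \<and> T x = y)" for y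
  have R: "R y \<in> l2" "T (R y) = y" if "y \<in> l2" for y
  proof -
    have "\<exists>x. x \<in> l2 \<and> T x = y" using ex[OF that] by blast
    from someI_ex[OF this] show "R y \<in> l2" "T (R y) = y" unfolding R_def by auto
  qed
  have "bounded_l2_operator R"
  proof (rule bounded_l2_operatorI)
    show "l2_norm (R x) \<le> K * l2_norm x" if "x \<in> l2" for x using bd[of "R x"] R[OF that] by simp
    show "R (x + y) = R x + R y" if "x \<in> l2" "y \<in> l2" for x y
    proof (rule inj)
      have "T (R x + R y) = T (R x) + T (R y)" using T R that by (simp add: bounded_l2_operator_def)
      then show "T (R (x + y)) = T (R x + R y)" using R that by (simp add: l2_add)
    qed (use R that in \<open>auto simp: l2_add\<close>)
    show "R (seq_scale z x) = seq_scale z (R x)" if "x \<in> l2" for z x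
    proof (rule inj)
      have "T (seq_scale z (R x)) = seq_scale z (T (R x))" using T R that by (simp add: bounded_l2_operator_def)
      then show "T (R (seq_scale z x)) = T (seq_scale z (R x))" using R that by (simp add: l2_scale)
    qed (use R that in \<open>auto simp: l2_scale\<close>)
  qed (use R in auto)
  moreover have "R (T x) = x" if "x \<in> l2" for x
    using inj[of "R (T x)" x] R[of "T x"] that T by (simp add: bounded_l2_operator_l2)
  ultimately show ?thesis using R unfolding l2_invertible_def by (intro exI[of _ R]) auto
qed

lemma l2_invertible_comp:
  assumes "l2_invertible S" "l2_invertible T" "bounded_l2_operator S" "bounded_l2_operator T"
  shows "l2_invertible (\<lambda>x. S (T x))"
proof -
  obtain A where A: "bounded_l2_operator A" "\<forall>x\<in>l2. A (S x) = x \<and> S (A x) = x"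
    using assms(1) unfolding l2_invertible_def by auto
  obtain B where B: "bounded_l2_operator B" "\<forall>x\<in>l2. B (T x) = x \<and> T (B x) = x"
    using assms(2) unfolding l2_invertible_def by auto
  have "bounded_l2_operator (\<lambda>x. B (A x))" by (rule bounded_l2_operator_comp[OF B(1) A(1)])
  moreover have "B (A (S (T x))) = x \<and> S (T (B (A x))) = x" if x: "x \<in> l2" for x
  proof -
    have "T x \<in> l2" "A x \<in> l2"
      using x bounded_l2_operator_l2[OF assms(4)] bounded_l2_operator_l2[OF A(1)] by auto
    then show ?thesis using A(2) B(2) x by simp
  qed
  ultimately show ?thesis unfolding l2_invertible_def by (intro exI[of _ "\<lambda>x. B (A x)"]) auto
qed

lemma l2_invertible_scale: "z \<noteq> 0 \<Longrightarrow> l2_invertible (seq_scale z)"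
  unfolding l2_invertible_def
  by (intro exI[of _ "seq_scale (inverse z)"]) (auto simp: bounded_l2_operator_scale)

lemma l2_invertible_cong: "(\<And>x. x \<in> l2 \<Longrightarrow> S x = T x) \<Longrightarrow> l2_invertible S \<Longrightarrow> l2_invertible T"
  unfolding l2_invertible_def by (metis bounded_l2_operator_l2)

lemma l2_neumann:
  assumes C: "bounded_l2_operator C" and q: "q < 1" and bd: "\<And>x. x \<in> l2 \<Longrightarrow> l2_norm (C x) \<le> q * l2_norm x"
  shows "l2_invertible (\<lambda>x. x + C x)"
proof (rule l2_invertibleI)
  \<comment> \<open>The sign of \<open>q\<close> is left open. A negative \<open>q\<close> would
    force every norm to vanish, and that degenerate case is closed with the solution 0.\<close>
  have q0: "0 \<le> q \<or> (\<forall>x\<in>l2. l2_norm x = 0)"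
  proof (cases "0 \<le> q")
    case False
    have "l2_norm x = 0" if "x \<in> l2" for x
    proof (rule ccontr)
      assume "l2_norm x \<noteq> 0"
      then have "l2_norm x > 0" using l2_norm_nonneg[of x] by linarith
      then have "q * l2_norm x < 0" using False by (simp add: mult_neg_pos)
      then show False using bd[OF that] l2_norm_nonneg[of "C x"] by linarith
    qed
    then show ?thesis by blast
  qed simp
  show "bounded_l2_operator (\<lambda>x. x + C x)"
    by (intro bounded_l2_operator_add bounded_l2_operator_id C)
  show "l2_norm x \<le> (1 / (1 - q)) * l2_norm (x + C x)" if x: "x \<in> l2" for x
  proof -
    have "l2_norm ((x + C x) - C x) \<le> l2_norm (x + C x) + l2_norm (C x)"
      using x C by (intro l2_diff l2_add) (auto simp: bounded_l2_operator_l2)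
    then have "l2_norm x \<le> l2_norm (x + C x) + q * l2_norm x" using bd[OF x] by simp
    then show ?thesis using q by (simp add: field_simps)
  qed
  fix f :: bisequence assume f: "f \<in> l2"
  show "\<exists>x\<in>l2. x + C x = f"
  proof (cases "0 \<le> q")
    case False
    then have "f = 0" using q0 f l2_norm_eq_0[of f] by auto
    then show ?thesis using bounded_l2_operator_0[OF C] by (intro bexI[of _ 0]) auto
  next
    case q0: True
    define y where "y n = ((\<lambda>x. - C x) ^^ n) f" for n
    have y0: "y 0 = f" and ySuc: "y (Suc n) = - C (y n)" for n by (auto simp: y_def)
    have yl: "y n \<in> l2 \<and> l2_norm (y n) \<le> q ^ n * l2_norm f" for n
    proof (induction n)
      case (Suc n)
      have "l2_norm (y (Suc n)) \<le> l2_norm (C (y n))"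
        unfolding ySuc using Suc C by (intro l2_uminus) (auto simp: bounded_l2_operator_l2)
      also have "\<dots> \<le> q * l2_norm (y n)" using Suc by (intro bd) auto
      also have "\<dots> \<le> q * (q ^ n * l2_norm f)" using Suc q0 by (intro mult_left_mono) auto
      finally have "l2_norm (y (Suc n)) \<le> q ^ Suc n * l2_norm f" by (simp only: power_Suc mult.assoc)
      moreover have "y (Suc n) \<in> l2"
        unfolding ySuc using Suc by (intro l2_uminus(1) bounded_l2_operator_l2[OF C]) auto
      ultimately show ?case by simp
    qed (use f y0 in auto)
    have sg: "summable (\<lambda>n. q ^ n * l2_norm f)" using q q0 by (intro summable_mult2 summable_geometric) auto
    have sy: "summable (\<lambda>n. l2_norm (y (n + m)))" for m
      by (rule summable_comparison_test'[OF summable_ignore_initial_segment[OF sg, of m], of 0])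
         (use yl in auto)
    \<comment> \<open>The candidate is a coordinatewise infinite sum, while \<open>C\<close> is only
      known to respect finite sums. Hence the split of \<open>x\<close> into a partial sum
      \<open>s m\<close> and a tail \<open>r m\<close> of geometrically small norm: the residual
      \<open>w\<close> of \<open>x\<close> is then bounded by a null sequence.\<close>
    define x where "x = (\<lambda>i. \<Sum>n. y n i)"
    define r where "r m = (\<lambda>i. \<Sum>n. y (n + m) i)" for m
    define s where "s m = (\<lambda>i. \<Sum>n<m. y n i)" for m
    have ysum: "summable (\<lambda>n. y n i)" for i using l2_suminf(3)[of y] yl sy[of 0] by simp
    have x: "x \<in> l2" unfolding x_def using l2_suminf(1)[of y] yl sy[of 0] by simp
    have r: "r m \<in> l2" for m unfolding r_def using l2_suminf(1)[of "\<lambda>n. y (n + m)"] yl sy[of m] by simp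
    have s: "s m \<in> l2" for m unfolding s_def using yl by (intro l2_sum) auto
    have xrs: "x = r m + s m" for m
      unfolding x_def r_def s_def by (rule ext) (simp add: suminf_split_initial_segment[OF ysum])
    have rn: "l2_norm (r m) \<le> q ^ m * (l2_norm f / (1 - q))" for m
    proof -
      have "l2_norm (r m) \<le> (\<Sum>n. l2_norm (y (n + m)))"
        unfolding r_def using l2_suminf(2)[of "\<lambda>n. y (n + m)"] yl sy[of m] by simp
      also have "\<dots> \<le> (\<Sum>n. q ^ m * l2_norm f * q ^ n)"
        using yl[of "_ + m"] q q0
        by (intro suminf_le sy summable_mult summable_geometric) (auto simp: power_add mult_ac)
      also have "\<dots> = q ^ m * (l2_norm f / (1 - q))"
        using q q0 by (subst suminf_mult) (auto simp: suminf_geometric)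
      finally show ?thesis .
    qed
    have sC: "s m + C (s m) = f - y m" for m
    proof (induction m)
      case 0
      have "s 0 = 0" by (auto simp: s_def)
      then show ?case unfolding y0 by (simp only: bounded_l2_operator_0[OF C] add_0_right diff_self)
    next
      case (Suc m)
      have "s (Suc m) = s m + y m" by (auto simp: s_def)
      then have "s (Suc m) + C (s (Suc m)) = (s m + C (s m)) + y m + C (y m)"
        using C s yl by (simp add: bounded_l2_operator_def)
      then show ?case by (simp add: Suc ySuc)
    qed
    define w where "w = x + C x - f"
    have w: "w \<in> l2" unfolding w_def using x f C by (intro l2_diff l2_add) (auto simp: bounded_l2_operator_l2)
    have "l2_norm w \<le> q ^ m * ((1 + q) * (l2_norm f / (1 - q)) + l2_norm f)" for m
    proof -
      have "w = (r m + C (r m)) - y m"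
        unfolding w_def xrs[of m] using sC[of m] C r s
        by (simp add: bounded_l2_operator_def algebra_simps)
      then have "l2_norm w \<le> l2_norm (r m + C (r m)) + l2_norm (y m)"
        using l2_diff(2)[OF l2_add(1)[OF r bounded_l2_operator_l2[OF C r]], of "y m" m m] yl[of m] by simp
      also have "\<dots> \<le> (l2_norm (r m) + q * l2_norm (r m)) + q ^ m * l2_norm f"
        using l2_add(2)[OF r bounded_l2_operator_l2[OF C r], of m m] bd[OF r, of m] yl[of m] by linarith
      also have "\<dots> = (1 + q) * l2_norm (r m) + q ^ m * l2_norm f" by (simp add: algebra_simps)
      also have "\<dots> \<le> (1 + q) * (q ^ m * (l2_norm f / (1 - q))) + q ^ m * l2_norm f"
        using rn[of m] q0 by (intro add_mono mult_left_mono) auto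
      finally show ?thesis by (simp add: algebra_simps)
    qed
    moreover have "(\<lambda>m. q ^ m * ((1 + q) * (l2_norm f / (1 - q)) + l2_norm f)) \<longlonglongrightarrow> 0 * ((1 + q) * (l2_norm f / (1 - q)) + l2_norm f)"
      using q q0 by (intro tendsto_intros LIMSEQ_power_zero) auto
    ultimately have "l2_norm w \<le> 0 * ((1 + q) * (l2_norm f / (1 - q)) + l2_norm f)"
      by (intro LIMSEQ_le_const) auto
    then have "w = 0" using l2_norm_eq_0[OF w] by (simp add: order_antisym)
    then show ?thesis using x by (intro bexI[of _ x]) (auto simp: w_def)
  qed
qed

section \<open>Jacobi matrices and their polynomials\<close>

lemma infsum_finite_support:
  fixes f :: "'a \<Rightarrow> complex"
  assumes "finite F" "\<And>j. j \<notin> F \<Longrightarrow> f j = 0"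
  shows "(\<Sum>\<^sub>\<infinity>j. f j) = (\<Sum>j\<in>F. f j)"
proof -
  have "infsum f UNIV = infsum f F" using assms by (intro infsum_cong_neutral) auto
  then show ?thesis using assms by simp
qed

lemma infsum_jacobi_row:
  "(\<Sum>\<^sub>\<infinity>j. jacobi_matrix a b c i j * x j) = a i * x (i - 1) + b i * x i + c (i + 1) * x (i + 1)"
proof -
  have "(\<Sum>\<^sub>\<infinity>j. jacobi_matrix a b c i j * x j) = (\<Sum>j\<in>{i - 1, i, i + 1}. jacobi_matrix a b c i j * x j)"
    by (rule infsum_finite_support) (auto simp: jacobi_matrix_def)
  also have "\<dots> = a i * x (i - 1) + b i * x i + c (i + 1) * x (i + 1)"
    by (simp add: jacobi_matrix_def)
  finally show ?thesis .
qed

lemma mat_apply_jacobi: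
  "mat_apply (jacobi_matrix a b c) x i = a i * x (i - 1) + b i * x i + c (i + 1) * x (i + 1)"
  by (simp add: mat_apply_def infsum_jacobi_row)

text \<open>Linearity on all sequences: Bloch solutions and solutions of the recurrence lie outside
  \<open>l2\<close>, where \<open>bounded_l2_operator\<close> says nothing.\<close>

definition seq_linear :: "(bisequence \<Rightarrow> bisequence) \<Rightarrow> bool" where
  "seq_linear T \<longleftrightarrow> (\<forall>x y. T (x + y) = T x + T y) \<and> (\<forall>z x. T (seq_scale z x) = seq_scale z (T x))"

lemma seq_linear_jacobi: "seq_linear (mat_apply (jacobi_matrix a b c))"
  by (auto simp: seq_linear_def fun_eq_iff mat_apply_jacobi seq_scale_def algebra_simps)

text \<open>The operator counterpart of \<open>mat_poly\<close>, meaningful on arbitrary sequences;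
  \<open>poly_op_jacobi\<close> identifies the two row by row through finite sums.\<close>

definition poly_op :: "complex poly \<Rightarrow> (bisequence \<Rightarrow> bisequence) \<Rightarrow> bisequence \<Rightarrow> bisequence" where
  "poly_op Q T x = (\<lambda>i. \<Sum>k\<le>degree Q. coeff Q k * (T ^^ k) x i)"

lemma poly_op_upto:
  assumes "degree Q \<le> n"
  shows "poly_op Q T x i = (\<Sum>k\<le>n. coeff Q k * (T ^^ k) x i)"
  unfolding poly_op_def using assms
  by (intro sum.mono_neutral_left) (auto simp: coeff_eq_0)

section \<open>Powers of a Jacobi matrix and the matrices commuting with it\<close>

context
  fixes a b c :: bisequence
begin

abbreviation Jpow where "Jpow \<equiv> mat_power (jacobi_matrix a b c)"

lemma mat_power_Suc_left:
  "Jpow (Suc k) i j = a i * Jpow k (i - 1) j + b i * Jpow k i j + c (i + 1) * Jpow k (i + 1) j"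
  by (simp add: mat_mult_def infsum_jacobi_row)

text \<open>Powers are built by multiplication from the left. This is the right-hand version, so
  that together with \<open>mat_power_Suc_left\<close> it says that a Jacobi matrix commutes with
  its powers.\<close>

lemma mat_power_Suc_right:
  "Jpow (Suc k) i j = Jpow k i (j - 1) * c j + Jpow k i j * b j + Jpow k i (j + 1) * a (j + 1)"
proof (induction k arbitrary: i j)
  case 0
  have "i - 1 = j \<longleftrightarrow> i = j + 1" "i + 1 = j \<longleftrightarrow> i = j - 1" by auto
  then show ?case unfolding mat_power_Suc_left by (auto simp: mat_one_def)
next
  case (Suc k)
  have "Jpow (Suc (Suc k)) i j = a i * (Jpow k (i - 1) (j - 1) * c j + Jpow k (i - 1) j * b j + Jpow k (i - 1) (j + 1) * a (j + 1))
      + b i * (Jpow k i (j - 1) * c j + Jpow k i j * b j + Jpow k i (j + 1) * a (j + 1))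
      + c (i + 1) * (Jpow k (i + 1) (j - 1) * c j + Jpow k (i + 1) j * b j + Jpow k (i + 1) (j + 1) * a (j + 1))"
    by (simp only: mat_power_Suc_left[of "Suc k" i j] Suc.IH)
  also have "\<dots> = Jpow (Suc k) i (j - 1) * c j + Jpow (Suc k) i j * b j + Jpow (Suc k) i (j + 1) * a (j + 1)"
    by (simp only: mat_power_Suc_left[of k]) (simp add: algebra_simps)
  finally show ?case .
qed

lemma mat_power_band: "int k < \<bar>i - j\<bar> \<Longrightarrow> Jpow k i j = 0"
proof (induction k arbitrary: i j)
  case (Suc k)
  then show ?case unfolding mat_power_Suc_left by simp
qed (auto simp: mat_one_def)

lemma mat_power_top: "Jpow k i (i + int k) = (\<Prod>m<k. c (i + 1 + int m))"
proof (induction k arbitrary: i)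
  case (Suc k)
  have "Jpow (Suc k) i (i + int (Suc k)) = c (i + 1) * Jpow k (i + 1) (i + 1 + int k)"
    unfolding mat_power_Suc_left by (simp add: mat_power_band add_ac)
  also have "\<dots> = (\<Prod>m<Suc k. c (i + 1 + int m))"
    by (simp only: Suc prod.lessThan_Suc_shift) (simp add: add_ac)
  finally show ?case .
qed (auto simp: mat_one_def)

lemma mat_power_bottom: "Jpow k i (i - int k) = (\<Prod>m<k. a (i - int m))"
proof (induction k arbitrary: i)
  case (Suc k)
  have "Jpow (Suc k) i (i - int (Suc k)) = a i * Jpow k (i - 1) (i - 1 - int k)"
    unfolding mat_power_Suc_left by (simp add: mat_power_band diff_diff_eq add_ac)
  also have "\<dots> = (\<Prod>m<Suc k. a (i - int m))"
    by (simp only: Suc prod.lessThan_Suc_shift) (simp add: diff_diff_eq add_ac)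
  finally show ?case .
qed (auto simp: mat_one_def)

text \<open>The hypothesis makes diag(d) J symmetric. Then J is symmetric for the bilinear form with
  weight d, and so is every power; this later moves identities from above the diagonal to below
  it.\<close>

lemma mat_power_symmetric:
  assumes d: "\<And>i. d i * c (i + 1) = d (i + 1) * a (i + 1)"
  shows "d i * Jpow k i j = d j * Jpow k j i"
proof (induction k arbitrary: i j)
  case (Suc k)
  have d': "d i * a i = d (i - 1) * c i" using d[of "i - 1"] by simp
  have "d i * Jpow (Suc k) i j = (d i * a i) * Jpow k (i - 1) j + b i * (d i * Jpow k i j) + (d i * c (i + 1)) * Jpow k (i + 1) j"
    unfolding mat_power_Suc_left by (simp add: algebra_simps)
  also have "\<dots> = c i * (d (i - 1) * Jpow k (i - 1) j) + b i * (d i * Jpow k i j) + a (i + 1) * (d (i + 1) * Jpow k (i + 1) j)"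
    unfolding d d' by (simp add: algebra_simps)
  also have "\<dots> = d j * Jpow (Suc k) j i"
    unfolding Suc.IH[of "i - 1" j] Suc.IH[of i j] Suc.IH[of "i + 1" j] mat_power_Suc_right by (simp add: algebra_simps)
  finally show ?case .
qed (auto simp: mat_one_def)

lemma mat_apply_power:
  assumes "finite F" "{i - int k..i + int k} \<subseteq> F"
  shows "((mat_apply (jacobi_matrix a b c)) ^^ k) x i = (\<Sum>j\<in>F. Jpow k i j * x j)"
  using assms
proof (induction k arbitrary: i F)
  case 0
  have "(\<Sum>j\<in>F. Jpow 0 i j * x j) = (\<Sum>j\<in>F. if i = j then x j else 0)"
    by (intro sum.cong) (auto simp: mat_one_def)
  then show ?case using 0 by (simp add: sum.delta)
next
  case (Suc k)
  have sub: "{i - 1 - int k..i - 1 + int k} \<subseteq> F" "{i - int k..i + int k} \<subseteq> F"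
    "{i + 1 - int k..i + 1 + int k} \<subseteq> F" using Suc.prems(2) by auto
  have "((mat_apply (jacobi_matrix a b c)) ^^ Suc k) x i =
      a i * (\<Sum>j\<in>F. Jpow k (i - 1) j * x j) + b i * (\<Sum>j\<in>F. Jpow k i j * x j) + c (i + 1) * (\<Sum>j\<in>F. Jpow k (i + 1) j * x j)"
    by (simp add: mat_apply_jacobi Suc.IH[OF Suc.prems(1) sub(1)] Suc.IH[OF Suc.prems(1) sub(2)]
        Suc.IH[OF Suc.prems(1) sub(3)])
  also have "\<dots> = (\<Sum>j\<in>F. Jpow (Suc k) i j * x j)"
    unfolding mat_power_Suc_left by (simp add: sum_distrib_left sum.distrib algebra_simps)
  finally show ?case .
qed

lemma poly_op_jacobi:
  assumes "finite F" "{i - int (degree Q)..i + int (degree Q)} \<subseteq> F"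
  shows "poly_op Q (mat_apply (jacobi_matrix a b c)) x i = (\<Sum>j\<in>F. mat_poly Q (jacobi_matrix a b c) i j * x j)"
proof -
  have "poly_op Q (mat_apply (jacobi_matrix a b c)) x i = (\<Sum>k\<le>degree Q. coeff Q k * (\<Sum>j\<in>F. Jpow k i j * x j))"
    unfolding poly_op_def
    by (intro sum.cong arg_cong2[where f = "(*)"] mat_apply_power assms order_trans[OF _ assms(2)]) auto
  also have "\<dots> = (\<Sum>k\<le>degree Q. \<Sum>j\<in>F. coeff Q k * Jpow k i j * x j)"
    by (simp add: sum_distrib_left mult.assoc)
  also have "\<dots> = (\<Sum>j\<in>F. \<Sum>k\<le>degree Q. coeff Q k * Jpow k i j * x j)" by (rule sum.swap)
  also have "\<dots> = (\<Sum>j\<in>F. mat_poly Q (jacobi_matrix a b c) i j * x j)"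
    unfolding mat_poly_def by (simp add: sum_distrib_right)
  finally show ?thesis .
qed

lemma mat_poly_top:
  "mat_poly Q (jacobi_matrix a b c) i (i + int (degree Q)) = lead_coeff Q * (\<Prod>m<degree Q. c (i + 1 + int m))"
proof -
  have "mat_poly Q (jacobi_matrix a b c) i (i + int (degree Q)) =
      (\<Sum>k\<in>{degree Q}. coeff Q k * Jpow k i (i + int (degree Q)))"
    unfolding mat_poly_def by (rule sum.mono_neutral_right) (auto simp: mat_power_band)
  then show ?thesis by (simp add: mat_power_top)
qed

lemma mat_poly_bottom:
  "mat_poly Q (jacobi_matrix a b c) i (i - int (degree Q)) = lead_coeff Q * (\<Prod>m<degree Q. a (i - int m))"
proof -
  have "mat_poly Q (jacobi_matrix a b c) i (i - int (degree Q)) =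
      (\<Sum>k\<in>{degree Q}. coeff Q k * Jpow k i (i - int (degree Q)))"
    unfolding mat_poly_def by (rule sum.mono_neutral_right) (auto simp: mat_power_band)
  then show ?thesis by (simp add: mat_power_bottom)
qed

text \<open>JX = XJ written entrywise with its three terms on each side, which keeps the finite sums
  explicit.\<close>

definition commuting :: "bimatrix \<Rightarrow> bool" where
  "commuting X \<longleftrightarrow> (\<forall>i j. a i * X (i - 1) j + b i * X i j + c (i + 1) * X (i + 1) j =
     X i (j - 1) * c j + X i j * b j + X i (j + 1) * a (j + 1))"

lemma commuting_power: "commuting (Jpow k)"
  unfolding commuting_def mat_power_Suc_left[symmetric] mat_power_Suc_right[symmetric] by simp

lemma commuting_diff_sum:
  assumes "commuting X"
  shows "commuting (\<lambda>i j. X i j - (\<Sum>m\<le>p. q m * Jpow m i j))"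
proof -
  have *: "a i * S (i - 1) j + b i * S i j + c (i + 1) * S (i + 1) j = S i (j - 1) * c j + S i j * b j + S i (j + 1) * a (j + 1)"
    if "S = (\<lambda>i j. \<Sum>m\<le>p. q m * Jpow m i j)" for S i j
  proof -
    have "a i * S (i - 1) j + b i * S i j + c (i + 1) * S (i + 1) j =
      (\<Sum>m\<le>p. q m * (a i * Jpow m (i - 1) j + b i * Jpow m i j + c (i + 1) * Jpow m (i + 1) j))"
      unfolding that by (simp add: sum_distrib_left sum.distrib algebra_simps)
    also have "\<dots> = (\<Sum>m\<le>p. q m * (Jpow m i (j - 1) * c j + Jpow m i j * b j + Jpow m i (j + 1) * a (j + 1)))"
      using commuting_power unfolding commuting_def by simp
    also have "\<dots> = S i (j - 1) * c j + S i j * b j + S i (j + 1) * a (j + 1)"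
      unfolding that by (simp add: sum_distrib_left sum_distrib_right sum.distrib algebra_simps)
    finally show ?thesis .
  qed
  show ?thesis using assms *[OF refl] unfolding commuting_def
    by (simp only: right_diff_distrib left_diff_distrib) (simp add: algebra_simps)
qed

text \<open>On diagonal k + 1 of JX = XJ only the outermost diagonal k of X survives. This is a
  first-order recurrence with the nonzero coefficients \<open>c\<close>, so its solutions form a
  line, and the k-th power of J spans it.\<close>

lemma commuting_leading_diagonal:
  assumes X: "commuting X" and c: "\<And>i. c i \<noteq> 0" and z: "\<And>i j. j > i + int k \<Longrightarrow> X i j = 0"
  shows "X i (i + int k) = X 0 (int k) / Jpow k 0 (int k) * Jpow k i (i + int k)"
proof -
  have nz: "Jpow k i (i + int k) \<noteq> 0" for i using c by (simp add: mat_power_top)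
  define R where "R i = X i (i + int k) / Jpow k i (i + int k)" for i
  have step: "R (i + 1) = R i" for i
  proof -
    have "c (i + 1) * Y (i + 1) (i + 1 + int k) = Y i (i + int k) * c (i + 1 + int k)"
      if "commuting Y" "\<And>i j. j > i + int k \<Longrightarrow> Y i j = 0" for Y
      using that(1)[unfolded commuting_def, rule_format, of i "i + 1 + int k"] that(2)
      by (simp add: add_ac)
    from this[OF X z] this[OF commuting_power[of k] mat_power_band]
    have "c (i + 1) * X (i + 1) (i + 1 + int k) = X i (i + int k) * c (i + 1 + int k)"
      "c (i + 1) * Jpow k (i + 1) (i + 1 + int k) = Jpow k i (i + int k) * c (i + 1 + int k)" by auto
    then have "c (i + 1) * (X (i + 1) (i + 1 + int k) * Jpow k i (i + int k)) = c (i + 1) * (Jpow k (i + 1) (i + 1 + int k) * X i (i + int k))"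
      by (simp add: mult.assoc[symmetric])
    then have "X (i + 1) (i + 1 + int k) * Jpow k i (i + int k) = Jpow k (i + 1) (i + 1 + int k) * X i (i + int k)"
      using c by simp
    then show ?thesis unfolding R_def using nz[of i] nz[of "i + 1"] by (simp add: frac_eq_eq mult.commute)
  qed
  have "R i = R 0"
  proof (induction i rule: int_induct[where k = 0])
    case (step2 i)
    then show ?case using step[of "i - 1"] by simp
  qed (auto simp: step)
  then have "X i (i + int k) / Jpow k i (i + int k) = X 0 (int k) / Jpow k 0 (int k)" by (simp add: R_def)
  then show ?thesis using nz[of i] by (simp add: field_simps)
qed

text \<open>Diagonals are removed from the top, each by a multiple of one power of J. The counter
  \<open>n\<close> is the number of treated diagonals, so at \<open>n = Suc p\<close> the main
  diagonal and everything above it agree; nothing is claimed below.\<close>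

lemma commuting_eliminate_upper:
  assumes X: "commuting X" and c: "\<And>i. c i \<noteq> 0" and z: "\<And>i j. j > i + int p \<Longrightarrow> X i j = 0"
  shows "n \<le> Suc p \<Longrightarrow> \<exists>q. \<forall>i j. j \<ge> i + int (Suc p - n) \<longrightarrow> X i j = (\<Sum>m\<le>p. q m * Jpow m i j)"
proof (induction n)
  case 0
  have "X i j = (\<Sum>m\<le>p. 0 * Jpow m i j)" if "j \<ge> i + int (Suc p - 0)" for i j using z that by simp
  then show ?case by (intro exI[of _ "\<lambda>_. 0"]) blast
next
  case (Suc n)
  define k where "k = Suc p - Suc n"
  have k: "Suc p - n = Suc k" "k \<le> p" using Suc.prems by (auto simp: k_def)
  obtain q where q: "\<And>i j. j \<ge> i + int (Suc k) \<Longrightarrow> X i j = (\<Sum>m\<le>p. q m * Jpow m i j)"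
    using Suc.IH Suc.prems k by auto
  define Y where "Y = (\<lambda>i j. X i j - (\<Sum>m\<le>p. q m * Jpow m i j))"
  have Y: "commuting Y" unfolding Y_def by (rule commuting_diff_sum[OF X])
  have Yz: "Y i j = 0" if "j > i + int k" for i j using q[of i j] that by (simp add: Y_def)
  \<comment> \<open>Changing only the coefficient of the k-th power leaves the diagonals beyond k
    intact, since that power vanishes there.\<close>
  define r where "r = Y 0 (int k) / Jpow k 0 (int k)"
  have "X i j = (\<Sum>m\<le>p. (q(k := q k + r)) m * Jpow m i j)" if j: "j \<ge> i + int k" for i j
  proof -
    have "(\<Sum>m\<le>p. (q(k := q k + r)) m * Jpow m i j) = (\<Sum>m\<le>p. q m * Jpow m i j + (if m = k then r * Jpow k i j else 0))"
      by (intro sum.cong) (auto simp: algebra_simps)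
    also have "\<dots> = (\<Sum>m\<le>p. q m * Jpow m i j) + r * Jpow k i j" using k by (simp add: sum.distrib)
    also have "\<dots> = X i j"
    proof (cases "j = i + int k")
      case True
      have "Y i (i + int k) = r * Jpow k i (i + int k)"
        unfolding r_def by (rule commuting_leading_diagonal[OF Y c Yz])
      then have "X i (i + int k) = (\<Sum>m\<le>p. q m * Jpow m i (i + int k)) + r * Jpow k i (i + int k)"
        unfolding Y_def diff_eq_eq by (simp only: add.commute)
      then show ?thesis using True by simp
    next
      case False
      then show ?thesis using Yz[of i j] j by (simp add: Y_def mat_power_band)
    qed
    finally show ?thesis by simp
  qed
  then show ?case unfolding k_def by blast
qed

end

section \<open>Naiman's theorem\<close>

lemma periodic_seq_shift:
  assumes "periodic_seq p a"
  shows "a (n + int p) = a n" "a (n - int p) = a n"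
  using assms unfolding periodic_seq_def by (auto, metis diff_add_cancel)

text \<open>The relation forces d(i)/d(i - 1) = c(i)/a(i), so d is a running product of these
  ratios. Its product over one period is 1 exactly by quasi-symmetry, and this makes d
  periodic.\<close>

lemma naiman_symmetrizer:
  assumes p: "periodic_seq p a" "periodic_seq p c" and nz: "\<And>n. a n \<noteq> 0" "\<And>n. c n \<noteq> 0"
    and qs: "quasi_symmetric p a c"
  obtains d :: bisequence where "\<And>i. d i \<noteq> 0" "\<And>i. d i * c (i + 1) = d (i + 1) * a (i + 1)" "periodic_seq p d"
proof -
  define r where "r i = c i / a i" for i
  have rnz: "r i \<noteq> 0" for i using nz by (simp add: r_def)
  define d where "d i = (if i \<ge> 0 then \<Prod>k=1..i. r k else \<Prod>k=i+1..0. inverse (r k))" for i :: int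
  have dnz: "d i \<noteq> 0" for i using rnz by (auto simp: d_def)
  have dr: "d (i + 1) = d i * r (i + 1)" for i
  proof (cases "i \<ge> 0")
    case True
    then have "{1..i + 1} = insert (i + 1) {1..i}" by auto
    then show ?thesis using True by (simp add: d_def mult.commute)
  next
    case False
    then have "{i + 1..0} = insert (i + 1) {i + 1 + 1..0}" by auto
    then show ?thesis using False rnz[of "i + 1"] by (auto simp: d_def)
  qed
  have rp: "r (n + int p) = r n" for n using periodic_seq_shift[OF p(1)] periodic_seq_shift[OF p(2)] by (simp add: r_def)
  have dp: "d (int p) = 1"
    using qs nz unfolding quasi_symmetric_def by (simp add: d_def r_def prod_dividef)
  have d0: "d 0 = 1" by (simp add: d_def)
  have "d (i + int p) = d i" for i
  proof (induction i rule: int_induct[where k = 0])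
    case base
    then show ?case using dp d0 by simp
  next
    case (step1 i)
    have "d (i + 1 + int p) = d (i + int p) * r (i + 1 + int p)" using dr[of "i + int p"] by (simp add: add_ac)
    then show ?case using step1 dr[of i] rp[of "i + 1"] by simp
  next
    case (step2 i)
    have "d (i + int p) = d (i - 1 + int p) * r (i + int p)" using dr[of "i - 1 + int p"] by (simp add: add_ac)
    moreover have "d i = d (i - 1) * r i" using dr[of "i - 1"] by simp
    ultimately have "d (i - 1 + int p) * r i = d (i - 1) * r i" using step2(2) rp[of i] by metis
    then show ?case using rnz[of i] mult_right_cancel by blast
  qed
  then have "periodic_seq p d" by (simp add: periodic_seq_def)
  moreover have "d i * c (i + 1) = d (i + 1) * a (i + 1)" for i
    unfolding dr r_def using nz by simp
  ultimately show thesis using that dnz by blast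
qed

text \<open>By periodicity J commutes with S^p + S^-p, so on and above the diagonal the latter is a
  polynomial in J of degree at most p. Both sides are symmetric for the periodic weight
  \<open>d\<close>, hence they agree below the diagonal too.\<close>

theorem naiman:
  assumes p: "p \<ge> 1" and per: "periodic_seq p a" "periodic_seq p b" "periodic_seq p c"
    and nz: "\<And>n. a n \<noteq> 0" "\<And>n. c n \<noteq> 0" and qs: "quasi_symmetric p a c"
  obtains Q where "degree Q = p" "mat_poly Q (jacobi_matrix a b c) = free_matrix p"
proof -
  note sh = periodic_seq_shift[OF per(1)] periodic_seq_shift[OF per(2)] periodic_seq_shift[OF per(3)]
  have "commuting a b c (free_matrix p)"
    unfolding commuting_def
  proof (intro allI)
    fix i j
    have "a i * free_matrix p (i - 1) j = free_matrix p i (j + 1) * a (j + 1)"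
    proof (cases "\<bar>i - 1 - j\<bar> = int p")
      case True
      then have "i = (j + 1) + int p \<or> i = (j + 1) - int p" by auto
      then have "a i = a (j + 1)" using sh by auto
      then show ?thesis by (simp add: free_matrix_def diff_diff_eq add.commute)
    qed (simp add: free_matrix_def diff_diff_eq add.commute)
    moreover have "b i * free_matrix p i j = free_matrix p i j * b j"
    proof (cases "\<bar>i - j\<bar> = int p")
      case True
      then have "i = j + int p \<or> i = j - int p" by auto
      then have "b i = b j" using sh by auto
      then show ?thesis by simp
    qed (simp add: free_matrix_def)
    moreover have "c (i + 1) * free_matrix p (i + 1) j = free_matrix p i (j - 1) * c j"
    proof (cases "\<bar>i + 1 - j\<bar> = int p")
      case True
      then have "i + 1 = j + int p \<or> i + 1 = j - int p" by auto
      then have "c (i + 1) = c j" using sh by metis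
      then show ?thesis by (simp add: free_matrix_def algebra_simps)
    qed (simp add: free_matrix_def algebra_simps)
    ultimately show "a i * free_matrix p (i - 1) j + b i * free_matrix p i j + c (i + 1) * free_matrix p (i + 1) j =
        free_matrix p i (j - 1) * c j + free_matrix p i j * b j + free_matrix p i (j + 1) * a (j + 1)"
      by simp
  qed
  from commuting_eliminate_upper[OF this nz(2), of p "Suc p"]
  obtain q where q: "\<And>i j. j \<ge> i \<Longrightarrow> free_matrix p i j = (\<Sum>m\<le>p. q m * mat_power (jacobi_matrix a b c) m i j)"
    by (auto simp: free_matrix_def)
  obtain d where d: "\<And>i. d i \<noteq> 0" "\<And>i. d i * c (i + 1) = d (i + 1) * a (i + 1)" "periodic_seq p d"
    using naiman_symmetrizer[OF per(1,3) nz qs] by blast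
  have eq: "free_matrix p i j = (\<Sum>m\<le>p. q m * mat_power (jacobi_matrix a b c) m i j)" for i j
  proof (cases "j \<ge> i")
    case False
    have "d i * free_matrix p i j = d j * free_matrix p j i"
    proof (cases "\<bar>i - j\<bar> = int p")
      case True
      then have "i = j + int p \<or> i = j - int p" by auto
      then have "d i = d j" using periodic_seq_shift[OF d(3)] by auto
      then show ?thesis by (simp add: free_matrix_def abs_minus_commute)
    qed (simp add: free_matrix_def abs_minus_commute)
    also have "\<dots> = (\<Sum>m\<le>p. q m * (d j * mat_power (jacobi_matrix a b c) m j i))"
      using q[of j i] False by (simp add: sum_distrib_left mult_ac)
    also have "\<dots> = d i * (\<Sum>m\<le>p. q m * mat_power (jacobi_matrix a b c) m i j)"
      unfolding mat_power_symmetric[where d = d and c = c and a = a and i = j and j = i, OF d(2)] by (simp add: sum_distrib_left mult_ac)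
    finally show ?thesis using d(1)[of i] by simp
  qed (use q in auto)
  define Q where "Q = (\<Sum>m\<le>p. monom (q m) m)"
  have cQ: "coeff Q m = (if m \<le> p then q m else 0)" for m
    by (simp add: Q_def coeff_sum)
  \<comment> \<open>Offset p is reached by the p-th power alone, and the free matrix has a 1 there;
    so the coefficient of degree p cannot vanish.\<close>
  have "1 = (\<Sum>m\<le>p. q m * mat_power (jacobi_matrix a b c) m 0 (int p))"
    using eq[of 0 "int p"] by (simp add: free_matrix_def)
  also have "\<dots> = (\<Sum>m\<in>{p}. q m * mat_power (jacobi_matrix a b c) m 0 (int p))"
    by (rule sum.mono_neutral_right) (auto simp: mat_power_band)
  finally have "q p \<noteq> 0" by auto
  then have deg: "degree Q = p"
    by (intro antisym degree_le le_degree) (auto simp: cQ)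
  have "mat_poly Q (jacobi_matrix a b c) = free_matrix p"
    by (intro ext) (simp add: mat_poly_def deg cQ eq)
  with deg that show thesis by blast
qed

section \<open>Power series whose coefficients decay like exp(-c sqrt n)\<close>

text \<open>Fubini for absolutely convergent double series, obtained from unordered sums over the
  product set.\<close>

lemma summable_swap:
  fixes x :: "nat \<Rightarrow> nat \<Rightarrow> 'a::banach"
  assumes "\<And>i. summable (\<lambda>j. norm (x i j))" "summable (\<lambda>i. \<Sum>j. norm (x i j))"
  shows "summable (\<lambda>i. norm (x i j))" "summable (\<lambda>j. \<Sum>i. norm (x i j))"
    "(\<Sum>i. \<Sum>j. x i j) = (\<Sum>j. \<Sum>i. x i j)"
proof -
  have inf_suminf: "infsum f UNIV = suminf f" if "summable (\<lambda>i. norm (f i))" for f :: "nat \<Rightarrow> 'b::banach"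
    using norm_summable_imp_has_sum[OF that summable_sums[OF summable_norm_cancel[OF that]]]
    by (rule infsumI)
  define y where "y = (\<lambda>ij. case ij of (i, j) \<Rightarrow> x i j)"
  have rowsum: "infsum (\<lambda>j. norm (x i j)) UNIV = (\<Sum>j. norm (x i j))" for i
    using assms(1)[of i] by (intro inf_suminf) simp
  have S: "(\<lambda>ij. norm (y ij)) summable_on (UNIV \<times> UNIV)"
    unfolding Infinite_Sum.abs_summable_on_Sigma_iff y_def prod.case
  proof (intro conjI ballI)
    fix i show "(\<lambda>j. norm (x i j)) summable_on UNIV"
      using assms(1)[of i] by (simp add: summable_on_UNIV_nonneg_real_iff)
    have "norm (\<Sum>j. norm (x i j)) = (\<Sum>j. norm (x i j))" for i
      using suminf_nonneg[OF assms(1)[of i]] by simp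
    then show "(\<lambda>i. norm (infsum (\<lambda>j. norm (x i j)) UNIV)) summable_on UNIV"
      unfolding rowsum by (subst summable_on_UNIV_nonneg_real_iff) (use assms(2) suminf_nonneg[OF assms(1)] in auto)
  qed
  have "(\<lambda>ij. norm (y (prod.swap ij))) summable_on (UNIV \<times> UNIV)"
    by (subst summable_on_reindex_bij_betw[of prod.swap "UNIV \<times> UNIV" "UNIV \<times> UNIV" "\<lambda>ij. norm (y ij)"])
       (use S in \<open>auto simp: bij_betw_def inj_on_def\<close>)
  then have sw: "(\<forall>j\<in>UNIV. (\<lambda>i. norm (x i j)) summable_on UNIV) \<and>
      (\<lambda>j. norm (infsum (\<lambda>i. norm (x i j)) UNIV)) summable_on UNIV"
    by (subst (asm) Infinite_Sum.abs_summable_on_Sigma_iff) (simp add: y_def)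
  then show c1: "summable (\<lambda>i. norm (x i j))" for j
    using summable_on_UNIV_nonneg_real_iff[of "\<lambda>i. norm (x i j)"] by auto
  have colsum: "infsum (\<lambda>i. norm (x i j)) UNIV = (\<Sum>i. norm (x i j))" for j
    using c1[of j] by (intro inf_suminf) simp
  have nn: "norm (\<Sum>i. norm (x i j)) = (\<Sum>i. norm (x i j))" for j
    using suminf_nonneg[OF c1[of j]] by simp
  show c2: "summable (\<lambda>j. \<Sum>i. norm (x i j))"
    using sw summable_on_UNIV_nonneg_real_iff[of "\<lambda>j. \<Sum>i. norm (x i j)"] nn suminf_nonneg[OF c1]
    by (simp add: colsum)
  have A: "(\<lambda>(i,j). x i j) summable_on (UNIV \<times> UNIV)"
    using abs_summable_summable[OF S] unfolding y_def .
  have "infsum (\<lambda>i. infsum (\<lambda>j. x i j) UNIV) UNIV = infsum (\<lambda>j. infsum (\<lambda>i. x i j) UNIV) UNIV"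
    using infsum_swap_banach[OF A] .
  moreover have "infsum (\<lambda>j. x i j) UNIV = (\<Sum>j. x i j)" for i by (rule inf_suminf) fact
  moreover have "infsum (\<lambda>i. x i j) UNIV = (\<Sum>i. x i j)" for j by (rule inf_suminf) fact
  moreover have "infsum (\<lambda>i. \<Sum>j. x i j) UNIV = (\<Sum>i. \<Sum>j. x i j)"
    by (rule inf_suminf, rule summable_comparison_test'[OF assms(2), of 0])
       (use summable_norm[OF assms(1)] in auto)
  moreover have "infsum (\<lambda>j. \<Sum>i. x i j) UNIV = (\<Sum>j. \<Sum>i. x i j)"
    by (rule inf_suminf, rule summable_comparison_test'[OF c2, of 0])
       (use summable_norm[OF c1] in auto)
  ultimately show "(\<Sum>i. \<Sum>j. x i j) = (\<Sum>j. \<Sum>i. x i j)" by simp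
qed

text \<open>Dividing out a zero z replaces the coefficients by g(i), the sum over k > i of a(k)
  z^(k-i-1). Since |z| is at most 1, the hockey-stick identity bounds the sum of (i choose m) |g(i)|
  by that of (k choose m + 1) |a(k)|. Each zero thus raises the lower index by one, and zeros on the
  unit circle are treated like interior ones.\<close>

lemma power_series_zeros_bound:
  fixes a :: "nat \<Rightarrow> complex"
  assumes "\<And>m. summable (\<lambda>k. real (k choose m) * norm (a k))"
    and "finite Z" "Z \<subseteq> cball 0 1" "\<And>z. z \<in> Z \<Longrightarrow> (\<Sum>k. a k * z ^ k) = 0" and "norm \<kappa> \<le> 1"
  shows "norm (\<Sum>k. a k * \<kappa> ^ k) \<le> (\<Sum>k. real (k choose card Z) * norm (a k)) * (\<Prod>z\<in>Z. norm (\<kappa> - z))"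
  using assms(2,1,3,4)
proof (induction Z arbitrary: a rule: finite_induct)
  case empty
  have sa: "summable (\<lambda>k. norm (a k))" using empty(1)[of 0] by simp
  have "norm (\<Sum>k. a k * \<kappa> ^ k) \<le> (\<Sum>k. norm (a k))"
    using assms(5) by (intro norm_suminf_le sa)
      (simp add: norm_mult norm_power mult_left_le power_le_one)
  then show ?case by simp
next
  case (insert z Z)
  have sa: "summable (\<lambda>k. norm (a k))" using insert(4)[of 0] by simp
  have nz: "norm z \<le> 1" using insert by auto
  \<comment> \<open>\<open>x i k\<close> is the contribution of a(k) to the i-th coefficient of the
    quotient, from w^k - z^k = (w - z) times the sum of z^(k-1-i) w^i.\<close>
  define x where "x i k = (if i < k then a k * z ^ (k - Suc i) else 0)" for i k :: nat
  define g where "g i = (\<Sum>k. x i k)" for i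
  define t where "t i k = (if i < k then norm (a k) else 0)" for i k :: nat
  have xt: "norm (x i k) \<le> t i k" for i k
    using nz by (auto simp: x_def t_def norm_mult norm_power mult_left_le power_le_one)
  have st: "summable (t i)" for i
    by (rule summable_comparison_test'[OF sa, of 0]) (auto simp: t_def)
  have sx: "summable (\<lambda>k. norm (x i k))" for i
    by (rule summable_comparison_test'[OF st, of 0]) (use xt in auto)
  have gt: "norm (g i) \<le> suminf (t i)" for i
    unfolding g_def by (intro norm_suminf_le st xt)
  have hockey: "(\<Sum>i<k. real (i choose m)) = real (k choose Suc m)" for k m
    by (induction k) auto
  have part: "(\<Sum>i<n. real (i choose m) * suminf (t i)) \<le> (\<Sum>k. real (k choose Suc m) * norm (a k))" for n m
  proof -
    have "(\<Sum>i<n. real (i choose m) * suminf (t i)) = (\<Sum>i<n. \<Sum>k. real (i choose m) * t i k)"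
      by (simp add: suminf_mult[OF st])
    also have "\<dots> = (\<Sum>k. \<Sum>i<n. real (i choose m) * t i k)"
      by (rule suminf_sum[symmetric]) (intro summable_mult st)
    also have "\<dots> \<le> (\<Sum>k. real (k choose Suc m) * norm (a k))"
    proof (intro suminf_le summable_sum summable_mult st insert(4))
      fix k
      have "(\<Sum>i<n. real (i choose m) * t i k) = (\<Sum>i\<in>{..<n} \<inter> {..<k}. real (i choose m) * norm (a k))"
        by (rule sum.mono_neutral_cong_right) (auto simp: t_def)
      also have "\<dots> \<le> (\<Sum>i<k. real (i choose m) * norm (a k))"
        by (rule sum_mono2) auto
      also have "\<dots> = real (k choose Suc m) * norm (a k)"
        by (simp add: hockey flip: sum_distrib_right)
      finally show "(\<Sum>i<n. real (i choose m) * t i k) \<le> real (k choose Suc m) * norm (a k)" .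
    qed
    finally show ?thesis .
  qed
  have tnn: "0 \<le> suminf (t i)" for i by (intro suminf_nonneg st) (auto simp: t_def)
  have sT: "summable (\<lambda>i. real (i choose m) * suminf (t i))" for m
  proof (rule bounded_imp_summable)
    show "(\<Sum>i\<le>n. real (i choose m) * suminf (t i)) \<le> (\<Sum>k. real (k choose Suc m) * norm (a k))" for n
      using part[where n = "Suc n" and m = m] by (simp only: lessThan_Suc_atMost)
  qed (use tnn in auto)
  have sg: "summable (\<lambda>i. real (i choose m) * norm (g i))" for m
    by (rule summable_comparison_test'[OF sT, of 0]) (use gt in \<open>auto intro!: mult_left_mono\<close>)
  have Sg: "(\<Sum>i. real (i choose m) * norm (g i)) \<le> (\<Sum>k. real (k choose Suc m) * norm (a k))" for m
  proof -
    have "(\<Sum>i. real (i choose m) * norm (g i)) \<le> (\<Sum>i. real (i choose m) * suminf (t i))"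
      by (intro suminf_le sg sT mult_left_mono gt) auto
    also have "\<dots> \<le> (\<Sum>k. real (k choose Suc m) * norm (a k))"
      by (intro suminf_le_const sT part)
    finally show ?thesis .
  qed
  have sak: "summable (\<lambda>k. a k * w ^ k)" if "norm w \<le> 1" for w
    by (rule summable_comparison_test'[OF sa, of 0])
       (use that in \<open>simp add: norm_mult norm_power mult_left_le power_le_one\<close>)
  have factor: "(\<Sum>k. a k * w ^ k) = (w - z) * (\<Sum>i. g i * w ^ i)" if w: "norm w \<le> 1" for w
  proof -
    have "(\<Sum>k. a k * w ^ k) = (\<Sum>k. a k * w ^ k) - (\<Sum>k. a k * z ^ k)"
      using insert(6)[of z] by simp
    also have "\<dots> = (\<Sum>k. a k * w ^ k - a k * z ^ k)"
      by (intro suminf_diff sak w nz)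
    also have "\<dots> = (\<Sum>k. (w - z) * (\<Sum>i. x i k * w ^ i))"
    proof (rule suminf_cong)
      fix k
      have "(\<Sum>i. x i k * w ^ i) = (\<Sum>i<k. x i k * w ^ i)"
        by (rule suminf_finite) (auto simp: x_def)
      also have "(w - z) * \<dots> = a k * ((w - z) * (\<Sum>i<k. z ^ (k - Suc i) * w ^ i))"
        by (simp add: x_def sum_distrib_left mult_ac)
      also have "\<dots> = a k * (w ^ k - z ^ k)"
        by (simp only: power_diff_sumr2)
      finally show "a k * w ^ k - a k * z ^ k = (w - z) * (\<Sum>i. x i k * w ^ i)"
        by (simp add: algebra_simps)
    qed
    finally have 1: "(\<Sum>k. a k * w ^ k) = (\<Sum>k. (w - z) * (\<Sum>i. x i k * w ^ i))" .
    have b: "norm (x i k * w ^ i) \<le> t i k" for i k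
      using mult_mono[OF xt[of i k], of "norm w ^ i" 1] w by (simp add: norm_mult norm_power power_le_one t_def split: if_splits)
    have s1: "summable (\<lambda>k. norm (x i k * w ^ i))" for i
      by (rule summable_comparison_test'[OF st, of 0]) (use b in auto)
    have s2: "summable (\<lambda>i. \<Sum>k. norm (x i k * w ^ i))"
      by (rule summable_comparison_test'[OF sT[of 0], of 0])
         (use suminf_le[OF b s1 st] in \<open>auto simp: suminf_nonneg s1\<close>)
    have "(\<Sum>k. (w - z) * (\<Sum>i. x i k * w ^ i)) = (w - z) * (\<Sum>k. (\<Sum>i. x i k * w ^ i))"
      by (rule suminf_mult, rule summable_comparison_test'[OF summable_swap(2)[OF s1 s2], of 0])
         (use summable_norm[OF summable_swap(1)[OF s1 s2]] in auto)
    also have "(\<Sum>k. (\<Sum>i. x i k * w ^ i)) = (\<Sum>i. (\<Sum>k. x i k * w ^ i))"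
      by (rule summable_swap(3)[OF s1 s2, symmetric])
    also have "\<dots> = (\<Sum>i. g i * w ^ i)"
      unfolding g_def by (intro suminf_cong suminf_mult2[symmetric] summable_norm_cancel[OF sx])
    finally show ?thesis using 1 by simp
  qed
  have gZ: "(\<Sum>k. g k * y ^ k) = 0" if "y \<in> Z" for y
    using factor[of y] insert(6)[of y] insert(5) insert(2) that by auto
  have "norm (\<Sum>k. a k * \<kappa> ^ k) = norm (\<kappa> - z) * norm (\<Sum>k. g k * \<kappa> ^ k)"
    by (simp add: factor[OF assms(5)] norm_mult)
  also have "\<dots> \<le> norm (\<kappa> - z) * ((\<Sum>k. real (k choose card Z) * norm (g k)) * (\<Prod>z\<in>Z. norm (\<kappa> - z)))"
    using insert(5) gZ sg by (intro mult_left_mono insert.IH) auto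
  also have "\<dots> \<le> norm (\<kappa> - z) * ((\<Sum>k. real (k choose Suc (card Z)) * norm (a k)) * (\<Prod>z\<in>Z. norm (\<kappa> - z)))"
    by (intro mult_left_mono mult_right_mono Sg prod_nonneg) auto
  also have "\<dots> = (\<Sum>k. real (k choose card (insert z Z)) * norm (a k)) * (\<Prod>z\<in>insert z Z. norm (\<kappa> - z))"
    using insert by simp
  finally show ?case .
qed

text \<open>A Phragmen-Lindelof argument: after \<open>w = 2 / (1 - z)\<close> the disc is the
  half-plane Re w > 1 and f decays exponentially in |w| in every direction. A suitable multiplier
  converts this decay into an arbitrarily strong bound at the centre.\<close>

lemma flat_at_boundary_imp_zero:
  assumes cont: "continuous_on (cball 0 1) f" and hol: "f holomorphic_on ball 0 1"
    and a: "a > 0" and bd: "\<And>z. norm z \<le> 1 \<Longrightarrow> z \<noteq> 1 \<Longrightarrow> norm (f z) \<le> C * exp (- a / norm (z - 1))"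
  shows "f 0 = 0"
proof -
  \<comment> \<open>With an argument of modulus at most 2, the multiplier grows at most like exp(2 b
    |w|) on the boundary, and 2 b |w| = a/|z - 1| is exactly what the decay of f pays for.\<close>
  define b where "b = a / 4"
  have b: "b > 0" using a by (simp add: b_def)
  have C: "C \<ge> 0" using order_trans[OF norm_ge_zero bd[of 0]] by (simp add: zero_le_mult_iff)
  define w where "w z = 2 / (1 - z)" for z :: complex
  have wRe: "Re (w z) = 1 + (1 - (norm z)\<^sup>2) / (norm (1 - z))\<^sup>2" if "z \<noteq> 1" for z
  proof -
    have "(norm (1 - z))\<^sup>2 = 1 - 2 * Re z + (norm z)\<^sup>2"
      by (simp only: cmod_power2) (simp add: power2_eq_square algebra_simps)
    moreover have "Re (w z) = 2 * (1 - Re z) / (norm (1 - z))\<^sup>2"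
      unfolding w_def by (subst Re_divide) (simp add: cmod_power2)
    moreover have "(norm (1 - z))\<^sup>2 \<noteq> 0" using that by simp
    ultimately show ?thesis by (simp add: field_simps)
  qed
  have key: "norm (f 0) \<le> C * exp (- b * (K - 2 * ln 2))" if K: "K \<ge> 0" for K
  proof -
    \<comment> \<open>The term \<open>(w z - 1) * K\<close> has real part 0 on the unit circle and K
      at the centre, up to the factor b. Far out it would explode; \<open>- w z * Ln (w z)\<close>
      compensates by decaying superexponentially along the real axis, and on the vertical line Re w
      = 1 it costs only exponential growth in |w|.\<close>
    define g where "g z = f z * exp (of_real b * ((w z - 1) * of_real K - w z * Ln (w z)))" for z
    \<comment> \<open>On the small circle around 1 this gives |w| = 2/\<epsilon>, at least exp K, so
      ln |w| is at least K and the logarithmic term dominates there. The cap 1/2 keeps 0 outside the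
      removed disc.\<close>
    define \<epsilon> where "\<epsilon> = min (2 * exp (- K)) (1/2)"
    have e: "\<epsilon> > 0" "\<epsilon> < 1" by (auto simp: \<epsilon>_def min_def)
    define S where "S = ball 0 1 - cball (1::complex) \<epsilon>"
    have opS: "open S" unfolding S_def by auto
    have w1: "Re (w z) \<ge> 1" if "norm z \<le> 1" "z \<noteq> 1" for z
      using that by (simp add: wRe power_le_one)
    have Gb: "norm (g z) \<le> C" if z: "norm z \<le> 1" "z \<noteq> 1" and zz: "norm z = 1 \<or> norm (z - 1) = \<epsilon>" for z
    proof -
      have r: "Re (w z) \<ge> 1" using w1 z by auto
      then have r': "norm (w z) \<ge> 1" using complex_Re_le_cmod[of "w z"] by linarith
      then have w0: "w z \<noteq> 0" by auto
      have arg: "\<bar>Im (Ln (w z))\<bar> \<le> 2"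
        using Re_Ln_pos_lt[OF w0] r pi_less_4 by auto
      have "Re (w z * Ln (w z)) = Re (w z) * ln (norm (w z)) - Im (w z) * Im (Ln (w z))"
        using w0 by (simp add: Re_Ln)
      moreover have "Im (w z) * Im (Ln (w z)) \<le> norm (w z) * 2"
      proof -
        have "\<bar>Im (w z) * Im (Ln (w z))\<bar> \<le> norm (w z) * 2"
          unfolding abs_mult by (intro mult_mono abs_Im_le_cmod arg) auto
        then show ?thesis by linarith
      qed
      ultimately have R: "- Re (w z * Ln (w z)) \<le> 2 * norm (w z) - Re (w z) * ln (norm (w z))" by linarith
      have "K * (Re (w z) - 1) - Re (w z) * ln (norm (w z)) \<le> 0"
      proof (cases "norm z = 1")
        case True
        then show ?thesis using r' z by (simp add: wRe)
      next
        case False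
        then have "norm (w z) = 2 / \<epsilon>" using zz by (simp add: w_def norm_divide norm_minus_commute)
        moreover have "exp K \<le> 2 / \<epsilon>" using e
          by (simp add: \<epsilon>_def min_def exp_minus field_simps split: if_splits)
        ultimately have "K \<le> ln (norm (w z))" by (metis ln_ge_iff w0 zero_less_norm_iff)
        then have "K * Re (w z) \<le> Re (w z) * ln (norm (w z))" using r
          by (simp add: mult.commute mult_left_mono)
        then show ?thesis using K by (simp add: algebra_simps)
      qed
      with R have "(Re (w z) - 1) * K - Re (w z * Ln (w z)) \<le> 2 * norm (w z)" by (simp add: mult.commute)
      then have "b * ((Re (w z) - 1) * K - Re (w z * Ln (w z))) \<le> b * (2 * norm (w z))"
        using b by (intro mult_left_mono) auto
      also have "b * (2 * norm (w z)) = a / norm (z - 1)"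
        by (simp add: b_def w_def norm_divide norm_minus_commute)
      finally have ex: "b * ((Re (w z) - 1) * K - Re (w z * Ln (w z))) \<le> a / norm (z - 1)" .
      have "norm (g z) = norm (f z) * exp (b * ((Re (w z) - 1) * K - Re (w z * Ln (w z))))"
        by (simp add: g_def norm_mult)
      also have "\<dots> \<le> (C * exp (- a / norm (z - 1))) * exp (a / norm (z - 1))"
        using ex C bd z by (intro mult_mono) auto
      also have "\<dots> = C" by (simp add: mult.assoc flip: exp_add)
      finally show ?thesis .
    qed
    have clS: "closure S \<subseteq> cball 0 1 - ball 1 \<epsilon>"
      by (rule closure_minimal) (auto simp: S_def)
    have clS1: "norm z \<le> 1" "z \<noteq> 1" if "z \<in> closure S" for z using that clS e by auto
    have Ln_cont: "continuous_on (closure S) g"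
    proof -
      have "w z \<notin> \<real>\<^sub>\<le>\<^sub>0" if "z \<in> closure S" for z
        using w1[OF clS1[OF that]] by (auto simp: complex_nonpos_Reals_iff)
      moreover have "1 - z \<noteq> 0" if "z \<in> closure S" for z using clS1[OF that] by auto
      moreover have "continuous_on (closure S) f" by (rule continuous_on_subset[OF cont]) (use clS1 in auto)
      ultimately show ?thesis unfolding g_def w_def
        by (intro continuous_intros) (auto simp: w_def)
    qed
    have holS: "g holomorphic_on S"
    proof -
      have sub: "S \<subseteq> closure S" by (rule closure_subset)
      have "w z \<notin> \<real>\<^sub>\<le>\<^sub>0" if "z \<in> S" for z
        using w1[OF clS1] that sub by (force simp: complex_nonpos_Reals_iff)
      moreover have "1 - z \<noteq> 0" if "z \<in> S" for z using clS1 that sub by force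
      moreover have "f holomorphic_on S" using hol by (rule holomorphic_on_subset) (auto simp: S_def)
      ultimately show ?thesis unfolding g_def w_def
        by (intro holomorphic_intros) (auto simp: w_def)
    qed
    have "norm (g 0) \<le> C"
    proof (rule maximum_modulus_frontier[of g S])
      show "g holomorphic_on interior S" using holS opS by (simp add: interior_open)
      show "continuous_on (closure S) g" by fact
      show "bounded S" by (auto simp: S_def)
      show "0 \<in> S" using e by (auto simp: S_def)
      fix z assume "z \<in> frontier S"
      then have "z \<in> closure S" "z \<notin> S" using opS by (auto simp: frontier_def interior_open)
      then show "norm (g z) \<le> C" using clS1[of z] clS
        by (intro Gb) (auto simp: S_def dist_norm norm_minus_commute)
    qed
    moreover have "norm (g 0) = norm (f 0) * exp (b * (K - 2 * ln 2))"
      by (simp add: g_def w_def norm_mult)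
    ultimately have "norm (f 0) * exp (b * (K - 2 * ln 2)) \<le> C" by simp
    moreover have "exp (- b * (K - 2 * ln 2)) = inverse (exp (b * (K - 2 * ln 2)))"
      by (simp flip: exp_minus)
    ultimately show ?thesis by (simp only:) (simp add: divide_inverse[symmetric] pos_le_divide_eq)
  qed
  have "((\<lambda>K. C * exp (- b * (K - 2 * ln 2))) \<longlongrightarrow> 0) at_top"
    using b by real_asymp
  moreover have "\<forall>\<^sub>F K in at_top. norm (f 0) \<le> C * exp (- b * (K - 2 * ln 2))"
    using eventually_ge_at_top[of 0] by eventually_elim (use key in auto)
  ultimately have "norm (f 0) \<le> 0"
    by (intro tendsto_lowerbound[where F = at_top]) auto
  then show ?thesis by simp
qed

text \<open>A weighted Wiener (Beurling) algebra of power series. The bound \<open>M\<close> on its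
  norm is carried explicitly so that infinite series of such functions can be summed; f matters only
  on the closed unit disc.\<close>

definition sqrt_decay_class :: "real \<Rightarrow> real \<Rightarrow> (complex \<Rightarrow> complex) \<Rightarrow> bool" where
  "sqrt_decay_class c M f \<longleftrightarrow> (\<exists>a. summable (\<lambda>n. norm (a n) * exp (c * sqrt (real n))) \<and>
     (\<Sum>n. norm (a n) * exp (c * sqrt (real n))) \<le> M \<and>
     (\<forall>\<kappa>. norm \<kappa> \<le> 1 \<longrightarrow> f \<kappa> = (\<Sum>n. a n * \<kappa> ^ n)))"

lemma sqrt_decay_coeff_summable:
  assumes "summable (\<lambda>n. norm (a n) * exp (c * sqrt (real n)))" "c \<ge> 0"
  shows "summable (\<lambda>n. norm (a n))"
  by (rule summable_comparison_test'[OF assms(1), of 0])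
     (use assms(2) in \<open>auto simp: mult_le_cancel_left1\<close>)

lemma abs_summable_power_series:
  fixes a :: "nat \<Rightarrow> complex"
  assumes "summable (\<lambda>n. norm (a n))" "norm z \<le> 1"
  shows "summable (\<lambda>n. a n * z ^ n)"
  by (rule summable_comparison_test'[OF assms(1), of 0])
     (use assms(2) in \<open>simp add: norm_mult norm_power mult_left_le power_le_one\<close>)

lemma sqrt_decay_class_regular:
  assumes "sqrt_decay_class c M f" "c \<ge> 0"
  shows "continuous_on (cball 0 1) f" "f holomorphic_on ball 0 1"
proof -
  obtain a where a: "summable (\<lambda>n. norm (a n) * exp (c * sqrt (real n)))"
    and f: "\<And>\<kappa>. norm \<kappa> \<le> 1 \<Longrightarrow> f \<kappa> = (\<Sum>n. a n * \<kappa> ^ n)"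
    using assms(1) unfolding sqrt_decay_class_def by blast
  note sa = sqrt_decay_coeff_summable[OF a assms(2)]
  have "uniform_limit (cball 0 1) (\<lambda>n \<kappa>. \<Sum>i<n. a i * \<kappa> ^ i) (\<lambda>\<kappa>. \<Sum>i. a i * \<kappa> ^ i) sequentially"
    by (rule Weierstrass_m_test[OF _ sa]) (simp add: norm_mult norm_power mult_left_le power_le_one)
  then have "continuous_on (cball 0 1) (\<lambda>\<kappa>. \<Sum>i. a i * \<kappa> ^ i)"
    by (rule uniform_limit_theorem[rotated]) (auto intro!: always_eventually continuous_intros)
  then show "continuous_on (cball 0 1) f"
    by (subst continuous_on_cong[OF refl f]) auto
  show "f holomorphic_on ball 0 1"
  proof (rule power_series_holomorphic)
    fix w :: complex assume "w \<in> ball 0 1"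
    then show "(\<lambda>n. a n * (w - 0) ^ n) sums f w"
      using summable_sums[OF abs_summable_power_series[OF sa, of w]] by (simp add: f)
  qed
qed

text \<open>(k choose n) is at most k^n / n!, and k^n = (sqrt k)^(2n) is controlled by the term of
  index 2n of the series of exp(c sqrt k). As (2n)! is at most 4^n n!^2, one n! remains, and this
  order of growth is what produces the rate exp(-a/d) later.\<close>

lemma choose_le_exp_sqrt:
  assumes c: "c > 0"
  shows "real (k choose n) \<le> (4 / c\<^sup>2 * real n) ^ n * exp (c * sqrt (real k))"
proof (cases "n = 0")
  case False
  have "(k choose n) * fact n \<le> k ^ n"
  proof (cases "n \<le> k")
    case True
    then have "fact k = ((k choose n) * fact n) * fact (k - n)"
      using binomial_fact_lemma[OF True] by (simp only: mult_ac)
    then have "(k choose n) * fact n = fact k div fact (k - n)" by simp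
    then show ?thesis using fact_div_fact_le_pow[OF True] by simp
  qed (simp add: binomial_eq_0)
  then have "real ((k choose n) * fact n) \<le> real (k ^ n)" by (simp only: of_nat_le_iff)
  then have "real (k choose n) * fact n \<le> real k ^ n" by simp
  also have "real k ^ n = (sqrt (real k)) ^ (2 * n)"
    by (simp add: power_mult)
  also have "\<dots> \<le> fact (2 * n) / c ^ (2 * n) * exp (c * sqrt (real k))"
  proof -
    have "(c * sqrt (real k)) ^ (2 * n) /\<^sub>R fact (2 * n) \<le> exp (c * sqrt (real k))"
      unfolding exp_def using summable_exp_generic[of "c * sqrt (real k)"] c
      by (intro order_trans[OF _ sum_le_suminf[where I = "{2 * n}"]]) auto
    then show ?thesis using c by (simp add: field_simps power_mult_distrib)
  qed
  also have "fact (2 * n) \<le> 4 ^ n * fact n * (fact n :: real)"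
  proof -
    have "real ((2 * n) choose n) \<le> 4 ^ n"
      using of_nat_mono[OF binomial_le_pow2[of "2*n" n], where 'a = real] by (simp add: power_mult)
    then have "real ((2 * n) choose n) * (fact n * fact n) \<le> 4 ^ n * (fact n * fact n)"
      by (intro mult_right_mono) auto
    moreover have "real ((2 * n) choose n) * (fact n * fact n) = fact (2 * n)"
      by (subst binomial_fact) auto
    ultimately show ?thesis by (simp only: mult.assoc)
  qed
  finally have "real (k choose n) * fact n \<le> (4 ^ n * fact n * fact n) / c ^ (2 * n) * exp (c * sqrt (real k))"
    using c by (simp add: divide_right_mono mult_right_mono)
  then have "real (k choose n) * fact n \<le> (4 ^ n * fact n / c ^ (2 * n) * exp (c * sqrt (real k))) * fact n"
    by (simp only: mult_ac times_divide_eq_right times_divide_eq_left)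
  then have "real (k choose n) \<le> 4 ^ n * fact n / c ^ (2 * n) * exp (c * sqrt (real k))"
    by (rule mult_right_le_imp_le) simp
  also have "\<dots> \<le> 4 ^ n * real n ^ n / c ^ (2 * n) * exp (c * sqrt (real k))"
    using c fact_le_power[of n] by (intro mult_right_mono divide_right_mono mult_left_mono) auto
  also have "4 ^ n * real n ^ n / c ^ (2 * n) = (4 / c\<^sup>2 * real n) ^ n"
    by (simp add: power_mult_distrib power_divide power_mult)
  finally show ?thesis .
qed (use c in auto)

lemma sqrt_decay_class_zeros_bound:
  assumes f: "sqrt_decay_class c M f" and c: "c > 0"
    and Z: "finite Z" "Z \<subseteq> cball 0 1" "\<And>z. z \<in> Z \<Longrightarrow> f z = 0" and z: "norm z \<le> 1"
  shows "norm (f z) \<le> (4 / c\<^sup>2 * real (card Z)) ^ card Z * M * (\<Prod>y\<in>Z. norm (z - y))"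
proof -
  obtain a where a: "summable (\<lambda>n. norm (a n) * exp (c * sqrt (real n)))"
    and aM: "(\<Sum>n. norm (a n) * exp (c * sqrt (real n))) \<le> M"
    and f: "\<And>\<kappa>. norm \<kappa> \<le> 1 \<Longrightarrow> f \<kappa> = (\<Sum>n. a n * \<kappa> ^ n)"
    using f unfolding sqrt_decay_class_def by blast
  define A where "A m = (4 / c\<^sup>2 * real m) ^ m" for m
  have A: "A m \<ge> 0" for m by (simp add: A_def)
  have b: "real (k choose m) * norm (a k) \<le> A m * (norm (a k) * exp (c * sqrt (real k)))" for m k
    using mult_right_mono[OF choose_le_exp_sqrt[OF c, of k m] norm_ge_zero[of "a k"]]
    by (simp add: A_def mult_ac)
  have s: "summable (\<lambda>k. real (k choose m) * norm (a k))" for m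
    by (rule summable_comparison_test'[OF summable_mult[OF a, of "A m"], of 0]) (use b in auto)
  have "norm (f z) \<le> (\<Sum>k. real (k choose card Z) * norm (a k)) * (\<Prod>y\<in>Z. norm (z - y))"
    unfolding f[OF z] using Z z f by (intro power_series_zeros_bound s) (auto simp: subset_iff)
  also have "(\<Sum>k. real (k choose card Z) * norm (a k)) \<le> (\<Sum>k. A (card Z) * (norm (a k) * exp (c * sqrt (real k))))"
    by (intro suminf_le b s summable_mult a)
  also have "\<dots> = A (card Z) * (\<Sum>k. norm (a k) * exp (c * sqrt (real k)))"
    by (rule suminf_mult[OF a])
  also have "\<dots> \<le> A (card Z) * M" by (intro mult_left_mono aM A)
  finally show ?thesis by (simp add: A_def mult_right_mono prod_nonneg)
qed

text \<open>For every n there are n zeros closer to \<zeta> than z is, each contributing a factor at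
  most 2 |z - \<zeta>|. They play the role of n vanishing derivatives at \<zeta>; choosing n by the
  distance gives the flatness that forces \<open>f 0 = 0\<close>.\<close>

lemma sqrt_decay_class_accumulating_zeros:
  assumes f: "sqrt_decay_class c M f" and c: "c > 0"
    and U: "U \<subseteq> ball 0 1" "\<And>z. z \<in> U \<Longrightarrow> f z = 0" and l: "\<zeta> islimpt U" and \<zeta>: "norm \<zeta> = 1"
  shows "f 0 = 0"
proof -
  have M: "M \<ge> 0"
    using f unfolding sqrt_decay_class_def by (auto intro: order_trans[OF suminf_nonneg])
  \<comment> \<open>The constant 4/c^2 of the binomial bound times the 2 from |z - y|, which is at
    most 2 |z - \<zeta>|.\<close>
  define B where "B = 8 / c\<^sup>2"
  have B: "B > 0" using c by (simp add: B_def)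
  have bd: "norm (f z) \<le> M * (B * real n * norm (z - \<zeta>)) ^ n" if z: "norm z \<le> 1" "z \<noteq> \<zeta>" for z n
  proof -
    have "infinite (U \<inter> ball \<zeta> (norm (z - \<zeta>)))"
      using l z by (simp add: islimpt_eq_infinite_ball)
    then obtain Z where Z: "Z \<subseteq> U \<inter> ball \<zeta> (norm (z - \<zeta>))" "finite Z" "card Z = n"
      by (meson infinite_arbitrarily_large)
    have "norm (f z) \<le> (4 / c\<^sup>2 * real (card Z)) ^ card Z * M * (\<Prod>y\<in>Z. norm (z - y))"
      using Z U z by (intro sqrt_decay_class_zeros_bound[OF f c]) (auto simp: subset_iff less_imp_le)
    also have "\<dots> \<le> (4 / c\<^sup>2 * real (card Z)) ^ card Z * M * (\<Prod>y\<in>Z. 2 * norm (z - \<zeta>))"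
    proof (intro mult_left_mono prod_mono conjI)
      fix y assume "y \<in> Z"
      then have "dist \<zeta> y < norm (z - \<zeta>)" using Z by auto
      then show "norm (z - y) \<le> 2 * norm (z - \<zeta>)"
        using norm_triangle_ineq[of "z - \<zeta>" "\<zeta> - y"] by (simp add: dist_norm)
    qed (use M in auto)
    also have "\<dots> = M * (B * real n * norm (z - \<zeta>)) ^ n"
      unfolding prod_constant Z(3) by (simp add: B_def power_mult_distrib power_divide) (simp flip: power_mult_distrib)
    finally show ?thesis .
  qed
  have flat: "norm (f z) \<le> (M * exp 1) * exp (- (1 / (exp 1 * B)) / norm (z - \<zeta>))"
    if z: "norm z \<le> 1" "z \<noteq> \<zeta>" for z
  proof -
    define d where "d = norm (z - \<zeta>)"
    have d: "d > 0" using z by (simp add: d_def)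
    \<comment> \<open>The near-optimal number of zeros: for n at most t one has B n d at most
      exp(-1), so the n-th power is at most exp(-n), and rounding t down loses only a factor
      e.\<close>
    define t where "t = 1 / (exp 1 * B * d)"
    have t: "t > 0" using d B by (simp add: t_def)
    define n where "n = nat \<lfloor>t\<rfloor>"
    have n: "real n \<le> t" "t < real n + 1" using t by (auto simp: n_def)
    have "B * real n * d \<le> B * t * d" using n B d by (intro mult_right_mono mult_left_mono) auto
    also have "\<dots> = exp (-1)" using B d by (simp add: t_def exp_minus field_simps)
    finally have "(B * real n * d) ^ n \<le> exp (-1) ^ n" using B d by (intro power_mono) auto
    also have "\<dots> = exp (- real n)" by (simp flip: exp_of_nat_mult)
    also have "\<dots> \<le> exp (1 - t)" using n by simp
    also have "\<dots> = exp 1 * exp (- t)" by (simp flip: exp_add)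
    finally have "(B * real n * d) ^ n \<le> exp 1 * exp (- t)" .
    then have "norm (f z) \<le> M * (exp 1 * exp (- t))"
      using order_trans[OF bd[OF z, of n] mult_left_mono[OF _ M]] unfolding d_def by blast
    then show ?thesis by (simp add: t_def d_def mult_ac)
  qed
  note reg = sqrt_decay_class_regular[OF f less_imp_le[OF c]]
  have \<zeta>0: "\<zeta> \<noteq> 0" using \<zeta> by auto
  have "(f \<circ> (\<lambda>z. \<zeta> * z)) 0 = 0"
  proof (rule flat_at_boundary_imp_zero[where a = "1 / (exp 1 * B)" and C = "M * exp 1"])
    show "continuous_on (cball 0 1) (f \<circ> (\<lambda>z. \<zeta> * z))"
      by (intro continuous_on_compose continuous_intros continuous_on_subset[OF reg(1)])
         (auto simp: norm_mult \<zeta>)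
    show "(f \<circ> (\<lambda>z. \<zeta> * z)) holomorphic_on ball 0 1"
      by (intro holomorphic_on_compose holomorphic_intros holomorphic_on_subset[OF reg(2)])
         (auto simp: norm_mult \<zeta>)
    fix z :: complex assume z: "norm z \<le> 1" "z \<noteq> 1"
    have "norm (\<zeta> * z - \<zeta>) = norm (\<zeta> * (z - 1))" by (simp add: algebra_simps)
    then have "norm (\<zeta> * z - \<zeta>) = norm (z - 1)" by (simp add: norm_mult \<zeta>)
    then show "norm ((f \<circ> (\<lambda>z. \<zeta> * z)) z) \<le> M * exp 1 * exp (- (1 / (exp 1 * B)) / norm (z - 1))"
      using flat[of "\<zeta> * z"] z \<zeta> \<zeta>0 by (simp add: norm_mult)
  qed (use B in auto)
  then show ?thesis by simp
qed

text \<open>Infinitely many zeros accumulate in the closed disc: inside, the identity theorem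
  applies, and on the circle the flatness argument does.\<close>

theorem sqrt_decay_class_finite_zeros:
  assumes f: "sqrt_decay_class c M f" and c: "c > 0" and f0: "f 0 \<noteq> 0"
  shows "finite {z. norm z < 1 \<and> f z = 0}"
proof (rule ccontr)
  define U where "U = {z. norm z < 1 \<and> f z = 0}"
  assume "infinite {z. norm z < 1 \<and> f z = 0}"
  moreover have "U \<subseteq> cball 0 1" by (auto simp: U_def)
  ultimately obtain \<zeta> where \<zeta>: "\<zeta> \<in> cball 0 1" "\<zeta> islimpt U"
    using compact_eq_Bolzano_Weierstrass[of "cball (0::complex) 1"] by (auto simp: U_def)
  show False
  proof (cases "norm \<zeta> < 1")
    case True
    have "f 0 = 0"
    proof (rule analytic_continuation[OF sqrt_decay_class_regular(2)[OF f less_imp_le[OF c]] open_ball connected_ball _ _ \<zeta>(2)])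
      show "U \<subseteq> ball 0 1" unfolding U_def by auto
      show "\<zeta> \<in> ball 0 1" using True by simp
      show "f z = 0" if "z \<in> U" for z using that by (simp add: U_def)
      show "(0::complex) \<in> ball 0 1" by simp
    qed
    then show False using f0 by simp
  next
    case False
    then have n: "norm \<zeta> = 1" using \<zeta>(1) by simp
    have "f 0 = 0"
    proof (rule sqrt_decay_class_accumulating_zeros[OF f c _ _ \<zeta>(2) n])
      show "U \<subseteq> ball 0 1" unfolding U_def by auto
      show "f z = 0" if "z \<in> U" for z using that by (simp add: U_def)
    qed
    then show False using f0 by simp
  qed
qed

text \<open>The order of vanishing is phrased through upper bounds on |f|, because a Jordan chain
  delivers an estimate of D near a point rather than an explicit factor.\<close>

lemma holomorphic_zero_order_bounded:
  assumes f: "f holomorphic_on ball 0 1" and f0: "f 0 \<noteq> 0" and z: "norm z < 1"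
  shows "\<exists>K. \<forall>k C. (\<forall>\<^sub>F w in at z. norm (f w) \<le> C * norm (w - z) ^ k) \<longrightarrow> k \<le> K"
proof (cases "f z = 0")
  case True
  have "\<not> f constant_on ball 0 1"
  proof
    assume "f constant_on ball 0 1"
    then obtain y where "\<forall>x\<in>ball 0 1. f x = y" unfolding constant_on_def by blast
    then have "f 0 = f z" using z by simp
    then show False using True f0 by simp
  qed
  then obtain g r n where n: "0 < n" and r: "0 < r" "ball z r \<subseteq> ball 0 1" and g: "g holomorphic_on ball z r"
    and fg: "\<And>w. w \<in> ball z r \<Longrightarrow> f w = (w - z) ^ n * g w" and g0: "\<And>w. w \<in> ball z r \<Longrightarrow> g w \<noteq> 0"
    using holomorphic_factor_zero_nonconstant[of f "ball 0 1" z] f z True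
    by (metis connected_ball mem_ball_0 open_ball)
  have "k \<le> n" if H: "\<forall>\<^sub>F w in at z. norm (f w) \<le> C * norm (w - z) ^ k" for k C
  proof (rule ccontr)
    assume "\<not> k \<le> n"
    then obtain m where m: "k = n + Suc m" by (metis add_Suc_right less_imp_Suc_add not_le)
    have ev: "\<forall>\<^sub>F w in at z. w \<in> ball z r - {z}"
      using r by (intro eventually_at_in_open) auto
    have "\<forall>\<^sub>F w in at z. norm (g w) \<le> C * norm (w - z) ^ Suc m"
      using H ev
    proof eventually_elim
      case (elim w)
      then have "norm (w - z) ^ n * norm (g w) \<le> norm (w - z) ^ n * (C * norm (w - z) ^ Suc m)"
        using fg[of w] by (simp add: norm_mult norm_power m power_add mult.left_commute)
      moreover have "0 < norm (w - z) ^ n" using elim by simp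
      ultimately show ?case by (simp only: mult_le_cancel_left_pos)
    qed
    moreover have "(g \<longlongrightarrow> g z) (at z)"
      using holomorphic_on_imp_continuous_on[OF g] r continuous_on_eq_continuous_at[of "ball z r" g]
      by (auto simp: isCont_def)
    then have "((\<lambda>w. norm (g w)) \<longlongrightarrow> norm (g z)) (at z)" by (rule tendsto_norm)
    moreover have "((\<lambda>w. C * norm (w - z) ^ Suc m) \<longlongrightarrow> C * norm (z - z) ^ Suc m) (at z)"
      by (intro tendsto_intros)
    ultimately have "norm (g z) \<le> C * norm (z - z) ^ Suc m"
      by (intro tendsto_le[of "at z"]) auto
    then show False using g0[of z] r by simp
  qed
  then show ?thesis by blast
next
  case False
  have "k \<le> 0" if H: "\<forall>\<^sub>F w in at z. norm (f w) \<le> C * norm (w - z) ^ k" for k C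
  proof (rule ccontr)
    assume k: "\<not> k \<le> 0"
    have "(f \<longlongrightarrow> f z) (at z)"
      using holomorphic_on_imp_continuous_on[OF f] z continuous_on_eq_continuous_at[of "ball 0 1" f]
      by (auto simp: isCont_def)
    then have "((\<lambda>w. norm (f w)) \<longlongrightarrow> norm (f z)) (at z)" by (rule tendsto_norm)
    moreover have "((\<lambda>w. C * norm (w - z) ^ k) \<longlongrightarrow> C * norm (z - z) ^ k) (at z)"
      by (intro tendsto_intros)
    ultimately have "norm (f z) \<le> C * norm (z - z) ^ k"
      using H by (intro tendsto_le[of "at z"]) auto
    then show False using False k by (simp add: power_0_left)
  qed
  then show ?thesis by blast
qed

section \<open>Continuous branches of the inverse of a polynomial\<close>

text \<open>Puiseux expansion to first order: near a zero \<open>z0\<close> of order \<open>m\<close> the polynomial \<open>P - P z0\<close> is the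
  \<open>m\<close>-th power of a local biholomorphism, whose inverse turns the \<open>m\<close> roots of \<open>s \<zeta>\<close> into branches.\<close>

lemma local_branches_at_root:
  fixes P :: "complex poly"
  assumes P: "poly P z0 = 0" "P \<noteq> 0" and \<zeta>: "norm \<zeta> = 1" and r: "r > 0"
  shows "\<exists>\<delta>>0. \<exists>\<beta>. (\<forall>k<order z0 P. continuous_on {0..\<delta>} (\<beta> k) \<and> \<beta> k 0 = z0 \<and>
     (\<forall>s\<in>{0..\<delta>}. \<beta> k s \<in> ball z0 r \<and> poly P (\<beta> k s) = of_real s * \<zeta>)) \<and>
     (\<forall>s\<in>{0<..\<delta>}. inj_on (\<lambda>k. \<beta> k s) {..<order z0 P})"
proof -
  define m where "m = order z0 P"
  have m: "m > 0" using P by (simp add: m_def order_root)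
  obtain R where R: "P = [:- z0, 1:] ^ m * R" "poly R z0 \<noteq> 0"
    using order_decomp[OF P(2), of z0] by (auto simp: m_def poly_eq_0_iff_dvd)
  have "\<exists>\<epsilon>>0. \<forall>z\<in>ball z0 \<epsilon>. poly R z \<noteq> 0"
    using continuous_at_avoid[of z0 "poly R" 0] R(2) by (auto simp: dist_commute)
  then obtain \<epsilon> where \<epsilon>: "\<epsilon> > 0" "\<And>z. z \<in> ball z0 \<epsilon> \<Longrightarrow> poly R z \<noteq> 0" by blast
  \<comment> \<open>On a ball the zero-free cofactor R has a logarithm h, so
    \<open>(z - z0) * exp (h z / m)\<close> is a holomorphic m-th root of P with nonzero derivative
    at z0.\<close>
  obtain h where h: "h holomorphic_on ball z0 \<epsilon>" "\<And>z. z \<in> ball z0 \<epsilon> \<Longrightarrow> poly R z = exp (h z)"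
  proof (rule holomorphic_logarithm_exists[of "ball z0 \<epsilon>" "poly R" z0])
    show "poly R holomorphic_on ball z0 \<epsilon>" by (intro holomorphic_intros)
  qed (use \<epsilon> in auto)
  define g where "g z = (z - z0) * exp (h z / of_nat m)" for z
  have gm: "g z ^ m = poly P z" if "z \<in> ball z0 \<epsilon>" for z
    using h(2)[OF that] m by (simp add: g_def R(1) power_mult_distrib exp_of_nat_mult[symmetric])
  have "(\<lambda>z. h z * (1 / of_nat m)) holomorphic_on ball z0 \<epsilon>"
    by (rule holomorphic_on_mult[OF h(1) holomorphic_on_const])
  from holomorphic_on_compose[OF this holomorphic_on_exp]
  have ghol: "g holomorphic_on ball z0 \<epsilon>"
    unfolding g_def comp_def by (intro holomorphic_on_mult holomorphic_on_diff holomorphic_on_ident holomorphic_on_const) simp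
  have dg: "deriv g z0 \<noteq> 0"
  proof -
    have "(h has_field_derivative deriv h z0) (at z0)"
      using holomorphic_derivI[OF h(1) open_ball] \<epsilon>(1) by simp
    then have "(g has_field_derivative exp (h z0 / of_nat m)) (at z0)"
      unfolding g_def using m by (auto intro!: derivative_eq_intros)
    then show ?thesis by (simp add: DERIV_imp_deriv)
  qed
  define \<rho>0 where "\<rho>0 = min \<epsilon> r"
  obtain \<rho> where \<rho>: "\<rho> > 0" "ball z0 \<rho> \<subseteq> ball z0 \<rho>0" "inj_on g (ball z0 \<rho>)"
  proof (rule has_complex_derivative_locally_injective[of g "ball z0 \<rho>0" z0])
    show "g holomorphic_on ball z0 \<rho>0" by (rule holomorphic_on_subset[OF ghol]) (auto simp: \<rho>0_def)
  qed (use dg \<epsilon>(1) r in \<open>auto simp: \<rho>0_def\<close>)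
  have sub: "ball z0 \<rho> \<subseteq> ball z0 \<epsilon>" "ball z0 \<rho> \<subseteq> ball z0 r" using \<rho>(2) by (auto simp: \<rho>0_def)
  have gh: "g holomorphic_on ball z0 \<rho>" using holomorphic_on_subset[OF ghol sub(1)] .
  obtain k where k: "k holomorphic_on (g ` ball z0 \<rho>)" "\<And>z. z \<in> ball z0 \<rho> \<Longrightarrow> k (g z) = z"
    by (rule holomorphic_has_inverse[OF gh open_ball \<rho>(3)]) (rule that)
  have "open (g ` ball z0 \<rho>)" using open_mapping_thm3[OF gh open_ball \<rho>(3)] .
  moreover have "0 \<in> g ` ball z0 \<rho>" using \<rho>(1) by (intro image_eqI[of _ _ z0]) (auto simp: g_def)
  ultimately obtain e where e: "e > 0" "ball 0 e \<subseteq> g ` ball z0 \<rho>" by (rule openE)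
  \<comment> \<open>Then m-th roots of parameters up to \<delta> have modulus at most e/2, inside
    the ball covered by the image of \<open>g\<close>.\<close>
  define \<delta> where "\<delta> = (e / 2) ^ m"
  have d: "\<delta> > 0" using e by (simp add: \<delta>_def)
  obtain \<zeta>' where \<zeta>': "\<zeta>' ^ m = \<zeta>" using exists_complex_root[of m \<zeta>] m by auto
  have n\<zeta>': "norm \<zeta>' = 1"
  proof (rule power_eq_imp_eq_base)
    show "norm \<zeta>' ^ m = 1 ^ m" using \<zeta> by (simp add: \<zeta>' flip: norm_power)
  qed (use m in auto)
  define \<omega> where "\<omega> j = exp (2 * of_real pi * \<i> * of_nat j / of_nat m)" for j
  have \<omega>: "\<omega> j ^ m = 1" "norm (\<omega> j) = 1" for j
    using m complex_root_unity[of m j] by (auto simp: \<omega>_def)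
  have \<omega>inj: "inj_on \<omega> {..<m}"
  proof (rule inj_onI)
    fix i j assume ij: "i \<in> {..<m}" "j \<in> {..<m}" "\<omega> i = \<omega> j"
    have "i mod m = j mod m"
      using complex_root_unity_eq[of m i j] m ij(3) by (simp add: \<omega>_def cong_def)
    then show "i = j" using ij by simp
  qed
  \<comment> \<open>The m different m-th roots of s \<zeta>, continuous in s and all meeting at 0
    when s = 0.\<close>
  define u where "u j s = complex_of_real (root m s) * (\<zeta>' * \<omega> j)" for j s
  have un: "norm (u j s) = root m s" if "s \<ge> 0" for j s
    using that m n\<zeta>' \<omega> by (simp add: u_def norm_mult)
  have um: "u j s ^ m = of_real s * \<zeta>" if "s \<ge> 0" for j s
    using that m \<zeta>' \<omega> by (simp add: u_def power_mult_distrib del: of_real_power add: of_real_power[symmetric])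
  have ue: "u j s \<in> ball 0 e" if "s \<in> {0..\<delta>}" for j s
  proof -
    have "root m s \<le> root m \<delta>" using that m by simp
    also have "\<dots> = e / 2" unfolding \<delta>_def using m e by (simp add: real_root_power_cancel)
    finally show ?thesis using un[of s j] that e by simp
  qed
  define \<beta> where "\<beta> j s = k (u j s)" for j s
  have \<beta>g: "\<beta> j s \<in> ball z0 \<rho>" "g (\<beta> j s) = u j s" if s: "s \<in> {0..\<delta>}" for j s
  proof -
    obtain z where z: "z \<in> ball z0 \<rho>" "u j s = g z" using ue[OF s, of j] e(2) by blast
    then show "\<beta> j s \<in> ball z0 \<rho>" "g (\<beta> j s) = u j s" using k(2) by (auto simp: \<beta>_def)
  qed
  have "continuous_on {0..\<delta>} (\<beta> j) \<and> \<beta> j 0 = z0 \<and>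
     (\<forall>s\<in>{0..\<delta>}. \<beta> j s \<in> ball z0 r \<and> poly P (\<beta> j s) = of_real s * \<zeta>)" for j
  proof (intro conjI ballI)
    have "continuous_on (u j ` {0..\<delta>}) k"
      proof (rule continuous_on_subset[OF holomorphic_on_imp_continuous_on[OF k(1)]])
      show "u j ` {0..\<delta>} \<subseteq> g ` ball z0 \<rho>" by (rule order_trans[OF image_subsetI[OF ue] e(2)])
    qed
    moreover have "continuous_on {0..\<delta>} (u j)" unfolding u_def by (intro continuous_intros)
    ultimately show "continuous_on {0..\<delta>} (\<beta> j)" unfolding \<beta>_def by (rule continuous_on_compose2) auto
    have "u j 0 = g z0" using m by (simp add: u_def g_def)
    then show "\<beta> j 0 = z0" using k(2)[of z0] \<rho>(1) by (simp add: \<beta>_def)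
    fix s assume s: "s \<in> {0..\<delta>}"
    show "\<beta> j s \<in> ball z0 r" by (rule subsetD[OF sub(2) \<beta>g(1)[OF s]])
    show "poly P (\<beta> j s) = of_real s * \<zeta>"
      using gm[OF subsetD[OF sub(1) \<beta>g(1)[OF s, of j]]] um[of s j] s by (simp add: \<beta>g(2)[OF s])
  qed
  moreover have "inj_on (\<lambda>j. \<beta> j s) {..<m}" if s: "s \<in> {0<..\<delta>}" for s
  proof (rule inj_onI)
    fix i j assume ij: "i \<in> {..<m}" "j \<in> {..<m}" "\<beta> i s = \<beta> j s"
    then have "u i s = u j s" using \<beta>g(2)[of s i] \<beta>g(2)[of s j] s by simp
    moreover have "root m s \<noteq> 0" "\<zeta>' \<noteq> 0" using s m n\<zeta>' by auto
    ultimately have "\<omega> i = \<omega> j" by (simp add: u_def)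
    then show "i = j" by (rule inj_onD[OF \<omega>inj _ ij(1,2)])
  qed
  ultimately show ?thesis using d unfolding m_def[symmetric] by (intro exI[of _ \<delta>] conjI exI[of _ \<beta>] allI impI ballI) simp_all
qed

text \<open>The condition of \<open>inverse_branches\<close> over an arbitrary set of parameters, so
  that it can be proved by subdividing an interval.\<close>

definition split_along :: "complex poly \<Rightarrow> (nat \<Rightarrow> real \<Rightarrow> complex) \<Rightarrow> real set \<Rightarrow> bool" where
  "split_along Q \<gamma> I \<longleftrightarrow> (\<forall>k<degree Q. continuous_on I (\<gamma> k)) \<and>
     (\<forall>t\<in>I. Q - [:complex_of_real t:] = Polynomial.smult (lead_coeff Q) (\<Prod>k<degree Q. [:- \<gamma> k t, 1:]))"

lemma prod_linear_dvd_of_distinct_roots: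
  fixes P :: "complex poly"
  assumes "finite A" "inj_on z A" "\<And>k. k \<in> A \<Longrightarrow> poly P (z k) = 0"
  shows "(\<Prod>k\<in>A. [:- z k, 1:]) dvd P"
  using assms
proof (induction A arbitrary: P rule: finite_induct)
  case (insert x A)
  obtain S where S: "P = [:- z x, 1:] * S" using insert.prems(2)[of x] by (auto simp: poly_eq_0_iff_dvd)
  have "poly S (z k) = 0" if "k \<in> A" for k
  proof -
    have "z k \<noteq> z x" using inj_onD[OF insert.prems(1), of k x] insert.hyps(2) that by auto
    then show ?thesis using insert.prems(2)[of k] that by (simp add: S)
  qed
  then have "(\<Prod>k\<in>A. [:- z k, 1:]) dvd S" using insert by (intro insert.IH) auto
  then show ?case unfolding prod.insert[OF insert.hyps] S by (rule mult_dvd_mono[OF dvd_refl])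
qed simp

lemma poly_eq_prod_of_distinct_roots:
  fixes P :: "complex poly"
  assumes "degree P = n" "n > 0" "inj_on z {..<n}" "\<And>k. k < n \<Longrightarrow> poly P (z k) = 0"
  shows "P = Polynomial.smult (lead_coeff P) (\<Prod>k<n. [:- z k, 1:])"
proof -
  have P: "P \<noteq> 0" using assms by auto
  define R where "R = (\<Prod>k<n. [:- z k, 1:])"
  have R: "lead_coeff R = 1" "degree R = n"
  proof -
    show "lead_coeff R = 1" unfolding R_def lead_coeff_prod by simp
    show "degree R = n" unfolding R_def by (subst degree_prod_eq_sum_degree) auto
  qed
  have "R dvd P"
    unfolding R_def using assms by (intro prod_linear_dvd_of_distinct_roots) auto
  then obtain S where S: "P = R * S" by blast
  have "S \<noteq> 0" "R \<noteq> 0" using P S by auto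
  then have "degree S = 0" using degree_mult_eq[of R S] S R assms(1) by simp
  then obtain s where "S = [:s:]" by (meson degree_eq_zeroE)
  then show ?thesis using S R unfolding R_def[symmetric] by (simp add: lead_coeff_mult)
qed

lemma degree_diff_const:
  fixes Q :: "complex poly"
  assumes "degree Q > 0"
  shows "degree (Q - [:c:]) = degree Q" "lead_coeff (Q - [:c:]) = lead_coeff Q" "Q - [:c:] \<noteq> 0"
proof -
  show d: "degree (Q - [:c:]) = degree Q"
    using assms by (subst diff_conv_add_uminus, subst degree_add_eq_left) auto
  then show l: "lead_coeff (Q - [:c:]) = lead_coeff Q"
    using assms by (cases "degree Q") auto
  show "Q - [:c:] \<noteq> 0" using d assms by auto
qed

text \<open>At a critical value the roots collide, and the local m-th root parametrization labels
  them only along a ray issuing from it. The two directions \<sigma> = 1 and \<sigma> = -1 are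
  therefore treated apart and matched afterwards.\<close>

lemma local_split_one_sided:
  fixes Q :: "complex poly"
  assumes n: "degree Q > 0" and \<sigma>: "\<sigma> = 1 \<or> \<sigma> = (-1::real)"
  shows "\<exists>\<delta>>0. \<exists>\<gamma>. (\<forall>k<degree Q. continuous_on {0..\<delta>} (\<gamma> k)) \<and>
     (\<forall>s\<in>{0..\<delta>}. Q - [:complex_of_real (t0 + \<sigma> * s):] = Polynomial.smult (lead_coeff Q) (\<Prod>k<degree Q. [:- \<gamma> k s, 1:]))"
proof -
  define P where "P = Q - [:complex_of_real t0:]"
  note dP = degree_diff_const[OF n, of "complex_of_real t0", folded P_def]
  define Z where "Z = {z. poly P z = 0}"
  have finZ: "finite Z" unfolding Z_def using dP(3) by (rule poly_roots_finite)
  have decomp: "Polynomial.smult (lead_coeff P) (\<Prod>z\<in>Z. [:- z, 1:] ^ order z P) = P"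
    unfolding Z_def by (rule complex_poly_decompose)
  have card: "(\<Sum>z\<in>Z. order z P) = degree Q"
  proof -
    define S where "S = (\<Prod>z\<in>Z. [:- z, 1:] ^ order z P)"
    have "lead_coeff P \<noteq> 0" using dP(3) by simp
    then have "degree P = degree S" using arg_cong[OF decomp, of degree] unfolding S_def[symmetric] by simp
    also have "\<dots> = (\<Sum>z\<in>Z. order z P)"
      unfolding S_def by (subst degree_prod_eq_sum_degree) (simp_all add: degree_linear_power)
    finally show ?thesis using dP(1) by simp
  qed
  obtain r where r: "r > 0" "\<And>x y. x \<in> Z \<Longrightarrow> y \<in> Z \<Longrightarrow> x \<noteq> y \<Longrightarrow> ball x r \<inter> ball y r = {}"
  proof -
    define D where "D = (\<lambda>(x, y). dist x y) ` {(x, y) \<in> Z \<times> Z. x \<noteq> y}"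
    have "finite {(x, y) \<in> Z \<times> Z. x \<noteq> y}"
      by (rule finite_subset[of _ "Z \<times> Z"]) (use finZ in auto)
    then have D: "finite (insert 1 D)" unfolding D_def by blast
    \<comment> \<open>Half the least distance between zeros keeps the balls disjoint; the inserted 1
      covers the case of a single zero.\<close>
    define r where "r = Min (insert 1 D) / 2"
    have "r > 0" using D unfolding r_def by (auto simp: D_def)
    moreover have "ball x r \<inter> ball y r = {}" if "x \<in> Z" "y \<in> Z" "x \<noteq> y" for x y
    proof -
      have "dist x y \<in> insert 1 D" using that unfolding D_def by force
      then have "2 * r \<le> dist x y" using D unfolding r_def by simp
      then show ?thesis by (intro disjoint_ballI) simp
    qed
    ultimately show thesis using that by blast
  qed
  define F where "F z \<delta> \<beta> \<longleftrightarrow> \<delta> > 0 \<and> (\<forall>k<order z P. continuous_on {0..\<delta>} (\<beta> k) \<and> \<beta> k 0 = z \<and>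
     (\<forall>s\<in>{0..\<delta>}. \<beta> k s \<in> ball z r \<and> poly P (\<beta> k s) = of_real s * of_real \<sigma>)) \<and>
     (\<forall>s\<in>{0<..\<delta>}. inj_on (\<lambda>k. \<beta> k s) {..<order z P})" for z \<delta> and \<beta> :: "nat \<Rightarrow> real \<Rightarrow> complex"
  have "\<exists>\<delta> \<beta>. F z \<delta> \<beta>" if "z \<in> Z" for z
    using local_branches_at_root[of P z "of_real \<sigma>" r] that \<sigma> r(1) dP(3) unfolding F_def by (auto simp: Z_def)
  then obtain \<delta> \<beta> where F: "\<And>z. z \<in> Z \<Longrightarrow> F z (\<delta> z) (\<beta> z)" by metis
  have \<delta>: "\<delta> z > 0" if "z \<in> Z" for z using F[OF that] by (simp add: F_def)
  have \<beta>c: "continuous_on {0..\<delta> z} (\<beta> z k)" and \<beta>0: "\<beta> z k 0 = z" if "z \<in> Z" "k < order z P" for z k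
    using F[OF that(1)] that(2) by (simp_all add: F_def)
  have \<beta>b: "\<beta> z k s \<in> ball z r" and \<beta>P: "poly P (\<beta> z k s) = of_real s * of_real \<sigma>"
    if "z \<in> Z" "k < order z P" "s \<in> {0..\<delta> z}" for z k s
    using F[OF that(1)] that(2,3) by (simp_all add: F_def)
  have \<beta>i: "inj_on (\<lambda>k. \<beta> z k s) {..<order z P}" if "z \<in> Z" "s \<in> {0<..\<delta> z}" for z s
    using F[OF that(1)] that(2) by (simp add: F_def)
  define d where "d = Min (insert 1 (\<delta> ` Z))"
  have d: "d > 0" "\<And>z. z \<in> Z \<Longrightarrow> d \<le> \<delta> z" using finZ \<delta> by (auto simp: d_def)
  \<comment> \<open>Pairs of a zero and a branch number at that zero. Their count is the degree, so
    they can be renumbered by 0, ..., \<open>degree Q - 1\<close>.\<close>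
  define I where "I = Sigma Z (\<lambda>z. {..<order z P})"
  have finI: "finite I" "card I = degree Q" using finZ card by (auto simp: I_def)
  then obtain e where e: "bij_betw e {..<degree Q} I"
    using ex_bij_betw_nat_finite[of I] by (metis lessThan_atLeast0)
  have eI: "e k \<in> I" if "k < degree Q" for k using e that by (auto simp: bij_betw_def)
  define \<gamma> where "\<gamma> k s = \<beta> (fst (e k)) (snd (e k)) s" for k s
  have ek: "fst (e k) \<in> Z" "snd (e k) < order (fst (e k)) P" if "k < degree Q" for k
    using eI[OF that] by (auto simp: I_def)
  show ?thesis
  proof (intro exI[of _ d] conjI exI[of _ \<gamma>] allI impI ballI d(1))
    fix k assume k: "k < degree Q"
    show "continuous_on {0..d} (\<gamma> k)"
      unfolding \<gamma>_def by (rule continuous_on_subset[OF \<beta>c[OF ek[OF k]]]) (use d(2)[OF ek(1)[OF k]] in auto)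
  next
    fix s assume s: "s \<in> {0..d}"
    define R where "R = Q - [:complex_of_real (t0 + \<sigma> * s):]"
    note dR = degree_diff_const[OF n, of "complex_of_real (t0 + \<sigma> * s)", folded R_def]
    show "Q - [:complex_of_real (t0 + \<sigma> * s):] = Polynomial.smult (lead_coeff Q) (\<Prod>k<degree Q. [:- \<gamma> k s, 1:])"
    \<comment> \<open>At s = 0 the branches repeat each zero according to its order and give the
      root decomposition of P; for s > 0 they are \<open>degree Q\<close> distinct roots, which
      determine the polynomial up to its leading coefficient.\<close>
    proof (cases "s = 0")
      case True
      have "(\<Prod>k<degree Q. [:- \<gamma> k s, 1:]) = (\<Prod>k<degree Q. [:- fst (e k), 1:])"
        using \<beta>0[OF ek] True by (intro prod.cong) (auto simp: \<gamma>_def)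
      also have "\<dots> = (\<Prod>x\<in>I. [:- fst x, 1:])" by (rule prod.reindex_bij_betw[OF e])
      also have "\<dots> = (\<Prod>z\<in>Z. \<Prod>k<order z P. [:- z, 1:])"
        unfolding I_def using finZ by (subst prod.Sigma) (auto simp: case_prod_unfold)
      also have "\<dots> = (\<Prod>z\<in>Z. [:- z, 1:] ^ order z P)" by simp
      finally show ?thesis using decomp dP True by (simp add: P_def)
    next
      case False
      then have s': "s \<in> {0<..d}" using s by auto
      have sd: "s \<in> {0..\<delta> (fst (e k))}" "s \<in> {0<..\<delta> (fst (e k))}" if "k < degree Q" for k
        using d(2)[OF ek(1)[OF that]] s' by auto
      have "R = Polynomial.smult (lead_coeff R) (\<Prod>k<degree Q. [:- \<gamma> k s, 1:])"
      proof (rule poly_eq_prod_of_distinct_roots[OF dR(1) n])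
        show "inj_on (\<lambda>k. \<gamma> k s) {..<degree Q}"
        proof (rule inj_onI)
          fix i j assume ij: "i \<in> {..<degree Q}" "j \<in> {..<degree Q}" "\<gamma> i s = \<gamma> j s"
          then have i: "i < degree Q" and j: "j < degree Q" by auto
          have "\<gamma> i s \<in> ball (fst (e i)) r" "\<gamma> j s \<in> ball (fst (e j)) r"
            unfolding \<gamma>_def by (intro \<beta>b ek i j sd)+
          then have "\<gamma> i s \<in> ball (fst (e i)) r \<inter> ball (fst (e j)) r" using ij(3) by simp
          then have f: "fst (e i) = fst (e j)" using r(2)[OF ek(1)[OF i] ek(1)[OF j]] by blast
          then have "snd (e i) = snd (e j)"
            using inj_onD[OF \<beta>i[OF ek(1)[OF i] sd(2)[OF i]], of "snd (e i)" "snd (e j)"] ij(3) ek[OF i] ek[OF j]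
            by (simp add: \<gamma>_def)
          with f have "e i = e j" by (simp add: prod_eq_iff)
          then show "i = j" using e i j by (auto simp: bij_betw_def dest: inj_onD)
        qed
        fix k assume k: "k < degree Q"
        show "poly R (\<gamma> k s) = 0"
          using \<beta>P[OF ek[OF k] sd(1)[OF k]] by (simp add: R_def P_def \<gamma>_def algebra_simps)
      qed
      then show ?thesis unfolding dR(2) unfolding R_def .
    qed
  qed
qed

text \<open>Both lists have the same multiset of values, namely the roots of the common
  product.\<close>

lemma prod_linear_eq_imp_permutes:
  fixes f g :: "nat \<Rightarrow> complex"
  assumes "(\<Prod>k<n. [:- f k, 1:]) = (\<Prod>k<n. [:- g k, 1:])"
  obtains \<pi> where "\<pi> permutes {..<n}" "\<And>k. k < n \<Longrightarrow> f k = g (\<pi> k)"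
proof -
  have pr: "proots (\<Prod>k<m. [:- h k, 1:]) = image_mset h (mset_set {..<m})" for h :: "nat \<Rightarrow> complex" and m
  proof (induction m)
    case (Suc m)
    have "proots (\<Prod>k<Suc m. [:- h k, 1:]) = proots (\<Prod>k<m. [:- h k, 1:]) + proots [:- h m, 1:]"
      by (simp only: prod.lessThan_Suc, rule proots_mult) auto
    then show ?case by (simp add: Suc lessThan_Suc)
  qed simp
  have "image_mset f (mset_set {..<n}) = image_mset g (mset_set {..<n})"
    using assms pr[of f n] pr[of g n] by simp
  then obtain \<pi> where "\<pi> permutes {..<n}" "\<forall>k\<in>{..<n}. f k = g (\<pi> k)"
    using image_mset_eq_implies_permutes[of "{..<n}" f g] by auto
  then show thesis using that by auto
qed

text \<open>At the common parameter b the two families list the same roots, possibly in another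
  order. Renumbering the right family by that permutation makes the pieces continuous and leaves its
  products unchanged.\<close>

lemma split_along_glue:
  assumes Q: "degree Q > 0" and ab: "a \<le> b" "b \<le> c"
    and 1: "split_along Q \<gamma>1 {a..b}" and 2: "split_along Q \<gamma>2 {b..c}"
  shows "\<exists>\<gamma>. split_along Q \<gamma> {a..c}"
proof -
  have lc: "lead_coeff Q \<noteq> 0" using Q by auto
  have e1: "Q - [:complex_of_real b:] = Polynomial.smult (lead_coeff Q) (\<Prod>k<degree Q. [:- \<gamma>1 k b, 1:])"
    using 1 ab unfolding split_along_def by auto
  have e2: "Q - [:complex_of_real b:] = Polynomial.smult (lead_coeff Q) (\<Prod>k<degree Q. [:- \<gamma>2 k b, 1:])"
    using 2 ab unfolding split_along_def by auto
  have inv: "Polynomial.smult (1 / lead_coeff Q) (Polynomial.smult (lead_coeff Q) X) = X" for X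
    using lc by simp
  have "(\<Prod>k<degree Q. [:- \<gamma>1 k b, 1:]) = (\<Prod>k<degree Q. [:- \<gamma>2 k b, 1:])"
    using arg_cong[OF trans[OF e1[symmetric] e2], of "Polynomial.smult (1 / lead_coeff Q)"] unfolding inv .
  then obtain \<pi> where \<pi>: "\<pi> permutes {..<degree Q}" "\<And>k. k < degree Q \<Longrightarrow> \<gamma>1 k b = \<gamma>2 (\<pi> k) b"
    by (rule prod_linear_eq_imp_permutes) blast
  have \<pi>l: "\<pi> k < degree Q" if "k < degree Q" for k using permutes_in_image[OF \<pi>(1), of k] that by simp
  define \<gamma> where "\<gamma> k t = (if t \<le> b then \<gamma>1 k t else \<gamma>2 (\<pi> k) t)" for k t
  have ac: "{a..c} = {a..b} \<union> {b..c}" using ab by auto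
  have "continuous_on {a..c} (\<gamma> k)" if k: "k < degree Q" for k
    unfolding ac \<gamma>_def
    using 1 2 k \<pi>l[OF k] \<pi>(2)[OF k] unfolding split_along_def
    by (intro continuous_on_cases) auto
  moreover have "Q - [:complex_of_real t:] = Polynomial.smult (lead_coeff Q) (\<Prod>k<degree Q. [:- \<gamma> k t, 1:])" if t: "t \<in> {a..c}" for t
  proof (cases "t \<le> b")
    case True
    then show ?thesis using 1 t unfolding split_along_def \<gamma>_def by auto
  next
    case False
    have "(\<Prod>k<degree Q. [:- \<gamma> k t, 1:]) = (\<Prod>k<degree Q. [:- \<gamma>2 (\<pi> k) t, 1:])" using False by (simp add: \<gamma>_def)
    also have "\<dots> = (\<Prod>k<degree Q. [:- \<gamma>2 k t, 1:])"
      using prod.permute[OF \<pi>(1), of "\<lambda>k. [:- \<gamma>2 k t, 1:]"] by (simp add: comp_def)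
    finally show ?thesis using 2 t False unfolding split_along_def by auto
  qed
  ultimately have "split_along Q \<gamma> {a..c}" unfolding split_along_def by blast
  then show ?thesis by blast
qed

lemma split_along_mono: "split_along Q \<gamma> I \<Longrightarrow> J \<subseteq> I \<Longrightarrow> split_along Q \<gamma> J"
  unfolding split_along_def using continuous_on_subset by blast

text \<open>Bolzano's bisection principle: the property is additive over adjacent intervals, and
  near each point it holds because the left and right one-sided families are glued there.\<close>

theorem split_along_interval:
  assumes Q: "degree Q > 0" and ab: "a \<le> b"
  shows "\<exists>\<gamma>. split_along Q \<gamma> {a..b}"
proof (rule Bolzano[OF ab, where P = "\<lambda>a b. \<exists>\<gamma>. split_along Q \<gamma> {a..b}"])
  show "\<exists>\<gamma>. split_along Q \<gamma> {a..c}"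
    if "\<exists>\<gamma>. split_along Q \<gamma> {a..b}" "\<exists>\<gamma>. split_along Q \<gamma> {b..c}" "a \<le> b" "b \<le> c" for a b c
    using split_along_glue[OF Q that(3,4)] that(1,2) by blast
  fix x :: real
  obtain d1 \<gamma>1 where d1: "d1 > 0" and \<gamma>1: "\<And>k. k < degree Q \<Longrightarrow> continuous_on {0..d1} (\<gamma>1 k)"
    "\<And>s. s \<in> {0..d1} \<Longrightarrow> Q - [:complex_of_real (x + 1 * s):] = Polynomial.smult (lead_coeff Q) (\<Prod>k<degree Q. [:- \<gamma>1 k s, 1:])"
    using local_split_one_sided[OF Q, of 1 x] by blast
  obtain d2 \<gamma>2 where d2: "d2 > 0" and \<gamma>2: "\<And>k. k < degree Q \<Longrightarrow> continuous_on {0..d2} (\<gamma>2 k)"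
    "\<And>s. s \<in> {0..d2} \<Longrightarrow> Q - [:complex_of_real (x + (-1) * s):] = Polynomial.smult (lead_coeff Q) (\<Prod>k<degree Q. [:- \<gamma>2 k s, 1:])"
    using local_split_one_sided[OF Q, of "-1" x] by blast
  have "split_along Q (\<lambda>k t. \<gamma>1 k (t - x)) {x..x + d1}"
    unfolding split_along_def
  proof (intro conjI allI impI ballI)
    show "continuous_on {x..x + d1} (\<lambda>t. \<gamma>1 k (t - x))" if "k < degree Q" for k
      by (rule continuous_on_compose2[OF \<gamma>1(1)[OF that]]) (auto intro!: continuous_intros)
    show "Q - [:complex_of_real t:] = Polynomial.smult (lead_coeff Q) (\<Prod>k<degree Q. [:- \<gamma>1 k (t - x), 1:])" if "t \<in> {x..x + d1}" for t
      using \<gamma>1(2)[of "t - x"] that by simp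
  qed
  moreover have "split_along Q (\<lambda>k t. \<gamma>2 k (x - t)) {x - d2..x}"
    unfolding split_along_def
  proof (intro conjI allI impI ballI)
    show "continuous_on {x - d2..x} (\<lambda>t. \<gamma>2 k (x - t))" if "k < degree Q" for k
      by (rule continuous_on_compose2[OF \<gamma>2(1)[OF that]]) (auto intro!: continuous_intros)
    show "Q - [:complex_of_real t:] = Polynomial.smult (lead_coeff Q) (\<Prod>k<degree Q. [:- \<gamma>2 k (x - t), 1:])" if "t \<in> {x - d2..x}" for t
      using \<gamma>2(2)[of "x - t"] that by simp
  qed
  ultimately obtain \<gamma> where \<gamma>: "split_along Q \<gamma> {x - d2..x + d1}"
    using split_along_glue[OF Q, of "x - d2" x "x + d1"] d1 d2 by auto
  show "\<exists>d>0. \<forall>a b. a \<le> x \<and> x \<le> b \<and> b - a < d \<longrightarrow> (\<exists>\<gamma>. split_along Q \<gamma> {a..b})"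
  proof (intro exI[of _ "min d1 d2"] conjI allI impI)
    fix a b assume "a \<le> x \<and> x \<le> b \<and> b - a < min d1 d2"
    then show "\<exists>\<gamma>. split_along Q \<gamma> {a..b}" by (intro exI[of _ \<gamma>] split_along_mono[OF \<gamma>]) auto
  qed (use d1 d2 in auto)
qed

lemma inverse_branches_exist:
  assumes "degree Q > 0"
  obtains \<gamma> where "inverse_branches Q \<gamma>"
  using split_along_interval[OF assms, of "-2" 2] unfolding split_along_def inverse_branches_def by auto

lemma inverse_branches_image:
  assumes \<gamma>: "inverse_branches Q \<gamma>" and Q: "degree Q > 0"
  shows "{z. \<exists>t\<in>{-2..2}. poly Q z = complex_of_real t} = (\<Union>k<degree Q. \<gamma> k ` {-2..2})"
proof -
  have "poly Q z = complex_of_real t \<longleftrightarrow> (\<exists>k<degree Q. z = \<gamma> k t)" if t: "t \<in> {-2..2}" for t z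
  proof -
    have "poly Q z - complex_of_real t = poly (Q - [:complex_of_real t:]) z" by simp
    also have "Q - [:complex_of_real t:] = Polynomial.smult (lead_coeff Q) (\<Prod>k<degree Q. [:- \<gamma> k t, 1:])"
      using \<gamma> t unfolding inverse_branches_def by blast
    also have "poly \<dots> z = lead_coeff Q * (\<Prod>k<degree Q. z - \<gamma> k t)" by (simp add: poly_prod)
    finally show ?thesis using Q by (auto simp: eq_iff_diff_eq_0[of "poly Q z"])
  qed
  then show ?thesis by (auto simp: image_iff)
qed

section \<open>The periodic operator\<close>

lemma seq_linear_diff:
  assumes "seq_linear T"
  shows "T (x - y) = T x - T y" "T 0 = 0"
proof -
  have "T ((x - y) + y) = T (x - y) + T y" using assms unfolding seq_linear_def by blast
  then show d: "T (x - y) = T x - T y" by simp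
  have "T (0 + 0) = T 0 + T 0" using assms unfolding seq_linear_def by blast
  then show "T 0 = 0" by simp
qed

lemma seq_linear_sum:
  assumes "seq_linear T"
  shows "T (\<lambda>i. \<Sum>k\<in>A. \<alpha> k * y k i) = (\<lambda>i. \<Sum>k\<in>A. \<alpha> k * T (y k) i)"
proof (induction A rule: infinite_finite_induct)
  case (insert k A)
  have e: "(\<lambda>i. \<Sum>k\<in>insert k A. \<alpha> k * z k i) = seq_scale (\<alpha> k) (z k) + (\<lambda>i. \<Sum>k\<in>A. \<alpha> k * z k i)" for z
    using insert by (auto simp: fun_eq_iff seq_scale_def)
  have "T (seq_scale (\<alpha> k) (y k) + (\<lambda>i. \<Sum>k\<in>A. \<alpha> k * y k i)) =
      seq_scale (\<alpha> k) (T (y k)) + T (\<lambda>i. \<Sum>k\<in>A. \<alpha> k * y k i)"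
    using assms unfolding seq_linear_def by simp
  then show ?case unfolding e insert.IH .
qed (use seq_linear_diff(2)[OF assms] in \<open>auto simp: zero_fun_def\<close>)

lemma seq_linear_minus_scalar: "seq_linear T \<Longrightarrow> seq_linear (minus_scalar T z)"
  unfolding seq_linear_def minus_scalar_def
  by (auto simp: seq.scale_right_distrib seq.scale_right_diff_distrib seq.scale_left_commute)

lemma poly_op_0: "poly_op 0 T x = 0"
  by (auto simp: poly_op_def)

lemma poly_op_pCons:
  assumes "seq_linear T"
  shows "poly_op (pCons \<alpha> Q) T x = seq_scale \<alpha> x + T (poly_op Q T x)"
proof
  fix i
  have "poly_op (pCons \<alpha> Q) T x i = (\<Sum>k\<le>Suc (degree Q). coeff (pCons \<alpha> Q) k * (T ^^ k) x i)"
    by (rule poly_op_upto) (rule degree_pCons_le)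
  also have "\<dots> = \<alpha> * x i + (\<Sum>k\<le>degree Q. coeff Q k * T ((T ^^ k) x) i)"
    by (simp add: sum.atMost_Suc_shift del: sum.atMost_Suc)
  also have "(\<Sum>k\<le>degree Q. coeff Q k * T ((T ^^ k) x) i) = T (poly_op Q T x) i"
    unfolding poly_op_def seq_linear_sum[OF assms] ..
  finally show "poly_op (pCons \<alpha> Q) T x i = (seq_scale \<alpha> x + T (poly_op Q T x)) i"
    by (simp add: seq_scale_def)
qed

lemma seq_linear_poly_op:
  assumes "seq_linear T" shows "seq_linear (poly_op Q T)"
proof (induction Q)
  case 0
  show ?case unfolding seq_linear_def poly_op_0 by (simp only: seq.scale_zero_right add_0_right) simp
next
  case (pCons \<alpha> Q)
  then show ?case using assms unfolding seq_linear_def poly_op_pCons[OF assms]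
    by (auto simp: seq.scale_right_distrib seq.scale_left_commute)
qed

lemma poly_op_commute:
  assumes "seq_linear T" shows "poly_op Q T (T x) = T (poly_op Q T x)"
proof (induction Q)
  case 0
  show ?case by (simp only: poly_op_0 seq_linear_diff(2)[OF assms])
next
  case (pCons \<alpha> Q)
  have "T (seq_scale \<alpha> x + T (poly_op Q T x)) = T (seq_scale \<alpha> x) + T (T (poly_op Q T x))"
    "T (seq_scale \<alpha> x) = seq_scale \<alpha> (T x)"
    using assms unfolding seq_linear_def by blast+
  then show ?case unfolding poly_op_pCons[OF assms] pCons.IH by (simp only:)
qed

lemma poly_op_commute_minus_scalar:
  assumes "seq_linear T" shows "poly_op Q T (minus_scalar T z x) = minus_scalar T z (poly_op Q T x)"
proof -
  have "poly_op Q T (T x - seq_scale z x) = poly_op Q T (T x) - poly_op Q T (seq_scale z x)"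
    by (rule seq_linear_diff(1)[OF seq_linear_poly_op[OF assms]])
  moreover have "poly_op Q T (seq_scale z x) = seq_scale z (poly_op Q T x)"
    using seq_linear_poly_op[OF assms, of Q] unfolding seq_linear_def by blast
  ultimately show ?thesis unfolding minus_scalar_def by (simp only: poly_op_commute[OF assms])
qed

lemma poly_op_add: "poly_op (P + Q) T x = poly_op P T x + poly_op Q T x"
proof
  fix i
  let ?n = "max (degree P) (degree Q)"
  have "poly_op (P + Q) T x i = (\<Sum>k\<le>?n. coeff (P + Q) k * (T ^^ k) x i)"
    by (rule poly_op_upto) (simp add: degree_add_le_max)
  also have "\<dots> = (\<Sum>k\<le>?n. coeff P k * (T ^^ k) x i) + (\<Sum>k\<le>?n. coeff Q k * (T ^^ k) x i)"
    by (simp add: sum.distrib distrib_right)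
  also have "\<dots> = poly_op P T x i + poly_op Q T x i"
    by (simp add: poly_op_upto[of P ?n] poly_op_upto[of Q ?n])
  finally show "poly_op (P + Q) T x i = (poly_op P T x + poly_op Q T x) i" by simp
qed

lemma poly_op_smult: "poly_op (Polynomial.smult \<alpha> Q) T x = seq_scale \<alpha> (poly_op Q T x)"
proof
  fix i
  have "poly_op (Polynomial.smult \<alpha> Q) T x i = (\<Sum>k\<le>degree Q. coeff (Polynomial.smult \<alpha> Q) k * (T ^^ k) x i)"
    by (rule poly_op_upto) (rule degree_smult_le)
  then show "poly_op (Polynomial.smult \<alpha> Q) T x i = seq_scale \<alpha> (poly_op Q T x) i"
    by (simp add: poly_op_def seq_scale_def sum_distrib_left mult.assoc)
qed

lemma poly_op_linear_factor:
  assumes "seq_linear T"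
  shows "poly_op ([:- z, 1:] * R) T x = minus_scalar T z (poly_op R T x)"
proof -
  have "[:- z, 1:] * R = Polynomial.smult (- z) R + pCons 0 R" by simp
  then show ?thesis
    by (simp only: poly_op_add poly_op_smult poly_op_pCons[OF assms])
       (simp add: minus_scalar_def seq.scale_minus_left)
qed

lemma poly_op_const: "poly_op [:\<alpha>:] T x = seq_scale \<alpha> x"
  by (auto simp: poly_op_def seq_scale_def fun_eq_iff)

lemma poly_op_factor:
  assumes T: "seq_linear T"
  obtains R where "\<And>x. minus_scalar (poly_op Q T) (poly Q z) x = minus_scalar T z (poly_op R T x)"
proof -
  have "[:- z, 1:] dvd Q - [:poly Q z:]" by (simp add: poly_eq_0_iff_dvd[symmetric])
  then obtain R where R: "Q - [:poly Q z:] = [:- z, 1:] * R" by blast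
  have "poly_op Q T x = minus_scalar T z (poly_op R T x) + seq_scale (poly Q z) x" for x
  proof -
    have "Q = [:- z, 1:] * R + [:poly Q z:]" unfolding R[symmetric] by simp
    then have "poly_op Q T x = poly_op ([:- z, 1:] * R + [:poly Q z:]) T x" by (rule arg_cong)
    then show ?thesis by (simp only: poly_op_add poly_op_const poly_op_linear_factor[OF T])
  qed
  then have "minus_scalar (poly_op Q T) (poly Q z) x = minus_scalar T z (poly_op R T x)" for x
    unfolding minus_scalar_def[of "poly_op Q T"] by simp
  then show thesis using that by blast
qed

text \<open>With Q(T) - Q(z) = (T - z) R(T) and commuting factors, the k-th power is R(T)^k (T -
  z)^k. Jordan chains thus pass from T to Q(T) without becoming longer.\<close>

lemma poly_op_root_vector:
  assumes T: "seq_linear T" and x: "(minus_scalar T z ^^ k) x = 0"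
  shows "(minus_scalar (poly_op Q T) (poly Q z) ^^ k) x = 0"
proof -
  obtain R where R: "\<And>x. minus_scalar (poly_op Q T) (poly Q z) x = minus_scalar T z (poly_op R T x)"
    using poly_op_factor[OF T] by blast
  define A where "A = minus_scalar T z"
  define G where "G = poly_op R T"
  have AG: "A (G y) = G (A y)" for y unfolding A_def G_def poly_op_commute_minus_scalar[OF T] ..
  have AkG: "(A ^^ m) (G y) = G ((A ^^ m) y)" for m y by (induction m) (simp_all add: AG)
  have e: "(minus_scalar (poly_op Q T) (poly Q z) ^^ m) y = (G ^^ m) ((A ^^ m) y)" for m y
  proof (induction m arbitrary: y)
    case (Suc m)
    have "(minus_scalar (poly_op Q T) (poly Q z) ^^ Suc m) y = (G ^^ m) ((A ^^ m) (G (A y)))"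
      unfolding funpow_Suc_right comp_def Suc.IH R[folded A_def G_def] AG ..
    then show ?case by (simp only: AkG funpow_Suc_right comp_def)
  qed simp
  have "G 0 = 0" unfolding G_def by (rule seq_linear_diff(2)[OF seq_linear_poly_op[OF T]])
  then have "(G ^^ m) 0 = 0" for m by (induction m) auto
  then show ?thesis using x e[of k x] by (simp add: A_def)
qed

lemma poly_op_eigenvector:
  assumes "seq_linear T" "T x = seq_scale z x"
  shows "poly_op Q T x = seq_scale (poly Q z) x"
  using poly_op_root_vector[OF assms(1), where z = z and k = 1 and x = x and Q = Q] assms(2) by (simp add: minus_scalar_def)

lemma bounded_l2_operator_poly_op:
  assumes "bounded_l2_operator T" "seq_linear T"
  shows "bounded_l2_operator (poly_op Q T)"
proof (induction Q)
  case 0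
  have "poly_op 0 T = (\<lambda>x. 0)" by (rule ext) (rule poly_op_0)
  then show ?case by (simp only: bounded_l2_operator_zero)
next
  case (pCons \<alpha> Q)
  have "poly_op (pCons \<alpha> Q) T = (\<lambda>x. seq_scale \<alpha> x + T (poly_op Q T x))"
    by (rule ext) (rule poly_op_pCons[OF assms(2)])
  then show ?case
    by (simp only:) (rule bounded_l2_operator_add[OF bounded_l2_operator_scale bounded_l2_operator_comp[OF assms(1) pCons.IH]])
qed

section \<open>Boundedness, resolvent and Bloch solutions of Jacobi operators\<close>

lemma jacobi_norm_le:
  assumes x: "x \<in> l2" and b: "\<And>i. cmod (a i) \<le> M" "\<And>i. cmod (b i) \<le> M" "\<And>i. cmod (c i) \<le> M"
  shows "mat_apply (jacobi_matrix a b c) x \<in> l2" "l2_norm (mat_apply (jacobi_matrix a b c) x) \<le> 3 * M * l2_norm x"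
proof -
  have M: "M \<ge> 0" using order_trans[OF norm_ge_zero b(1)] .
  define u where "u = (\<lambda>i. a i * x (i + (-1)))"
  define v where "v = (\<lambda>i. b i * x i)"
  define w where "w = (\<lambda>i. c (i + 1) * x (i + 1))"
  have u: "u \<in> l2" "l2_norm u \<le> M * l2_norm x"
    using l2_mult[where m = a and M = M, OF l2_shift(1)[OF x, of "-1"] b(1)] mult_left_mono[OF l2_shift(2)[OF x, of "-1"] M] by (auto simp: u_def)
  have v: "v \<in> l2" "l2_norm v \<le> M * l2_norm x" using l2_mult[where m = b and M = M, OF x b(2)] by (auto simp: v_def)
  have w: "w \<in> l2" "l2_norm w \<le> M * l2_norm x"
    using l2_mult[where m = "\<lambda>i. c (i + 1)" and M = M, OF l2_shift(1)[OF x, of 1] b(3)] mult_left_mono[OF l2_shift(2)[OF x, of 1] M] by (auto simp: w_def)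
  have "mat_apply (jacobi_matrix a b c) x = (u + v) + w"
    by (auto simp: fun_eq_iff mat_apply_jacobi u_def v_def w_def)
  then show "mat_apply (jacobi_matrix a b c) x \<in> l2" "l2_norm (mat_apply (jacobi_matrix a b c) x) \<le> 3 * M * l2_norm x"
    using l2_add[OF l2_add(1)[OF u(1) v(1)] w(1)] l2_add(2)[OF u(1) v(1)] u v w by auto
qed

lemma bounded_l2_operator_jacobi:
  assumes "\<And>i. cmod (a i) \<le> M" "\<And>i. cmod (b i) \<le> M" "\<And>i. cmod (c i) \<le> M"
  shows "bounded_l2_operator (mat_apply (jacobi_matrix a b c))"
  using seq_linear_jacobi[of a b c] jacobi_norm_le[OF _ assms] unfolding seq_linear_def
  by (intro bounded_l2_operatorI[where K = "3 * M"]) auto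

text \<open>The roots of w^2 - \<mu> w + 1 are w and 1/w. On the unit circle 1/w is the conjugate of
  w and \<mu> = 2 Re w would lie in [-2,2]; otherwise one of the two is inside the disc.\<close>

lemma joukowski_exists:
  assumes "\<mu> \<notin> complex_of_real ` {-2..2}"
  obtains \<kappa> where "\<kappa> \<noteq> 0" "norm \<kappa> < 1" "\<mu> = \<kappa> + 1 / \<kappa>"
proof -
  define w where "w = (\<mu> + csqrt (\<mu>\<^sup>2 - 4)) / 2"
  have "w * w - \<mu> * w + 1 = ((csqrt (\<mu>\<^sup>2 - 4))\<^sup>2 - \<mu>\<^sup>2) / 4 + 1"
    by (simp add: w_def field_simps power2_eq_square)
  then have "w * w - \<mu> * w + 1 = 0" by (simp add: field_simps)
  then have ww: "\<mu> * w = w * w + 1" by (simp add: algebra_simps)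
  then have w0: "w \<noteq> 0" by auto
  have "\<mu> = (\<mu> * w) / w" using w0 by simp
  then have e: "\<mu> = w + 1 / w" unfolding ww using w0 by (simp add: add_divide_distrib)
  have "norm w \<noteq> 1"
  proof
    assume n: "norm w = 1"
    then have "1 / w = cnj w" using w0 by (simp add: complex_eq_iff Re_divide Im_divide cmod_def)
    then have "\<mu> = complex_of_real (2 * Re w)" using e by (simp add: complex_eq_iff)
    moreover have "2 * Re w \<in> {-2..2}" using abs_Re_le_cmod[of w] n by auto
    ultimately show False using assms imageI[of "2 * Re w" "{-2..2}" complex_of_real] by simp
  qed
  then consider "norm w < 1" | "norm w > 1" by linarith
  then show thesis
  proof cases
    case 1 then show thesis using that w0 e by blast
  next
    case 2
    then have "norm (1 / w) < 1" by (simp add: norm_divide divide_simps)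
    then show thesis using that[of "1 / w"] w0 e by (simp add: add.commute)
  qed
qed

lemma joukowski_unit:
  assumes "t \<in> {-2..2::real}"
  obtains \<kappa> where "norm \<kappa> = 1" "complex_of_real t = \<kappa> + 1 / \<kappa>"
proof -
  define \<kappa> where "\<kappa> = Complex (t / 2) (sqrt (1 - (t / 2)\<^sup>2))"
  have "(t / 2)\<^sup>2 \<le> 1" using assms by (auto simp: abs_square_le_1)
  then have n: "norm \<kappa> = 1" by (simp add: \<kappa>_def complex_norm)
  then have "\<kappa> * cnj \<kappa> = 1" by (simp add: complex_norm_square[symmetric])
  then have "1 / \<kappa> = cnj \<kappa>" using n by (metis nonzero_eq_divide_eq mult.commute norm_zero zero_neq_one)
  then have "complex_of_real t = \<kappa> + 1 / \<kappa>" by (simp add: \<kappa>_def complex_eq_iff)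
  with n that show thesis by blast
qed

lemma bounded_l2_operator_shift: "bounded_l2_operator (\<lambda>x i. x (i + k))"
  by (rule bounded_l2_operatorI[where K = 1]) (auto simp: l2_shift fun_eq_iff seq_scale_def)

definition free_op :: "nat \<Rightarrow> bisequence \<Rightarrow> bisequence" where
  "free_op p x i = x (i - int p) + x (i + int p)"

lemma free_matrix_row_sum:
  assumes "p \<ge> 1" "finite F" "i - int p \<in> F" "i + int p \<in> F"
  shows "(\<Sum>j\<in>F. free_matrix p i j * x j) = free_op p x i"
proof -
  have "(\<Sum>j\<in>F. free_matrix p i j * x j) = (\<Sum>j\<in>{i - int p, i + int p}. free_matrix p i j * x j)"
    using assms by (intro sum.mono_neutral_right) (auto simp: free_matrix_def)
  then show ?thesis using assms(1) by (simp add: free_matrix_def free_op_def)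
qed

lemma poly_op_free:
  assumes "p \<ge> 1" "degree Q = p" "mat_poly Q (jacobi_matrix a b c) = free_matrix p"
  shows "poly_op Q (mat_apply (jacobi_matrix a b c)) = free_op p"
proof (intro ext)
  fix x i
  show "poly_op Q (mat_apply (jacobi_matrix a b c)) x i = free_op p x i"
    using poly_op_jacobi[of "{i - int p..i + int p}" i Q a b c x] assms
    by (simp add: free_matrix_row_sum)
qed

text \<open>With \<open>\<mu> = \<kappa> + 1/\<kappa>\<close> the operator \<open>S\<^sup>p + S\<^sup>-\<^sup>p - \<mu>\<close> factors as
  \<open>-(1/\<kappa>) (1 - \<kappa> S\<^sup>p) (1 - \<kappa> S\<^sup>-\<^sup>p)\<close>.\<close>

lemma free_op_invertible:
  assumes "\<mu> \<notin> complex_of_real ` {-2..2}"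
  shows "l2_invertible (minus_scalar (free_op p) \<mu>)"
proof -
  obtain \<kappa> where \<kappa>: "\<kappa> \<noteq> 0" "norm \<kappa> < 1" "\<mu> = \<kappa> + 1 / \<kappa>" using joukowski_exists[OF assms] .
  define C where "C k x = seq_scale (- \<kappa>) (\<lambda>i. x (i + k))" for k :: int and x :: bisequence
  have Cb: "bounded_l2_operator (C k)" for k
    unfolding C_def[abs_def]
    by (rule bounded_l2_operator_comp[OF bounded_l2_operator_scale bounded_l2_operator_shift])
  have Cn: "l2_norm (C k x) \<le> norm \<kappa> * l2_norm x" if "x \<in> l2" for k x
  proof -
    have "l2_norm (C k x) \<le> norm (- \<kappa>) * l2_norm (\<lambda>i. x (i + k))"
      unfolding C_def by (intro l2_scale l2_shift that)
    also have "\<dots> \<le> norm (- \<kappa>) * l2_norm x" by (intro mult_left_mono l2_shift that) simp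
    finally show ?thesis by simp
  qed
  define U where "U k x = x + C k x" for k x
  have U: "l2_invertible (U k)" "bounded_l2_operator (U k)" for k
    using l2_neumann[OF Cb \<kappa>(2) Cn, of k] bounded_l2_operator_add[OF bounded_l2_operator_id Cb[of k]]
    unfolding U_def[abs_def] by auto
  have "l2_invertible (\<lambda>x. seq_scale (- (1 / \<kappa>)) (U (int p) (U (- int p) x)))"
    using \<kappa>(1)
    by (intro l2_invertible_comp[OF l2_invertible_scale _ bounded_l2_operator_scale]
        l2_invertible_comp[OF U(1) U(1) U(2) U(2)] bounded_l2_operator_comp[OF U(2) U(2)]) simp
  moreover have "(\<lambda>x. seq_scale (- (1 / \<kappa>)) (U (int p) (U (- int p) x))) = minus_scalar (free_op p) \<mu>"
  proof (intro ext)
    fix x i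
    have "U (int p) (U (- int p) x) i = x i - \<kappa> * x (i - int p) - \<kappa> * x (i + int p) + \<kappa> * \<kappa> * x i"
      by (simp add: U_def C_def seq_scale_def algebra_simps)
    then show "seq_scale (- (1 / \<kappa>)) (U (int p) (U (- int p) x)) i = minus_scalar (free_op p) \<mu> x i"
      using \<kappa>(1) by (simp add: seq_scale_def minus_scalar_def free_op_def \<kappa>(3) field_simps)
  qed
  ultimately show ?thesis by simp
qed

text \<open>If D = AG = GA has inverse R, then GR is a right inverse of A. It is also a left
  inverse: A annihilates G R A x - x, hence so does D = GA, and D is injective.\<close>

lemma l2_invertible_commuting_factor:
  assumes D: "l2_invertible D" and A: "bounded_l2_operator A" and G: "bounded_l2_operator G"
    and AG: "\<And>x. D x = A (G x)" and GA: "\<And>x. D x = G (A x)"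
  shows "l2_invertible A"
proof -
  obtain R where R: "bounded_l2_operator R" "\<And>x. x \<in> l2 \<Longrightarrow> R (D x) = x" "\<And>x. x \<in> l2 \<Longrightarrow> D (R x) = x"
    using D unfolding l2_invertible_def by blast
  have GR: "bounded_l2_operator (\<lambda>x. G (R x))" by (rule bounded_l2_operator_comp[OF G R(1)])
  have r: "A (G (R x)) = x" if "x \<in> l2" for x using R(3)[OF that] AG by simp
  have "G (R (A x)) = x" if x: "x \<in> l2" for x
  proof -
    define y where "y = G (R (A x)) - x"
    have Ax: "A x \<in> l2" by (rule bounded_l2_operator_l2[OF A x])
    have g: "G (R (A x)) \<in> l2" by (rule bounded_l2_operator_l2[OF GR Ax])
    have y: "y \<in> l2" unfolding y_def by (rule l2_diff(1)[OF g x])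
    have "A y = 0" unfolding y_def bounded_l2_operator_diff[OF A g x] r[OF Ax] by simp
    then have "D y = 0" using GA[of y] bounded_l2_operator_0[OF G] by (simp only:)
    then have "y = 0" using R(2)[OF y] bounded_l2_operator_0[OF R(1)] by (simp only:)
    then show ?thesis by (simp add: y_def)
  qed
  then show ?thesis unfolding l2_invertible_def
    by (intro exI[of _ "\<lambda>x. G (R x)"] conjI GR ballI) (use r in auto)
qed

lemma periodic_resolvent:
  assumes T: "bounded_l2_operator T" "seq_linear T" and Q: "poly_op Q T = free_op p"
    and z: "poly Q z \<notin> complex_of_real ` {-2..2}"
  shows "l2_invertible (minus_scalar T z)"
proof -
  obtain R where R: "\<And>x. minus_scalar (poly_op Q T) (poly Q z) x = minus_scalar T z (poly_op R T x)"
    using poly_op_factor[OF T(2)] by blast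
  show ?thesis
  proof (rule l2_invertible_commuting_factor)
    show "l2_invertible (minus_scalar (poly_op Q T) (poly Q z))" unfolding Q by (rule free_op_invertible[OF z])
    show "minus_scalar (poly_op Q T) (poly Q z) x = poly_op R T (minus_scalar T z x)" for x
      unfolding R poly_op_commute_minus_scalar[OF T(2)] ..
  qed (use T R in \<open>auto intro: bounded_l2_operator_minus_scalar bounded_l2_operator_poly_op\<close>)
qed

text \<open>Nonzero off-diagonal entries let the three-term recurrence run in both directions from
  the values at 0 and 1.\<close>

lemma jacobi_solution_exists:
  assumes nz: "\<And>i. a i \<noteq> 0" "\<And>i. c i \<noteq> 0"
  obtains u where "minus_scalar (mat_apply (jacobi_matrix a b c)) z u = f" "u 0 = x0" "u 1 = x1"
proof -
  \<comment> \<open>\<open>F n\<close> holds the pair of values at n and n + 1 going right, and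
    \<open>G n\<close> the pair at -n and -n + 1 going left.\<close>
  define F where "F = rec_nat (x0, x1) (\<lambda>n (u, v). (v, (f (int n + 1) + z * v - b (int n + 1) * v - a (int n + 1) * u) / c (int n + 2)))"
  define G where "G = rec_nat (x0, x1) (\<lambda>n (u, v). ((f (- int n) + z * u - b (- int n) * u - c (- int n + 1) * v) / a (- int n), u))"
  define u where "u i = (if i \<ge> 0 then fst (F (nat i)) else fst (G (nat (- i))))" for i
  have FS: "F (Suc n) = (snd (F n), (f (int n + 1) + z * snd (F n) - b (int n + 1) * snd (F n) - a (int n + 1) * fst (F n)) / c (int n + 2))" for n
    by (simp add: F_def case_prod_unfold)
  have GS: "G (Suc n) = ((f (- int n) + z * fst (G n) - b (- int n) * fst (G n) - c (- int n + 1) * snd (G n)) / a (- int n), fst (G n))" for n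
    by (simp add: G_def case_prod_unfold)
  have F0: "F 0 = (x0, x1)" and G0: "G 0 = (x0, x1)" by (auto simp: F_def G_def)
  have Fu: "F n = (u (int n), u (int n + 1))" for n
  proof -
    have "nat (int n + 1) = Suc n" by simp
    then have "u (int n + 1) = snd (F n)" by (simp add: u_def FS)
    then show ?thesis by (simp add: u_def prod_eq_iff)
  qed
  have Gu: "G n = (u (- int n), u (- int n + 1))" for n
  proof (cases n)
    case 0
    then show ?thesis using Fu[of 0] by (simp add: F0 G0)
  next
    case (Suc m)
    have "u (- int m) = fst (G m)"
      by (cases "m = 0") (auto simp: u_def F0 G0)
    then have "u (- int (Suc m) + 1) = snd (G (Suc m))" by (simp add: GS)
    moreover have "u (- int (Suc m)) = fst (G (Suc m))" by (simp add: u_def del: of_nat_Suc)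
    ultimately show ?thesis unfolding Suc by (simp add: prod_eq_iff)
  qed
  have "minus_scalar (mat_apply (jacobi_matrix a b c)) z u i = f i" for i
  proof (cases "i \<ge> 1")
    case True
    define n where "n = nat (i - 1)"
    have i: "i = int n + 1" using True by (simp add: n_def)
    have "snd (F (Suc n)) * c (int n + 2) = f i + z * u i - b i * u i - a i * u (i - 1)"
      using nz by (simp add: FS) (simp add: Fu i)
    moreover have "snd (F (Suc n)) = u (i + 1)" by (simp add: Fu i add_ac)
    ultimately show ?thesis
      by (simp add: minus_scalar_def mat_apply_jacobi seq_scale_def i algebra_simps)
  next
    case False
    define n where "n = nat (- i)"
    have i: "i = - int n" using False by (simp add: n_def)
    have "fst (G (Suc n)) * a i = f i + z * u i - b i * u i - c (i + 1) * u (i + 1)"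
      using nz by (simp add: GS i) (simp add: Gu)
    moreover have "- int (Suc n) = i - 1" by (simp add: i)
    then have "fst (G (Suc n)) = u (i - 1)" unfolding Gu[of "Suc n"] by simp
    ultimately show ?thesis
      by (simp add: minus_scalar_def mat_apply_jacobi seq_scale_def algebra_simps)
  qed
  moreover have "u 0 = x0" "u 1 = x1" using Fu[of 0] by (auto simp: F0)
  ultimately show thesis using that[of u] by (auto simp: fun_eq_iff)
qed

text \<open>A solution u satisfies (S^p - \<kappa>)(S^p - 1/\<kappa>) u = 0 with |\<kappa>| = 1.
  Either the second factor already annihilates u, or v = (S^p - 1/\<kappa>) u is nonzero with
  multiplier \<kappa>; periodicity makes v a solution as well. Both multipliers are
  unimodular.\<close>

lemma bloch_solution_exists:
  assumes p: "p \<ge> 1" and per: "periodic_seq p a" "periodic_seq p b" "periodic_seq p c"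
    and nz: "\<And>n. a n \<noteq> 0" "\<And>n. c n \<noteq> 0" and Q: "poly_op Q (mat_apply (jacobi_matrix a b c)) = free_op p"
    and t: "poly Q z = complex_of_real t" "t \<in> {-2..2}"
  obtains u where "u \<noteq> 0" "minus_scalar (mat_apply (jacobi_matrix a b c)) z u = 0" "\<And>i. norm (u (i + int p)) = norm (u i)"
proof -
  let ?T = "mat_apply (jacobi_matrix a b c)"
  obtain u where u: "minus_scalar ?T z u = 0" "u 0 = 1" "u 1 = 0"
    using jacobi_solution_exists[of a c b z 0 1 0, OF nz] by blast
  have Tu: "?T u = seq_scale z u" using u(1) by (simp add: minus_scalar_def)
  obtain \<kappa> where \<kappa>: "norm \<kappa> = 1" "complex_of_real t = \<kappa> + 1 / \<kappa>" using joukowski_unit[OF t(2)] .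
  have \<kappa>0: "\<kappa> \<noteq> 0" using \<kappa> by auto
  have "free_op p u = seq_scale (poly Q z) u"
    using poly_op_eigenvector[OF seq_linear_jacobi Tu, of Q] Q by simp
  then have F: "u (i - int p) + u (i + int p) = (\<kappa> + 1 / \<kappa>) * u i" for i
    using t \<kappa> by (metis free_op_def seq_scale_def)
  define v where "v i = u (i + int p) - (1 / \<kappa>) * u i" for i
  show thesis
  proof (cases "v = 0")
    case True
    then have "u (i + int p) = (1 / \<kappa>) * u i" for i by (metis eq_iff_diff_eq_0 v_def zero_fun_apply)
    then have "norm (u (i + int p)) = norm (u i)" for i using \<kappa> by (simp add: norm_divide)
    moreover have "u \<noteq> 0" using u(2) by auto
    ultimately show thesis using that u(1) by blast
  next
    case False
    note sh = periodic_seq_shift(1)[OF per(1)] periodic_seq_shift(1)[OF per(2)] periodic_seq_shift(1)[OF per(3)]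
    have E: "a i * u (i - 1) + b i * u i + c (i + 1) * u (i + 1) = z * u i" for i
      using Tu by (metis mat_apply_jacobi seq_scale_def)
    have "minus_scalar ?T z v i = 0" for i
    proof -
      have "a i * u (i - 1 + int p) + b i * u (i + int p) + c (i + 1) * u (i + 1 + int p) = z * u (i + int p)"
        using E[of "i + int p"] sh(1)[of i] sh(2)[of i] sh(3)[of "i + 1"] by (simp add: algebra_simps)
      moreover have "(1 / \<kappa>) * (a i * u (i - 1) + b i * u i + c (i + 1) * u (i + 1)) = (1 / \<kappa>) * (z * u i)" by (simp only: E)
      ultimately show ?thesis
        by (simp add: minus_scalar_def mat_apply_jacobi seq_scale_def v_def algebra_simps)
    qed
    then have "minus_scalar ?T z v = 0" by (simp add: fun_eq_iff)
    moreover have "v (i + int p) = \<kappa> * v i" for i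
    proof -
      have "u (i + int p + int p) = (\<kappa> + 1 / \<kappa>) * u (i + int p) - u i" using F[of "i + int p"] by (simp add: algebra_simps)
      then show ?thesis using \<kappa>0 by (simp add: v_def algebra_simps)
    qed
    then have "norm (v (i + int p)) = norm (v i)" for i using \<kappa> by (simp add: norm_mult)
    ultimately show thesis using that False by blast
  qed
qed

section \<open>The algebra of series with decaying coefficients\<close>

lemma sqrt_decay_class_const: "sqrt_decay_class c (norm z) (\<lambda>_. z)"
  unfolding sqrt_decay_class_def
proof (intro exI[of _ "\<lambda>n. if n = 0 then z else 0"] conjI allI impI)
  let ?a = "\<lambda>n::nat. if n = 0 then z else 0"
  have "(\<lambda>n. norm (?a n) * exp (c * sqrt (real n))) sums (\<Sum>n\<in>{0}. norm (?a n) * exp (c * sqrt (real n)))"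
    by (rule sums_finite) auto
  then show "summable (\<lambda>n. norm (?a n) * exp (c * sqrt (real n)))"
    "(\<Sum>n. norm (?a n) * exp (c * sqrt (real n))) \<le> norm z" by (auto simp: sums_iff)
  fix \<kappa> :: complex
  have "(\<lambda>n. ?a n * \<kappa> ^ n) sums (\<Sum>n\<in>{0}. ?a n * \<kappa> ^ n)" by (rule sums_finite) auto
  then show "z = (\<Sum>n. ?a n * \<kappa> ^ n)" by (auto simp: sums_iff)
qed

lemma sqrt_decay_class_power: "sqrt_decay_class c (exp (c * sqrt (real m))) (\<lambda>\<kappa>. \<kappa> ^ m)"
  unfolding sqrt_decay_class_def
proof (intro exI[of _ "\<lambda>n. if n = m then 1 else 0"] conjI allI impI)
  let ?a = "\<lambda>n::nat. if n = m then 1 else (0::complex)"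
  have "(\<lambda>n. norm (?a n) * exp (c * sqrt (real n))) sums (\<Sum>n\<in>{m}. norm (?a n) * exp (c * sqrt (real n)))"
    by (rule sums_finite) auto
  then show "summable (\<lambda>n. norm (?a n) * exp (c * sqrt (real n)))"
    "(\<Sum>n. norm (?a n) * exp (c * sqrt (real n))) \<le> exp (c * sqrt (real m))" by (auto simp: sums_iff)
  fix \<kappa> :: complex
  have "(\<lambda>n. ?a n * \<kappa> ^ n) sums (\<Sum>n\<in>{m}. ?a n * \<kappa> ^ n)" by (rule sums_finite) auto
  then show "\<kappa> ^ m = (\<Sum>n. ?a n * \<kappa> ^ n)" by (auto simp: sums_iff)
qed

lemma sqrt_decay_class_mono: "sqrt_decay_class c M f \<Longrightarrow> M \<le> N \<Longrightarrow> sqrt_decay_class c N f"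
  unfolding sqrt_decay_class_def by force

lemma sqrt_decay_class_nonneg: "sqrt_decay_class c M f \<Longrightarrow> 0 \<le> M"
  unfolding sqrt_decay_class_def by (auto intro: order_trans[OF suminf_nonneg])

lemma sqrt_decay_class_norm_le:
  assumes f: "sqrt_decay_class c M f" and c: "c \<ge> 0" and z: "norm z \<le> 1"
  shows "norm (f z) \<le> M"
proof -
  obtain a where a: "summable (\<lambda>n. norm (a n) * exp (c * sqrt (real n)))"
    and aM: "(\<Sum>n. norm (a n) * exp (c * sqrt (real n))) \<le> M"
    and f: "\<And>\<kappa>. norm \<kappa> \<le> 1 \<Longrightarrow> f \<kappa> = (\<Sum>n. a n * \<kappa> ^ n)"
    using f unfolding sqrt_decay_class_def by auto
  have b: "norm (a n * z ^ n) \<le> norm (a n) * exp (c * sqrt (real n))" for n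
  proof -
    have "norm (a n * z ^ n) \<le> norm (a n) * 1"
      unfolding norm_mult norm_power using z by (intro mult_left_mono power_le_one) auto
    also have "\<dots> \<le> norm (a n) * exp (c * sqrt (real n))" using c by (intro mult_left_mono) auto
    finally show ?thesis .
  qed
  show ?thesis unfolding f[OF z] by (rule order_trans[OF norm_suminf_le[OF b a] aM])
qed

text \<open>Completeness of the weighted algebra: the coefficient sums converge absolutely, first
  against the weight for the norm bound and then against \<kappa>^n for the value.\<close>

lemma sqrt_decay_class_suminf:
  fixes f :: "nat \<Rightarrow> complex \<Rightarrow> complex"
  assumes f: "\<And>i. sqrt_decay_class c (M i) (f i)" and M: "summable M" and c: "c \<ge> 0"
  shows "sqrt_decay_class c (suminf M) (\<lambda>\<kappa>. \<Sum>i. f i \<kappa>)"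
proof -
  have "\<forall>i. \<exists>a. summable (\<lambda>n. norm (a n) * exp (c * sqrt (real n))) \<and>
     (\<Sum>n. norm (a n) * exp (c * sqrt (real n))) \<le> M i \<and>
     (\<forall>\<kappa>. norm \<kappa> \<le> 1 \<longrightarrow> f i \<kappa> = (\<Sum>n. a n * \<kappa> ^ n))"
    using f unfolding sqrt_decay_class_def by simp
  then obtain a where a: "\<And>i. summable (\<lambda>n. norm (a i n) * exp (c * sqrt (real n)))"
    and aM: "\<And>i. (\<Sum>n. norm (a i n) * exp (c * sqrt (real n))) \<le> M i"
    and fa: "\<And>i \<kappa>. norm \<kappa> \<le> 1 \<Longrightarrow> f i \<kappa> = (\<Sum>n. a i n * \<kappa> ^ n)"
    by (auto dest!: choice)
  define x where "x i n = norm (a i n) * exp (c * sqrt (real n))" for i n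
  have xn: "norm (x i n) = x i n" for i n by (simp add: x_def)
  have s1: "summable (\<lambda>n. norm (x i n))" for i unfolding xn using a by (simp add: x_def)
  have s2: "summable (\<lambda>i. \<Sum>n. norm (x i n))"
    unfolding xn by (rule summable_comparison_test'[OF M, of 0])
      (use aM suminf_nonneg[OF a] in \<open>auto simp: x_def\<close>)
  note sw = summable_swap[OF s1 s2, unfolded xn]
  define b where "b n = (\<Sum>i. a i n)" for n
  have sa: "summable (\<lambda>i. norm (a i n))" for n
  proof -
    have "summable (\<lambda>i. x i n * exp (- c * sqrt (real n)))" by (rule summable_mult2[OF sw(1)])
    then show ?thesis by (simp add: x_def mult.assoc flip: exp_add)
  qed
  have bx: "norm (b n) * exp (c * sqrt (real n)) \<le> (\<Sum>i. x i n)" for n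
  proof -
    have "norm (b n) * exp (c * sqrt (real n)) \<le> (\<Sum>i. norm (a i n)) * exp (c * sqrt (real n))"
      unfolding b_def by (intro mult_right_mono summable_norm sa) auto
    also have "\<dots> = (\<Sum>i. x i n)" unfolding x_def by (rule suminf_mult2[OF sa])
    finally show ?thesis .
  qed
  have sb: "summable (\<lambda>n. norm (b n) * exp (c * sqrt (real n)))"
    by (rule summable_comparison_test'[OF sw(2), of 0]) (use bx in auto)
  have "(\<Sum>n. norm (b n) * exp (c * sqrt (real n))) \<le> (\<Sum>n. \<Sum>i. x i n)"
    by (rule suminf_le[OF bx sb sw(2)])
  also have "\<dots> = (\<Sum>i. \<Sum>n. x i n)" by (rule sw(3)[symmetric])
  also have "\<dots> \<le> suminf M"
    using s2 M aM unfolding xn by (intro suminf_le) (auto simp: x_def)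
  finally have bM: "(\<Sum>n. norm (b n) * exp (c * sqrt (real n))) \<le> suminf M" .
  have "(\<Sum>i. f i \<kappa>) = (\<Sum>n. b n * \<kappa> ^ n)" if \<kappa>: "norm \<kappa> \<le> 1" for \<kappa>
  proof -
    have le: "norm (a i n * \<kappa> ^ n) \<le> x i n" for i n
    proof -
      have "norm (a i n * \<kappa> ^ n) \<le> norm (a i n) * 1"
        unfolding norm_mult norm_power using \<kappa> by (intro mult_left_mono power_le_one) auto
      also have "\<dots> \<le> x i n" unfolding x_def using c by (intro mult_left_mono) auto
      finally show ?thesis .
    qed
    have t1: "summable (\<lambda>n. norm (a i n * \<kappa> ^ n))" for i
      by (rule summable_comparison_test'[OF s1[of i, unfolded xn], of 0]) (use le in auto)
    have t2: "summable (\<lambda>i. \<Sum>n. norm (a i n * \<kappa> ^ n))"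
      by (rule summable_comparison_test'[OF s2[unfolded xn], of 0])
        (use suminf_le[OF le t1 s1[unfolded xn]] suminf_nonneg[OF t1] in auto)
    have "(\<Sum>i. f i \<kappa>) = (\<Sum>i. \<Sum>n. a i n * \<kappa> ^ n)" using fa[OF \<kappa>] by simp
    also have "\<dots> = (\<Sum>n. \<Sum>i. a i n * \<kappa> ^ n)" by (rule summable_swap(3)[OF t1 t2])
    also have "\<dots> = (\<Sum>n. b n * \<kappa> ^ n)"
      unfolding b_def by (intro suminf_cong suminf_mult2[symmetric] summable_norm_cancel[OF sa])
    finally show ?thesis .
  qed
  then show ?thesis unfolding sqrt_decay_class_def using sb bM by (intro exI[of _ b]) simp
qed

lemma sqrt_decay_class_add:
  assumes "sqrt_decay_class c M f" "sqrt_decay_class c N g" and c: "c \<ge> 0"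
  shows "sqrt_decay_class c (M + N) (\<lambda>\<kappa>. f \<kappa> + g \<kappa>)"
proof -
  define F where "F i = (if i = 0 then f else if i = 1 then g else (\<lambda>_. 0))" for i :: nat
  define L where "L i = (if i = 0 then M else if i = 1 then N else 0)" for i :: nat
  have "sqrt_decay_class c (L i) (F i)" for i
    using assms sqrt_decay_class_const[of c 0] by (auto simp: F_def L_def)
  moreover have L: "L sums (\<Sum>i\<in>{0, 1}. L i)" by (rule sums_finite) (auto simp: L_def)
  moreover have "(\<lambda>i. F i \<kappa>) sums (\<Sum>i\<in>{0, 1}. F i \<kappa>)" for \<kappa> by (rule sums_finite) (auto simp: F_def)
  ultimately show ?thesis
    using sqrt_decay_class_suminf[of c L F, OF _ _ c] by (simp add: sums_iff F_def L_def)
qed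

text \<open>The square root is subadditive, so the weight is submultiplicative and the norm of a
  Cauchy product is at most the product of the norms.\<close>

lemma sqrt_decay_class_mult:
  assumes f: "sqrt_decay_class c M f" and g: "sqrt_decay_class c N g" and c: "c \<ge> 0"
  shows "sqrt_decay_class c (M * N) (\<lambda>\<kappa>. f \<kappa> * g \<kappa>)"
proof -
  define e where "e n = exp (c * sqrt (real n))" for n
  have e: "e n \<ge> 1" for n using c by (simp add: e_def)
  have e0: "e n > 0" for n by (simp add: e_def)
  obtain a where a: "summable (\<lambda>n. norm (a n) * e n)" and aM: "(\<Sum>n. norm (a n) * e n) \<le> M"
    and fa: "\<And>\<kappa>. norm \<kappa> \<le> 1 \<Longrightarrow> f \<kappa> = (\<Sum>n. a n * \<kappa> ^ n)"
    using f unfolding sqrt_decay_class_def e_def by auto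
  obtain b where b: "summable (\<lambda>n. norm (b n) * e n)" and bM: "(\<Sum>n. norm (b n) * e n) \<le> N"
    and gb: "\<And>\<kappa>. norm \<kappa> \<le> 1 \<Longrightarrow> g \<kappa> = (\<Sum>n. b n * \<kappa> ^ n)"
    using g unfolding sqrt_decay_class_def e_def by auto
  note sa = sqrt_decay_coeff_summable[OF a[unfolded e_def] c]
  note sb = sqrt_decay_coeff_summable[OF b[unfolded e_def] c]
  define d where "d n = (\<Sum>i\<le>n. a i * b (n - i))" for n
  have na: "summable (\<lambda>n. norm (norm (a n) * e n))" "summable (\<lambda>n. norm (norm (b n) * e n))"
    using a b e0 by (simp_all add: abs_mult abs_of_pos)
  have de: "norm (d n) * e n \<le> (\<Sum>i\<le>n. (norm (a i) * e i) * (norm (b (n - i)) * e (n - i)))" for n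
  proof -
    have "norm (d n) * e n \<le> (\<Sum>i\<le>n. norm (a i * b (n - i))) * e n"
      unfolding d_def using e0[of n] by (intro mult_right_mono norm_sum) simp
    also have "\<dots> = (\<Sum>i\<le>n. norm (a i) * norm (b (n - i)) * e n)" by (simp add: sum_distrib_right norm_mult)
    also have "\<dots> \<le> (\<Sum>i\<le>n. norm (a i) * norm (b (n - i)) * (e i * e (n - i)))"
    proof (intro sum_mono mult_left_mono)
      fix i assume "i \<in> {..n}"
      then have "real n = real i + real (n - i)" by auto
      then have "sqrt (real n) = sqrt (real i + real (n - i))" by (rule arg_cong)
      also have "\<dots> \<le> sqrt (real i) + sqrt (real (n - i))" by (rule sqrt_add_le_add_sqrt) auto
      finally have "sqrt (real n) \<le> sqrt (real i) + sqrt (real (n - i))" .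
      from mult_left_mono[OF this c] show "e n \<le> e i * e (n - i)"
        unfolding e_def by (simp add: distrib_left flip: exp_add)
    qed auto
    also have "\<dots> = (\<Sum>i\<le>n. (norm (a i) * e i) * (norm (b (n - i)) * e (n - i)))" by (simp add: mult_ac)
    finally show ?thesis .
  qed
  note cp = Cauchy_product_sums[OF na]
  have sd: "summable (\<lambda>n. norm (d n) * e n)"
    by (rule summable_comparison_test'[OF sums_summable[OF cp], of 0]) (use de e0 in \<open>auto simp: abs_mult abs_of_pos\<close>)
  have "(\<Sum>n. norm (d n) * e n) \<le> (\<Sum>n. norm (a n) * e n) * (\<Sum>n. norm (b n) * e n)"
    using suminf_le[OF de sd sums_summable[OF cp]] sums_unique[OF cp] by simp
  also have "\<dots> \<le> M * N"
    using e0 by (intro mult_mono aM bM suminf_nonneg b sqrt_decay_class_nonneg[OF f]) (auto simp: less_imp_le)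
  finally have dM: "(\<Sum>n. norm (d n) * e n) \<le> M * N" .
  have "f \<kappa> * g \<kappa> = (\<Sum>n. d n * \<kappa> ^ n)" if \<kappa>: "norm \<kappa> \<le> 1" for \<kappa>
  proof -
    have le: "norm (norm (h n * \<kappa> ^ n)) \<le> norm (h n)" for h :: "nat \<Rightarrow> complex" and n
      using mult_left_mono[OF power_le_one[OF norm_ge_zero \<kappa>, of n] norm_ge_zero[of "h n"]] by (simp add: norm_mult norm_power)
    have ab: "summable (\<lambda>n. norm (a n * \<kappa> ^ n))" "summable (\<lambda>n. norm (b n * \<kappa> ^ n))"
      by (rule summable_comparison_test'[OF sa, of 0], rule le, rule summable_comparison_test'[OF sb, of 0], rule le)
    have "(\<Sum>n. d n * \<kappa> ^ n) = (\<Sum>n. \<Sum>i\<le>n. (a i * \<kappa> ^ i) * (b (n - i) * \<kappa> ^ (n - i)))"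
    proof (intro suminf_cong)
      fix n
      have "d n * \<kappa> ^ n = (\<Sum>i\<le>n. a i * b (n - i) * \<kappa> ^ n)" by (simp add: d_def sum_distrib_right)
      also have "\<dots> = (\<Sum>i\<le>n. (a i * \<kappa> ^ i) * (b (n - i) * \<kappa> ^ (n - i)))"
      proof (intro sum.cong refl)
        fix i assume "i \<in> {..n}"
        then have "\<kappa> ^ n = \<kappa> ^ i * \<kappa> ^ (n - i)" by (simp flip: power_add)
        then show "a i * b (n - i) * \<kappa> ^ n = (a i * \<kappa> ^ i) * (b (n - i) * \<kappa> ^ (n - i))" by (simp only: mult_ac)
      qed
      finally show "d n * \<kappa> ^ n = (\<Sum>i\<le>n. (a i * \<kappa> ^ i) * (b (n - i) * \<kappa> ^ (n - i)))" .
    qed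
    also have "\<dots> = f \<kappa> * g \<kappa>" unfolding fa[OF \<kappa>] gb[OF \<kappa>] by (rule Cauchy_product[OF ab, symmetric])
    finally show ?thesis ..
  qed
  then show ?thesis unfolding sqrt_decay_class_def using sd dM unfolding e_def by (intro exI[of _ d]) simp
qed

lemma sqrt_decay_class_cmult:
  assumes f: "sqrt_decay_class c M f" and c: "c \<ge> 0"
  shows "sqrt_decay_class c (norm z * M) (\<lambda>\<kappa>. z * f \<kappa>)"
  by (rule sqrt_decay_class_mult[OF sqrt_decay_class_const f c])

lemma sqrt_decay_class_sum:
  assumes "\<And>i. i \<in> A \<Longrightarrow> sqrt_decay_class c (M i) (f i)" and c: "c \<ge> 0"
  shows "sqrt_decay_class c (\<Sum>i\<in>A. M i) (\<lambda>\<kappa>. \<Sum>i\<in>A. f i \<kappa>)"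
  using assms(1)
proof (induction A rule: infinite_finite_induct)
  case (insert x A)
  then have "sqrt_decay_class c (M x + (\<Sum>i\<in>A. M i)) (\<lambda>\<kappa>. f x \<kappa> + (\<Sum>i\<in>A. f i \<kappa>))"
    by (intro sqrt_decay_class_add c) auto
  then show ?case using insert by simp
qed (use sqrt_decay_class_const[of c 0] in auto)

lemma sqrt_decay_class_prod:
  assumes "\<And>i. i \<in> A \<Longrightarrow> sqrt_decay_class c (M i) (f i)" and c: "c \<ge> 0"
  shows "sqrt_decay_class c (\<Prod>i\<in>A. M i) (\<lambda>\<kappa>. \<Prod>i\<in>A. f i \<kappa>)"
  using assms(1)
proof (induction A rule: infinite_finite_induct)
  case (insert x A)
  then have "sqrt_decay_class c (M x * (\<Prod>i\<in>A. M i)) (\<lambda>\<kappa>. f x \<kappa> * (\<Prod>i\<in>A. f i \<kappa>))"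
    by (intro sqrt_decay_class_mult c) auto
  then show ?case using insert by simp
qed (use sqrt_decay_class_const[of c 1] in auto)

section \<open>Jost solutions on the half-line\<close>

text \<open>\<open>v i d\<close> is the perturbation of row i at offset d. \<open>W s\<close>
  majorizes the entries of all rows from s on, multiplied by the norm of the Green kernel at
  distance s and by that of the powers of \<kappa> linking neighbouring blocks. The last condition
  makes the Picard iteration contract by \<open>q\<close> in the weighted algebra.\<close>

locale half_line =
  fixes p :: nat and v :: "nat \<Rightarrow> nat \<Rightarrow> complex" and c q :: real and W :: "nat \<Rightarrow> real"
  assumes p: "p \<ge> 1" and c: "c > 0" and q: "q < 1"
    and v_le: "\<And>s i d. d \<le> 2 * p \<Longrightarrow> s \<le> i \<Longrightarrow>
      (real s + 1) * exp (c * sqrt (2 * real s)) * exp (c * sqrt (2 * real p)) * norm (v i d) \<le> W s"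
    and W: "summable W" "(2 * real p + 1) * suminf W \<le> q"
begin

text \<open>The half-line matrix has rows \<open>i \<ge> 0\<close>, and row \<open>i\<close> occupies the columns \<open>i, \<dots>, i + 2 p\<close>; the
  diagonal of the bi-infinite matrix is at offset \<open>d = p\<close>. It represents \<open>\<kappa> (B - \<kappa> - 1/\<kappa>)\<close>.\<close>

definition row :: "complex \<Rightarrow> nat \<Rightarrow> nat \<Rightarrow> complex" where
  "row \<kappa> i d = \<kappa> * ((if d = 0 \<or> d = 2 * p then 1 else 0) + v i d) - (\<kappa>\<^sup>2 + 1) * (if d = p then 1 else 0)"

text \<open>The Green kernel (1 - \<kappa>^(2s+2))/(1 - \<kappa>^2) of the free recurrence solved
  from infinity, written as a sum so that it stays regular at \<kappa> = 1 and \<kappa> =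
  -1.\<close>

definition ker :: "nat \<Rightarrow> complex \<Rightarrow> complex" where
  "ker s \<kappa> = (\<Sum>m\<le>s. \<kappa> ^ (2 * m))"

text \<open>The perturbation terms of the equation in column \<open>j + 2 * p\<close>, where row
  \<open>j + e\<close> enters at offset \<open>2 * p - e\<close>, after division by the common
  factor \<kappa>^(j div p + 1).\<close>

definition src :: "(nat \<Rightarrow> complex \<Rightarrow> complex) \<Rightarrow> nat \<Rightarrow> complex \<Rightarrow> complex" where
  "src f j \<kappa> = (\<Sum>e\<le>2 * p. \<kappa> ^ ((j + e) div p - j div p) * (v (j + e) (2 * p - e) * f (j + e) \<kappa>))"

text \<open>Picard iterates for the Jost solution that is free on the residue class r at infinity,
  with the decay factor \<kappa>^(i div p) removed.\<close>

primrec iter :: "nat \<Rightarrow> nat \<Rightarrow> nat \<Rightarrow> complex \<Rightarrow> complex" where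
  "iter r 0 i = (\<lambda>_. if i mod p = r then 1 else 0)"
| "iter r (Suc k) i = (\<lambda>\<kappa>. \<Sum>s. - (ker s \<kappa> * src (iter r k) (i + s * p) \<kappa>))"

definition amp :: "nat \<Rightarrow> nat \<Rightarrow> complex \<Rightarrow> complex" where
  "amp r i \<kappa> = (\<Sum>k. iter r k i \<kappa>)"

lemma W_nonneg: "0 \<le> W s"
  by (rule order_trans[OF _ v_le[of 0 s s]]) auto

lemma q_nonneg: "0 \<le> q"
  by (rule order_trans[OF _ W(2)]) (intro mult_nonneg_nonneg suminf_nonneg W W_nonneg, auto)

lemma ker_class: "sqrt_decay_class c ((real s + 1) * exp (c * sqrt (2 * real s))) (ker s)"
proof -
  have a: "sqrt_decay_class c (\<Sum>m\<le>s. exp (c * sqrt (real (2 * m)))) (ker s)"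
    unfolding ker_def[abs_def] using c by (intro sqrt_decay_class_sum sqrt_decay_class_power) auto
  have "(\<Sum>m\<le>s. exp (c * sqrt (real (2 * m)))) \<le> (\<Sum>m\<le>s. exp (c * sqrt (2 * real s)))"
    using c by (intro sum_mono) auto
  also have "\<dots> = (real s + 1) * exp (c * sqrt (2 * real s))" by simp
  finally show ?thesis by (rule sqrt_decay_class_mono[OF a])
qed

lemma div_shift_le: "(j + e) div p - j div p \<le> e"
proof -
  have "(j + e) div p \<le> (j + e * p) div p" using p by (intro div_le_mono) (cases p, auto)
  also have "\<dots> = j div p + e" using p by simp
  finally show ?thesis by simp
qed

lemma src_class:
  assumes f: "\<And>i. sqrt_decay_class c M (f i)" and sj: "s \<le> j"
  shows "sqrt_decay_class c ((2 * real p + 1) * (W s * M)) (\<lambda>\<kappa>. ker s \<kappa> * src f j \<kappa>)"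
    "sqrt_decay_class c ((2 * real p + 1) * (W s * M)) (src f j)"
proof -
  have M: "M \<ge> 0" by (rule sqrt_decay_class_nonneg[OF f])
  define b where "b e = exp (c * sqrt (2 * real p)) * (norm (v (j + e) (2 * p - e)) * M)" for e
  have src: "sqrt_decay_class c (\<Sum>e\<le>2 * p. b e) (src f j)"
    unfolding src_def[abs_def]
  proof (intro sqrt_decay_class_sum)
    fix e assume e: "e \<in> {..2 * p}"
    have "sqrt_decay_class c (exp (c * sqrt (real ((j + e) div p - j div p))) * (norm (v (j + e) (2 * p - e)) * M))
        (\<lambda>\<kappa>. \<kappa> ^ ((j + e) div p - j div p) * (v (j + e) (2 * p - e) * f (j + e) \<kappa>))"
      using c by (intro sqrt_decay_class_mult sqrt_decay_class_power sqrt_decay_class_const f) auto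
    moreover have "(j + e) div p - j div p \<le> 2 * p"
      using le_trans[OF div_shift_le[of j e], of "2 * p"] e by simp
    then have "real ((j + e) div p - j div p) \<le> 2 * real p"
      using of_nat_mono[where 'a = real] by fastforce
    then have "exp (c * sqrt (real ((j + e) div p - j div p))) \<le> exp (c * sqrt (2 * real p))"
      using c by simp
    then have "exp (c * sqrt (real ((j + e) div p - j div p))) * (norm (v (j + e) (2 * p - e)) * M) \<le> b e"
      unfolding b_def using M by (intro mult_right_mono) auto
    ultimately show "sqrt_decay_class c (b e) (\<lambda>\<kappa>. \<kappa> ^ ((j + e) div p - j div p) * (v (j + e) (2 * p - e) * f (j + e) \<kappa>))"
      by (rule sqrt_decay_class_mono)
  qed (use c in auto)
  define K where "K = (real s + 1) * exp (c * sqrt (2 * real s))"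
  have "1 * 1 \<le> (real s + 1) * exp (c * sqrt (2 * real s))" using c by (intro mult_mono) auto
  then have K: "K \<ge> 1" by (simp add: K_def)
  have "K * (\<Sum>e\<le>2 * p. b e) = (\<Sum>e\<le>2 * p. K * b e)" by (rule sum_distrib_left)
  also have "\<dots> \<le> (\<Sum>e\<le>2 * p. W s * M)"
  proof (rule sum_mono)
    fix e assume "e \<in> {..2 * p}"
    have "K * exp (c * sqrt (2 * real p)) * norm (v (j + e) (2 * p - e)) \<le> W s"
      unfolding K_def using sj by (intro v_le) auto
    from mult_right_mono[OF this M] show "K * b e \<le> W s * M" unfolding b_def by (simp only: mult.assoc)
  qed
  also have "\<dots> = (2 * real p + 1) * (W s * M)" by (simp add: algebra_simps)
  finally have le: "K * (\<Sum>e\<le>2 * p. b e) \<le> (2 * real p + 1) * (W s * M)" .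
  show "sqrt_decay_class c ((2 * real p + 1) * (W s * M)) (\<lambda>\<kappa>. ker s \<kappa> * src f j \<kappa>)"
    using sqrt_decay_class_mono[OF sqrt_decay_class_mult[OF ker_class src] le[unfolded K_def]] c by simp
  have "1 * (\<Sum>e\<le>2 * p. b e) \<le> K * (\<Sum>e\<le>2 * p. b e)"
    using K M by (intro mult_right_mono sum_nonneg) (auto simp: b_def)
  then show "sqrt_decay_class c ((2 * real p + 1) * (W s * M)) (src f j)"
    using le by (intro sqrt_decay_class_mono[OF src]) simp
qed

lemma s_le_shift: "s \<le> i + s * p"
  using p by (metis le_add2 le_trans mult.right_neutral mult_le_mono2)

lemma iter_class: "sqrt_decay_class c (q ^ k) (iter r k i)"
proof (induction k arbitrary: i)
  case 0
  show ?case using sqrt_decay_class_const[of c "if i mod p = r then 1 else 0"]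
    by (auto intro: sqrt_decay_class_mono)
next
  case (Suc k)
  have "sqrt_decay_class c (\<Sum>s. (2 * real p + 1) * (W s * q ^ k)) (iter r (Suc k) i)"
    unfolding iter.simps
  proof (rule sqrt_decay_class_suminf)
    fix s
    show "sqrt_decay_class c ((2 * real p + 1) * (W s * q ^ k)) (\<lambda>\<kappa>. - (ker s \<kappa> * src (iter r k) (i + s * p) \<kappa>))"
      using sqrt_decay_class_cmult[where z = "-1", OF src_class(1)[where s = s and j = "i + s * p", OF Suc s_le_shift]] c by simp
  qed (use c W(1) in \<open>auto intro!: summable_mult summable_mult2\<close>)
  moreover have "(\<Sum>s. (2 * real p + 1) * (W s * q ^ k)) = ((2 * real p + 1) * suminf W) * q ^ k"
    using W(1) by (subst suminf_mult) (auto simp: suminf_mult2 intro!: summable_mult2)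
  moreover have "\<dots> \<le> q * q ^ k" using W(2) q_nonneg by (intro mult_right_mono) auto
  ultimately show ?case using sqrt_decay_class_mono by simp
qed

lemma geometric_q: "summable (\<lambda>k. q ^ k)" "suminf (\<lambda>k. q ^ k) = 1 / (1 - q)"
  using q q_nonneg by (auto intro!: summable_geometric suminf_geometric)

lemma amp_class: "sqrt_decay_class c (1 / (1 - q)) (amp r i)"
  using sqrt_decay_class_suminf[OF iter_class geometric_q(1)] c
  unfolding amp_def[abs_def] geometric_q(2) by simp

lemma iter_norm_le: "norm \<kappa> \<le> 1 \<Longrightarrow> norm (iter r k i \<kappa>) \<le> q ^ k"
  using sqrt_decay_class_norm_le[OF iter_class] c by simp

lemma amp_norm_le: "norm \<kappa> \<le> 1 \<Longrightarrow> norm (amp r i \<kappa>) \<le> 1 / (1 - q)"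
  using sqrt_decay_class_norm_le[OF amp_class] c by simp

lemma summable_iter: "norm \<kappa> \<le> 1 \<Longrightarrow> summable (\<lambda>k. iter r k i \<kappa>)"
  by (rule summable_comparison_test'[OF geometric_q(1), of 0]) (use iter_norm_le in auto)

lemma amp_split: "norm \<kappa> \<le> 1 \<Longrightarrow> amp r i \<kappa> = iter r 0 i \<kappa> + (\<Sum>k. iter r (Suc k) i \<kappa>)"
  unfolding amp_def using suminf_split_head[OF summable_iter, of \<kappa> r i] by simp

lemma amp_near_free:
  assumes "norm \<kappa> \<le> 1"
  shows "norm (amp r i \<kappa> - (if i mod p = r then 1 else 0)) \<le> q / (1 - q)"
proof -
  have "norm (\<Sum>k. iter r (Suc k) i \<kappa>) \<le> (\<Sum>k. q ^ Suc k)"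
    by (rule norm_suminf_le[OF iter_norm_le[OF assms]]) (use geometric_q(1) in \<open>simp add: summable_mult\<close>)
  also have "\<dots> = q / (1 - q)" using geometric_q by (simp add: suminf_mult)
  finally show ?thesis unfolding amp_split[OF assms] by simp
qed

lemma amp_fixed_point:
  assumes \<kappa>: "norm \<kappa> \<le> 1"
  shows "amp r i \<kappa> = iter r 0 i \<kappa> - (\<Sum>s. ker s \<kappa> * src (amp r) (i + s * p) \<kappa>)"
    "summable (\<lambda>s. ker s \<kappa> * src (amp r) (i + s * p) \<kappa>)"
    "summable (\<lambda>s. src (amp r) (i + s * p) \<kappa>)"
proof -
  define x where "x k s = - (ker s \<kappa> * src (iter r k) (i + s * p) \<kappa>)" for k s
  have xb: "norm (x k s) \<le> (2 * real p + 1) * (W s * q ^ k)" for k s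
    unfolding x_def norm_minus_cancel
    by (rule sqrt_decay_class_norm_le[OF src_class(1)[OF iter_class s_le_shift] _ \<kappa>]) (use c in simp)
  have sW: "summable (\<lambda>s. (2 * real p + 1) * (W s * y))" for y by (intro summable_mult summable_mult2 W)
  have s1: "summable (\<lambda>s. norm (x k s))" for k
    by (rule summable_comparison_test'[OF sW, of 0]) (use xb in auto)
  have Wk: "(\<Sum>s. (2 * real p + 1) * (W s * y)) = ((2 * real p + 1) * suminf W) * y" for y
    using W(1) by (subst suminf_mult) (auto simp: suminf_mult2 intro!: summable_mult2)
  have s2: "summable (\<lambda>k. \<Sum>s. norm (x k s))"
  proof (rule summable_comparison_test'[OF summable_mult[OF geometric_q(1), of "(2 * real p + 1) * suminf W"], of 0])
    fix k
    have "(\<Sum>s. norm (x k s)) \<le> (\<Sum>s. (2 * real p + 1) * (W s * q ^ k))" by (rule suminf_le[OF xb s1 sW])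
    then show "norm (\<Sum>s. norm (x k s)) \<le> (2 * real p + 1) * suminf W * q ^ k"
      unfolding Wk using suminf_nonneg[OF s1[of k]] by simp
  qed
  have col: "(\<Sum>k. x k s) = - (ker s \<kappa> * src (amp r) (i + s * p) \<kappa>)" for s
  proof -
    have "src (amp r) (i + s * p) \<kappa> = (\<Sum>k. src (iter r k) (i + s * p) \<kappa>)"
      unfolding src_def amp_def
      by (subst suminf_sum) (auto intro!: summable_mult summable_iter \<kappa> sum.cong simp: suminf_mult summable_iter[OF \<kappa>] summable_mult)
    moreover have "summable (\<lambda>k. src (iter r k) (i + s * p) \<kappa>)"
      unfolding src_def by (intro summable_sum summable_mult summable_iter \<kappa>)
    ultimately show ?thesis unfolding x_def by (simp add: suminf_minus suminf_mult summable_mult)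
  qed
  have "(\<Sum>k. iter r (Suc k) i \<kappa>) = (\<Sum>k. \<Sum>s. x k s)" by (simp add: x_def)
  also have "\<dots> = (\<Sum>s. \<Sum>k. x k s)" by (rule summable_swap(3)[OF s1 s2])
  finally have e: "(\<Sum>k. iter r (Suc k) i \<kappa>) = (\<Sum>s. - (ker s \<kappa> * src (amp r) (i + s * p) \<kappa>))" by (simp only: col)
  show s: "summable (\<lambda>s. ker s \<kappa> * src (amp r) (i + s * p) \<kappa>)"
    by (rule summable_comparison_test'[OF sW, of 0])
      (rule sqrt_decay_class_norm_le[OF src_class(1)[where f = "amp r", OF amp_class s_le_shift] less_imp_le[OF c] \<kappa>])
  show "summable (\<lambda>s. src (amp r) (i + s * p) \<kappa>)"
    by (rule summable_comparison_test'[OF sW, of 0])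
      (rule sqrt_decay_class_norm_le[OF src_class(2)[where f = "amp r", OF amp_class s_le_shift] less_imp_le[OF c] \<kappa>])
  show "amp r i \<kappa> = iter r 0 i \<kappa> - (\<Sum>s. ker s \<kappa> * src (amp r) (i + s * p) \<kappa>)"
    unfolding amp_split[OF \<kappa>] e using suminf_minus[OF s] by simp
qed

text \<open>The tail sums \<open>U\<close> satisfy U(i) - U(i + p) = \<tau>(i), and the kernel
  satisfies ker(s + 1) = 1 + \<kappa>^2 ker(s), so S(i) - \<kappa>^2 S(i + p) = U(i). Applying the
  free recurrence to \<open>S\<close> therefore leaves just the source, while the constant free part
  drops out.\<close>

lemma amp_recurrence:
  assumes \<kappa>: "norm \<kappa> \<le> 1"
  shows "\<kappa>\<^sup>2 * amp r (i + 2 * p) \<kappa> + amp r i \<kappa> - (\<kappa>\<^sup>2 + 1) * amp r (i + p) \<kappa> + src (amp r) i \<kappa> = 0"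
proof -
  define \<tau> where "\<tau> j = src (amp r) j \<kappa>" for j
  define S where "S i = (\<Sum>s. ker s \<kappa> * \<tau> (i + s * p))" for i
  define U where "U i = (\<Sum>s. \<tau> (i + s * p))" for i
  have sK: "summable (\<lambda>s. ker s \<kappa> * \<tau> (i + s * p))" and sT: "summable (\<lambda>s. \<tau> (i + s * p))" for i
    using amp_fixed_point(2,3)[OF \<kappa>] by (simp_all add: \<tau>_def)
  have sh: "i + Suc s * p = i + p + s * p" for i s by simp
  have kS: "ker (Suc s) \<kappa> = 1 + \<kappa>\<^sup>2 * ker s \<kappa>" for s
  proof -
    have "ker (Suc s) \<kappa> = 1 + (\<Sum>m\<le>s. \<kappa> ^ (2 * Suc m))"
      unfolding ker_def by (simp only: sum.atMost_Suc_shift) simp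
    also have "(\<Sum>m\<le>s. \<kappa> ^ (2 * Suc m)) = \<kappa>\<^sup>2 * ker s \<kappa>"
      unfolding ker_def by (simp add: sum_distrib_left power2_eq_square mult_ac)
    finally show ?thesis .
  qed
  have U: "U i = \<tau> i + U (i + p)" for i
    using suminf_split_head[OF sT[of i]] unfolding U_def sh by simp
  have S: "S i = U i + \<kappa>\<^sup>2 * S (i + p)" for i
  proof -
    have "S i = ker 0 \<kappa> * \<tau> i + (\<Sum>s. ker (Suc s) \<kappa> * \<tau> (i + p + s * p))"
      using suminf_split_head[OF sK[of i]] unfolding S_def sh by simp
    also have "(\<Sum>s. ker (Suc s) \<kappa> * \<tau> (i + p + s * p)) = (\<Sum>s. \<tau> (i + p + s * p) + \<kappa>\<^sup>2 * (ker s \<kappa> * \<tau> (i + p + s * p)))"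
      unfolding kS by (simp add: algebra_simps)
    also have "\<dots> = U (i + p) + \<kappa>\<^sup>2 * S (i + p)"
      unfolding U_def S_def by (subst suminf_add[symmetric]) (auto intro!: sT sK summable_mult simp: suminf_mult[OF sK])
    finally show ?thesis using U[of i] by (simp add: ker_def)
  qed
  have A: "amp r j \<kappa> = iter r 0 j \<kappa> - S j" for j
    unfolding S_def \<tau>_def by (rule amp_fixed_point(1)[OF \<kappa>])
  have per: "iter r 0 (i + p) \<kappa> = iter r 0 i \<kappa>" "iter r 0 (i + 2 * p) \<kappa> = iter r 0 i \<kappa>" by simp_all
  have i2: "i + 2 * p = i + p + p" by simp
  have "\<kappa>\<^sup>2 * amp r (i + 2 * p) \<kappa> + amp r i \<kappa> - (\<kappa>\<^sup>2 + 1) * amp r (i + p) \<kappa> =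
      (S (i + p) - \<kappa>\<^sup>2 * S (i + p + p)) - (S i - \<kappa>\<^sup>2 * S (i + p))"
    unfolding A per unfolding i2 by (simp add: algebra_simps)
  also have "\<dots> = U (i + p) - U i" using S[of i] S[of "i + p"] by simp
  also have "\<dots> = - \<tau> i" using U[of i] by simp
  finally show ?thesis unfolding \<tau>_def by simp
qed

section \<open>Jost solutions and their boundary terms\<close>

definition jost :: "nat \<Rightarrow> complex \<Rightarrow> nat \<Rightarrow> complex" where
  "jost r \<kappa> i = \<kappa> ^ (i div p) * amp r i \<kappa>"

text \<open>Component l of the row vector \<open>jost\<close> times the half-line matrix; for small
  l the columns lack rows, which is why these components survive.\<close>

definition bdry :: "nat \<Rightarrow> nat \<Rightarrow> complex \<Rightarrow> complex" where
  "bdry r l \<kappa> = (\<Sum>d\<le>min l (2 * p). jost r \<kappa> (l - d) * row \<kappa> (l - d) d)"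

lemma sum_three:
  fixes g :: "nat \<Rightarrow> complex"
  shows "(\<Sum>d\<le>2 * p. g d * (\<alpha> * (if d = 0 \<or> d = 2 * p then 1 else 0) - \<beta> * (if d = p then 1 else 0))) =
     \<alpha> * g 0 + \<alpha> * g (2 * p) - \<beta> * g p"
proof -
  have "(\<Sum>d\<le>2 * p. g d * (\<alpha> * (if d = 0 \<or> d = 2 * p then 1 else 0) - \<beta> * (if d = p then 1 else 0))) =
      (\<Sum>d\<in>{0, p, 2 * p}. g d * (\<alpha> * (if d = 0 \<or> d = 2 * p then 1 else 0) - \<beta> * (if d = p then 1 else 0)))"
    by (rule sum.mono_neutral_right) auto
  then show ?thesis using p by (simp add: algebra_simps)
qed

text \<open>From l = 2 p on, every row meeting column l exists, and the column equation is a power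
  of \<kappa> times \<open>amp_recurrence\<close>.\<close>

lemma bdry_eq_0:
  assumes \<kappa>: "norm \<kappa> \<le> 1" and l: "l \<ge> 2 * p"
  shows "bdry r l \<kappa> = 0"
proof -
  define i where "i = l - 2 * p"
  have li: "l = i + 2 * p" using l by (simp add: i_def)
  define n where "n = i div p"
  have dp: "(i + p) div p = n + 1" "(i + 2 * p) div p = n + 2" using p by (simp_all add: n_def)
  have "bdry r l \<kappa> = (\<Sum>d\<le>2 * p. jost r \<kappa> (l - d) * row \<kappa> (l - d) d)"
    unfolding bdry_def using l by (simp add: min_absorb2)
  also have "\<dots> = (\<Sum>d\<le>2 * p. jost r \<kappa> (l - d) * (\<kappa> * (if d = 0 \<or> d = 2 * p then 1 else 0) - (\<kappa>\<^sup>2 + 1) * (if d = p then 1 else 0)))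
      + (\<Sum>d\<le>2 * p. jost r \<kappa> (l - d) * (\<kappa> * v (l - d) d))"
    unfolding row_def sum.distrib[symmetric] by (intro sum.cong) (auto simp: algebra_simps)
  also have "(\<Sum>d\<le>2 * p. jost r \<kappa> (l - d) * (\<kappa> * (if d = 0 \<or> d = 2 * p then 1 else 0) - (\<kappa>\<^sup>2 + 1) * (if d = p then 1 else 0)))
      = \<kappa> * jost r \<kappa> (i + 2 * p) + \<kappa> * jost r \<kappa> i - (\<kappa>\<^sup>2 + 1) * jost r \<kappa> (i + p)"
  proof -
    have l': "l - 0 = i + 2 * p" "l - 2 * p = i" "l - p = i + p" using li by auto
    show ?thesis unfolding sum_three l' ..
  qed
  also have "(\<Sum>d\<le>2 * p. jost r \<kappa> (l - d) * (\<kappa> * v (l - d) d)) = (\<Sum>e\<le>2 * p. jost r \<kappa> (i + e) * (\<kappa> * v (i + e) (2 * p - e)))"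
    by (rule sum.reindex_bij_witness[of _ "\<lambda>e. 2 * p - e" "\<lambda>d. 2 * p - d"]) (auto simp: li)
  also have "\<dots> = \<kappa> ^ (n + 1) * src (amp r) i \<kappa>"
    unfolding src_def sum_distrib_left
  proof (intro sum.cong refl)
    fix e
    have "i div p \<le> (i + e) div p" by (intro div_le_mono) simp
    then have "\<kappa> ^ ((i + e) div p) = \<kappa> ^ n * \<kappa> ^ ((i + e) div p - i div p)"
      unfolding n_def by (simp flip: power_add)
    then show "jost r \<kappa> (i + e) * (\<kappa> * v (i + e) (2 * p - e)) =
        \<kappa> ^ (n + 1) * (\<kappa> ^ ((i + e) div p - i div p) * (v (i + e) (2 * p - e) * amp r (i + e) \<kappa>))"
      unfolding jost_def by (simp add: mult_ac)
  qed
  also have "\<kappa> * jost r \<kappa> (i + 2 * p) + \<kappa> * jost r \<kappa> i - (\<kappa>\<^sup>2 + 1) * jost r \<kappa> (i + p) + \<kappa> ^ (n + 1) * src (amp r) i \<kappa> =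
      \<kappa> ^ (n + 1) * (\<kappa>\<^sup>2 * amp r (i + 2 * p) \<kappa> + amp r i \<kappa> - (\<kappa>\<^sup>2 + 1) * amp r (i + p) \<kappa> + src (amp r) i \<kappa>)"
    unfolding jost_def dp n_def[symmetric] by (simp add: algebra_simps power2_eq_square)
  finally show ?thesis by (simp only: amp_recurrence[OF \<kappa>] mult_zero_right)
qed

lemma bdry_class: "\<exists>N. sqrt_decay_class c N (bdry r l)"
proof -
  have c0: "c \<ge> 0" using c by simp
  have "\<exists>N. sqrt_decay_class c N (\<lambda>\<kappa>. jost r \<kappa> (l - d) * row \<kappa> (l - d) d)" for d
  proof -
    have J: "sqrt_decay_class c (exp (c * sqrt (real ((l - d) div p))) * (1 / (1 - q))) (\<lambda>\<kappa>. jost r \<kappa> (l - d))"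
      unfolding jost_def by (intro sqrt_decay_class_mult sqrt_decay_class_power amp_class c0)
    define A where "A = (if d = 0 \<or> d = 2 * p then 1 else 0) + v (l - d) d"
    define B where "B = (if d = p then -1 else 0 :: complex)"
    have "sqrt_decay_class c (exp (c * sqrt (real 1)) * norm A + (exp (c * sqrt (real 2)) + norm (1::complex)) * norm B)
        (\<lambda>\<kappa>. \<kappa> ^ 1 * A + (\<kappa> ^ 2 + 1) * B)"
      by (intro sqrt_decay_class_add sqrt_decay_class_mult sqrt_decay_class_power sqrt_decay_class_const c0)
    moreover have "(\<lambda>\<kappa>. \<kappa> ^ 1 * A + (\<kappa> ^ 2 + 1) * B) = (\<lambda>\<kappa>. row \<kappa> (l - d) d)"
      by (auto simp: fun_eq_iff row_def A_def B_def)
    ultimately have "sqrt_decay_class c (exp (c * sqrt (real 1)) * norm A + (exp (c * sqrt (real 2)) + norm (1::complex)) * norm B)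
        (\<lambda>\<kappa>. row \<kappa> (l - d) d)" by simp
    from sqrt_decay_class_mult[OF J this c0] show ?thesis by (rule exI)
  qed
  then obtain N where "\<And>d. sqrt_decay_class c (N d) (\<lambda>\<kappa>. jost r \<kappa> (l - d) * row \<kappa> (l - d) d)" by metis
  then have "sqrt_decay_class c (\<Sum>d\<le>min l (2 * p). N d) (\<lambda>\<kappa>. \<Sum>d\<le>min l (2 * p). jost r \<kappa> (l - d) * row \<kappa> (l - d) d)"
    by (intro sqrt_decay_class_sum c0)
  then show ?thesis unfolding bdry_def[abs_def] by (rule exI)
qed

text \<open>At \<kappa> = 0 the matrix row reduces to -1 at offset p, so the boundary vector is
  minus the first p values of the Jost solution, which differ from a unit vector by at most the
  geometric tail of the iteration.\<close>

lemma bdry_at_0: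
  assumes l: "l < 2 * p" and r: "r < p"
  shows "norm (bdry r l 0 + (if l = p + r then 1 else 0)) \<le> (if l < p then 0 else q / (1 - q))"
proof -
  have "bdry r l 0 = (\<Sum>d\<le>min l (2 * p). if d = p then - jost r 0 (l - p) else 0)"
    unfolding bdry_def by (intro sum.cong) (auto simp: row_def)
  also have "\<dots> = (if l < p then 0 else - jost r 0 (l - p))" by auto
  finally have e: "bdry r l 0 = (if l < p then 0 else - jost r 0 (l - p))" .
  show ?thesis
  proof (cases "l < p")
    case False
    then have lp: "l - p < p" "(l = p + r) = (l - p = r)" using l by auto
    have "bdry r l 0 + (if l = p + r then 1 else 0) = - (amp r (l - p) 0 - (if (l - p) mod p = r then 1 else 0))"
      using False lp unfolding e jost_def by auto
    then have "norm (bdry r l 0 + (if l = p + r then 1 else 0)) = norm (amp r (l - p) 0 - (if (l - p) mod p = r then 1 else 0))"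
      by (simp only: norm_minus_cancel)
    then show ?thesis using amp_near_free[of 0 r "l - p"] False by simp
  qed (use r e in auto)
qed

lemma summable_power_div:
  assumes "0 < \<rho>" "\<rho> < (1::real)"
  shows "summable (\<lambda>i. \<rho> ^ (i div p))"
proof -
  define \<sigma> where "\<sigma> = root p \<rho>"
  have \<sigma>: "0 < \<sigma>" "\<sigma> < 1" "\<sigma> ^ p = \<rho>" using assms p by (simp_all add: \<sigma>_def)
  have le: "\<rho> ^ (i div p) \<le> (1 / \<rho>) * \<sigma> ^ i" for i
  proof -
    have "i \<le> p * (i div p) + p" using p mod_less_divisor[of p i] mult_div_mod_eq[of p i] by linarith
    then have "\<sigma> ^ (p * (i div p) + p) \<le> \<sigma> ^ i" using \<sigma> by (intro power_decreasing) auto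
    then have "\<rho> ^ (i div p) * \<rho> \<le> \<sigma> ^ i" by (simp add: power_add power_mult \<sigma>(3))
    then show ?thesis using assms by (simp add: field_simps)
  qed
  have s: "summable (\<lambda>i. (1 / \<rho>) * \<sigma> ^ i)" using \<sigma> by (intro summable_mult summable_geometric) simp
  show ?thesis
  proof (rule summable_comparison_test'[OF s, of 0])
    show "norm (\<rho> ^ (i div p)) \<le> (1 / \<rho>) * \<sigma> ^ i" for i
      using le[of i] assms(1) by (simp only: real_norm_def abs_of_pos zero_less_power)
  qed
qed

text \<open>The Jost solution annihilates the matrix from the left, so summation by parts leaves only boundary terms.\<close>

lemma jost_pairing:
  assumes \<rho>: "0 < \<rho>" "\<rho> < 1"
  shows "\<exists>G. \<forall>\<kappa> u B \<eta>. norm \<kappa> \<le> \<rho> \<longrightarrow> (\<forall>l. norm (u l) \<le> B) \<longrightarrow>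
     (\<forall>i. norm (\<Sum>d\<le>2 * p. row \<kappa> i d * u (i + d)) \<le> \<eta>) \<longrightarrow> norm (\<Sum>l<2 * p. bdry r l \<kappa> * u l) \<le> G * \<eta>"
proof -
  define A where "A = 1 / (1 - q)"
  have A: "A > 0" using q by (simp add: A_def)
  have sd: "summable (\<lambda>i. \<rho> ^ (i div p))" by (rule summable_power_div[OF \<rho>])
  have sA: "summable (\<lambda>i. \<rho> ^ (i div p) * A)" by (rule summable_mult2[OF sd])
  have vb: "norm (v i d) \<le> W 0" if "d \<le> 2 * p" for i d
  proof -
    have "1 * norm (v i d) \<le> exp (c * sqrt (2 * real p)) * norm (v i d)"
      using c by (intro mult_right_mono) auto
    then show ?thesis using v_le[OF that, of 0 i] by simp
  qed
  have "norm (\<Sum>l<2 * p. bdry r l \<kappa> * u l) \<le> (\<Sum>i. \<rho> ^ (i div p) * A) * \<eta>"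
    if \<kappa>: "norm \<kappa> \<le> \<rho>" and u: "\<And>l. norm (u l) \<le> B" and h: "\<And>i. norm (\<Sum>d\<le>2 * p. row \<kappa> i d * u (i + d)) \<le> \<eta>"
    for \<kappa> u B \<eta>
  proof -
    have \<kappa>1: "norm \<kappa> \<le> 1" using \<kappa> \<rho> by simp
    have Fb: "norm (jost r \<kappa> i) \<le> \<rho> ^ (i div p) * A" for i
      unfolding jost_def norm_mult norm_power A_def
      using \<kappa> \<rho> by (intro mult_mono power_mono amp_norm_le \<kappa>1) auto
    have rb: "norm (row \<kappa> i d) \<le> 3 + W 0" if "d \<le> 2 * p" for i d
    proof -
      have 1: "norm (\<kappa> * ((if d = 0 \<or> d = 2 * p then 1 else 0) + v i d)) \<le> 1 * (1 + W 0)"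
        unfolding norm_mult using \<kappa>1 vb[OF that, of i]
        by (intro mult_mono order_trans[OF norm_triangle_ineq] add_mono) auto
      have "norm (\<kappa>\<^sup>2 + 1) \<le> 1 + 1"
        by (intro order_trans[OF norm_triangle_ineq] add_mono) (auto simp: norm_power power_le_one \<kappa>1)
      then have 2: "norm ((\<kappa>\<^sup>2 + 1) * (if d = p then 1 else 0)) \<le> 2" by auto
      have "norm (row \<kappa> i d) \<le> norm (\<kappa> * ((if d = 0 \<or> d = 2 * p then 1 else 0) + v i d))
          + norm ((\<kappa>\<^sup>2 + 1) * (if d = p then 1 else 0))"
        unfolding row_def by (rule norm_triangle_ineq4)
      also have "\<dots> \<le> 1 * (1 + W 0) + 2" by (rule add_mono[OF 1 2])
      finally show ?thesis by simp
    qed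
    have B: "B \<ge> 0" using order_trans[OF norm_ge_zero u] .
    define x where "x d i = jost r \<kappa> i * row \<kappa> i d * u (i + d)" for d i
    have sx: "summable (x d)" if d: "d \<le> 2 * p" for d
    proof (rule summable_comparison_test'[OF summable_mult2[OF sA, of "(3 + W 0) * B"], of 0])
      fix i
      have "norm (x d i) \<le> (\<rho> ^ (i div p) * A) * (3 + W 0) * B"
        unfolding x_def norm_mult using \<rho> A B W_nonneg[of 0]
        by (intro mult_mono Fb rb d u) auto
      then show "norm (x d i) \<le> \<rho> ^ (i div p) * A * ((3 + W 0) * B)" by (simp only: mult.assoc)
    qed
    have eq1: "(\<Sum>i. jost r \<kappa> i * (\<Sum>d\<le>2 * p. row \<kappa> i d * u (i + d))) = (\<Sum>d\<le>2 * p. \<Sum>i. x d i)"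
    proof -
      have "(\<Sum>i. jost r \<kappa> i * (\<Sum>d\<le>2 * p. row \<kappa> i d * u (i + d))) = (\<Sum>i. \<Sum>d\<le>2 * p. x d i)"
        unfolding x_def sum_distrib_left by (simp add: mult.assoc)
      also have "\<dots> = (\<Sum>d\<le>2 * p. \<Sum>i. x d i)" by (rule suminf_sum) (use sx in auto)
      finally show ?thesis .
    qed
    \<comment> \<open>Reindexing by the column l = i + d, padded with zeros for l < d, so that
      adding over d collects the components \<open>bdry\<close>.\<close>
    define y where "y d l = (if l < d then 0 else x d (l - d))" for d l
    have y: "y d sums (\<Sum>i. x d i)" if "d \<le> 2 * p" for d
      using sums_zero_iff_shift[of d "y d" "\<Sum>i. x d i"] summable_sums[OF sx[OF that]] by (simp add: y_def[abs_def])
    have "(\<lambda>l. \<Sum>d\<le>2 * p. y d l) sums (\<Sum>d\<le>2 * p. \<Sum>i. x d i)" by (intro sums_sum y) auto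
    moreover have "(\<Sum>d\<le>2 * p. y d l) = bdry r l \<kappa> * u l" for l
    proof -
      have "(\<Sum>d\<le>2 * p. y d l) = (\<Sum>d\<le>min l (2 * p). y d l)"
        by (rule sum.mono_neutral_right) (auto simp: y_def)
      also have "\<dots> = (\<Sum>d\<le>min l (2 * p). jost r \<kappa> (l - d) * row \<kappa> (l - d) d * u l)"
        by (intro sum.cong) (auto simp: y_def x_def)
      finally show ?thesis unfolding bdry_def by (simp add: sum_distrib_right)
    qed
    ultimately have "(\<lambda>l. bdry r l \<kappa> * u l) sums (\<Sum>d\<le>2 * p. \<Sum>i. x d i)" by simp
    moreover have "(\<lambda>l. bdry r l \<kappa> * u l) sums (\<Sum>l<2 * p. bdry r l \<kappa> * u l)"
      by (rule sums_finite) (auto simp: bdry_eq_0[OF \<kappa>1])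
    ultimately have "(\<Sum>l<2 * p. bdry r l \<kappa> * u l) = (\<Sum>d\<le>2 * p. \<Sum>i. x d i)" by (rule sums_unique2[symmetric])
    also have "norm \<dots> \<le> (\<Sum>i. (\<rho> ^ (i div p) * A) * \<eta>)"
      unfolding eq1[symmetric]
    proof (rule norm_suminf_le)
      fix i
      show "norm (jost r \<kappa> i * (\<Sum>d\<le>2 * p. row \<kappa> i d * u (i + d))) \<le> (\<rho> ^ (i div p) * A) * \<eta>"
        unfolding norm_mult using \<rho> A by (intro mult_mono Fb h) auto
    qed (rule summable_mult2[OF sA])
    also have "\<dots> = (\<Sum>i. \<rho> ^ (i div p) * A) * \<eta>" by (rule suminf_mult2[OF sA, symmetric])
    finally show ?thesis .
  qed
  then show ?thesis by blast
qed

end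

section \<open>Determinants and finite-rank perturbations\<close>

definition fdet :: "nat \<Rightarrow> (nat \<Rightarrow> nat \<Rightarrow> complex) \<Rightarrow> complex" where
  "fdet n A = Determinant.det (Matrix.mat n n (\<lambda>(i, j). A i j))"

lemma fdet_leibniz:
  "fdet n A = (\<Sum>\<pi> | \<pi> permutes {0..<n}. of_int (sign \<pi>) * (\<Prod>i = 0..<n. A i (\<pi> i)))"
proof -
  have "fdet n A = (\<Sum>\<pi> | \<pi> permutes {0..<n}. of_int (sign \<pi>) * (\<Prod>i = 0..<n. Matrix.mat n n (\<lambda>(i, j). A i j) $$ (i, \<pi> i)))"
    unfolding fdet_def Determinant.det_def by simp
  also have "\<dots> = (\<Sum>\<pi> | \<pi> permutes {0..<n}. of_int (sign \<pi>) * (\<Prod>i = 0..<n. A i (\<pi> i)))"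
  proof (intro sum.cong refl arg_cong2[where f = "(*)"] prod.cong)
    fix \<pi> i assume "\<pi> \<in> {\<pi>. \<pi> permutes {0..<n}}" "i \<in> {0..<n}"
    then have "\<pi> i < n" "i < n" using permutes_in_image[of \<pi> "{0..<n}" i] by auto
    then show "Matrix.mat n n (\<lambda>(i, j). A i j) $$ (i, \<pi> i) = A i (\<pi> i)" by simp
  qed
  finally show ?thesis .
qed

lemma mat_mult_vec_nth:
  assumes "i < n"
  shows "vec_index (Matrix.mat n n (\<lambda>(i, j). A i j) *\<^sub>v Matrix.vec n x) i = (\<Sum>j<n. A i j * x j)"
  using assms by (simp add: scalar_prod_def lessThan_atLeast0)

lemma fdet_eq_0_imp_kernel:
  assumes "fdet n A = 0"
  obtains v where "\<exists>i<n. v i \<noteq> 0" "\<And>i. i < n \<Longrightarrow> (\<Sum>j<n. A i j * v j) = 0"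
proof -
  let ?M = "Matrix.mat n n (\<lambda>(i, j). A i j)"
  have M: "?M \<in> carrier_mat n n" by simp
  obtain w where w: "w \<in> carrier_vec n" "w \<noteq> 0\<^sub>v n" "?M *\<^sub>v w = 0\<^sub>v n"
    using assms det_0_iff_vec_prod_zero[OF M] unfolding fdet_def by auto
  define v where "v i = vec_index w i" for i
  have wv: "w = Matrix.vec n v" using w(1) by (auto simp: v_def)
  have "(\<Sum>j<n. A i j * v j) = 0" if "i < n" for i
    using mat_mult_vec_nth[OF that, of A v] w(3) that unfolding wv by simp
  moreover have "\<exists>i<n. v i \<noteq> 0" using w(1,2) unfolding v_def by (auto simp: vec_eq_iff)
  ultimately show thesis using that by blast
qed

lemma fdet_nonzero_inverse:
  assumes "fdet n A \<noteq> 0"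
  obtains B where "\<And>b i. i < n \<Longrightarrow> (\<Sum>j<n. A i j * (\<Sum>k<n. B j k * b k)) = b i"
    "\<And>b i. i < n \<Longrightarrow> (\<Sum>j<n. B i j * (\<Sum>k<n. A j k * b k)) = b i"
proof -
  let ?M = "Matrix.mat n n (\<lambda>(i, j). A i j)"
  have M: "?M \<in> carrier_mat n n" by simp
  define B where "B i j = adj_mat ?M $$ (i, j) / fdet n A" for i j
  have adj: "adj_mat ?M \<in> carrier_mat n n" by (rule adj_mat(1)[OF M])
  have 1: "(\<Sum>j<n. A i j * B j k) = (if i = k then 1 else 0)" if "i < n" "k < n" for i k
  proof -
    have "(?M * adj_mat ?M) $$ (i, k) = (\<Sum>j<n. A i j * adj_mat ?M $$ (j, k))"
      using that adj by (simp add: scalar_prod_def lessThan_atLeast0)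
    moreover have "(?M * adj_mat ?M) $$ (i, k) = (if i = k then fdet n A else 0)"
      unfolding adj_mat(2)[OF M] fdet_def using that by simp
    ultimately have "(\<Sum>j<n. A i j * adj_mat ?M $$ (j, k)) = (if i = k then fdet n A else 0)" by (simp only:)
    then have "(\<Sum>j<n. A i j * adj_mat ?M $$ (j, k)) / fdet n A = (if i = k then 1 else 0)"
      using assms by simp
    then show ?thesis by (simp add: B_def sum_divide_distrib)
  qed
  have 2: "(\<Sum>j<n. B i j * A j k) = (if i = k then 1 else 0)" if "i < n" "k < n" for i k
  proof -
    have "(adj_mat ?M * ?M) $$ (i, k) = (\<Sum>j<n. adj_mat ?M $$ (i, j) * A j k)"
      using that adj by (simp add: scalar_prod_def lessThan_atLeast0)
    moreover have "(adj_mat ?M * ?M) $$ (i, k) = (if i = k then fdet n A else 0)"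
      unfolding adj_mat(3)[OF M] fdet_def using that by simp
    ultimately have "(\<Sum>j<n. adj_mat ?M $$ (i, j) * A j k) = (if i = k then fdet n A else 0)" by (simp only:)
    then have "(\<Sum>j<n. adj_mat ?M $$ (i, j) * A j k) / fdet n A = (if i = k then 1 else 0)"
      using assms by simp
    then show ?thesis by (simp add: B_def sum_divide_distrib)
  qed
  have swap: "(\<Sum>j<n. X i j * (\<Sum>k<n. Y j k * b k)) = (\<Sum>k<n. (\<Sum>j<n. X i j * Y j k) * b k)"
    for X Y :: "nat \<Rightarrow> nat \<Rightarrow> complex" and b i
  proof -
    have "(\<Sum>j<n. X i j * (\<Sum>k<n. Y j k * b k)) = (\<Sum>j<n. \<Sum>k<n. X i j * Y j k * b k)"
      by (simp add: sum_distrib_left mult.assoc)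
    also have "\<dots> = (\<Sum>k<n. \<Sum>j<n. X i j * Y j k * b k)" by (rule sum.swap)
    finally show ?thesis by (simp add: sum_distrib_right)
  qed
  have d: "(\<Sum>k<n. (if i = k then 1 else 0) * b k) = b i" if "i < n" for b :: "nat \<Rightarrow> complex" and i
  proof -
    have "(\<Sum>k<n. (if i = k then 1 else 0) * b k) = (\<Sum>k<n. if i = k then b k else 0)" by (intro sum.cong) auto
    then show ?thesis using that by simp
  qed
  have "(\<Sum>j<n. A i j * (\<Sum>k<n. B j k * b k)) = b i" if "i < n" for b i
  proof -
    have "(\<Sum>j<n. A i j * (\<Sum>k<n. B j k * b k)) = (\<Sum>k<n. (if i = k then 1 else 0) * b k)"
      unfolding swap using 1[OF that] by (intro sum.cong) auto
    then show ?thesis using d[OF that] by simp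
  qed
  moreover have "(\<Sum>j<n. B i j * (\<Sum>k<n. A j k * b k)) = b i" if "i < n" for b i
  proof -
    have "(\<Sum>j<n. B i j * (\<Sum>k<n. A j k * b k)) = (\<Sum>k<n. (if i = k then 1 else 0) * b k)"
      unfolding swap using 2[OF that] by (intro sum.cong) auto
    then show ?thesis using d[OF that] by simp
  qed
  ultimately show thesis using that by blast
qed

text \<open>Cramer's rule with a small right-hand side: each of the n! Leibniz terms of the modified
  matrix contains exactly one entry of the replaced column, hence one factor \<eta>. It turns an
  approximate kernel vector into an upper bound for the determinant.\<close>

lemma fdet_cramer_bound:
  assumes k: "k < n" and R: "R \<ge> 1" and A: "\<And>i j. i < n \<Longrightarrow> j < n \<Longrightarrow> norm (A i j) \<le> R"
    and \<eta>: "\<eta> \<ge> 0" "\<And>i. i < n \<Longrightarrow> norm (\<Sum>j<n. A i j * x j) \<le> \<eta>"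
  shows "norm (x k) * norm (fdet n A) \<le> fact n * R ^ n * \<eta>"
proof -
  let ?M = "Matrix.mat n n (\<lambda>(i, j). A i j)"
  have M: "?M \<in> carrier_mat n n" by simp
  define C where "C i j = (if j = k then \<Sum>j<n. A i j * x j else A i j)" for i j
  have "replace_col ?M (?M *\<^sub>v Matrix.vec n x) k = Matrix.mat n n (\<lambda>(i, j). C i j)"
    unfolding replace_col_def
    by (rule eq_matI) (auto simp: C_def mat_mult_vec_nth simp del: index_mult_mat_vec)
  then have "fdet n C = x k * fdet n A"
    using cramer_lemma_mat[OF M, of "Matrix.vec n x" k] k by (simp add: fdet_def)
  moreover have "norm (fdet n C) \<le> fact n * R ^ n * \<eta>"
  proof -
    have "norm (of_int (sign \<pi>) * (\<Prod>i = 0..<n. C i (\<pi> i))) \<le> R ^ n * \<eta>" if \<pi>: "\<pi> permutes {0..<n}" for \<pi>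
    proof -
      obtain i0 where i0: "i0 < n" "\<pi> i0 = k"
      proof -
        have "k \<in> \<pi> ` {0..<n}" unfolding permutes_image[OF \<pi>] using k by simp
        then show thesis using that by auto
      qed
      have "norm (of_int (sign \<pi>) * (\<Prod>i = 0..<n. C i (\<pi> i))) = (\<Prod>i = 0..<n. norm (C i (\<pi> i)))"
        by (simp add: norm_mult prod_norm sign_def)
      also have "\<dots> = norm (C i0 (\<pi> i0)) * (\<Prod>i\<in>{0..<n} - {i0}. norm (C i (\<pi> i)))"
        using i0 by (intro prod.remove) auto
      also have "\<dots> \<le> \<eta> * (\<Prod>i\<in>{0..<n} - {i0}. R)"
      proof (intro mult_mono prod_mono conjI)
        show "norm (C i0 (\<pi> i0)) \<le> \<eta>" using i0 \<eta> by (simp add: C_def)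
        fix i assume i: "i \<in> {0..<n} - {i0}"
        then have "\<pi> i \<noteq> k" using i0 permutes_inj[OF \<pi>] by (auto dest: injD)
        moreover have "\<pi> i < n" using permutes_in_image[OF \<pi>, of i] i by simp
        ultimately show "norm (C i (\<pi> i)) \<le> R" using A[of i "\<pi> i"] i by (simp add: C_def)
      qed (use \<eta> in \<open>auto intro!: prod_nonneg\<close>)
      also have "\<dots> = \<eta> * R ^ (n - 1)" using i0 by simp
      also have "\<dots> \<le> \<eta> * R ^ n" using R \<eta>(1) by (intro mult_left_mono power_increasing) auto
      finally show ?thesis by (simp add: mult.commute)
    qed
    then have "norm (fdet n C) \<le> (\<Sum>\<pi> | \<pi> permutes {0..<n}. R ^ n * \<eta>)"
      unfolding fdet_leibniz by (intro sum_norm_le) auto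
    also have "\<dots> = fact n * (R ^ n * \<eta>)" by (simp add: card_permutations)
    finally show ?thesis by (simp add: mult.assoc)
  qed
  ultimately show ?thesis by (simp add: norm_mult)
qed

text \<open>A is close to minus the identity; a kernel vector contradicts this at its largest
  coordinate.\<close>

lemma fdet_diag_dominant:
  assumes "\<And>i. i < n \<Longrightarrow> (\<Sum>j<n. norm (A i j + (if i = j then 1 else 0))) \<le> \<theta>" and "\<theta> < 1"
  shows "fdet n A \<noteq> 0"
proof
  assume "fdet n A = 0"
  then obtain v where v: "\<exists>i<n. v i \<noteq> 0" "\<And>i. i < n \<Longrightarrow> (\<Sum>j<n. A i j * v j) = 0"
    by (rule fdet_eq_0_imp_kernel) blast
  define m where "m = Max ((\<lambda>i. norm (v i)) ` {..<n})"
  have n: "n > 0" using v(1) by auto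
  have le: "norm (v i) \<le> m" if "i < n" for i unfolding m_def using that by (intro Max_ge) auto
  have "m \<in> (\<lambda>i. norm (v i)) ` {..<n}" unfolding m_def using n by (intro Max_in) auto
  then obtain t where t: "t < n" "m = norm (v t)" by auto
  obtain i where i: "i < n" "v i \<noteq> 0" using v(1) by blast
  then have "0 < norm (v i)" by simp
  then have m: "m > 0" using le[OF i(1)] by linarith
  have "(\<Sum>j<n. (A t j + (if t = j then 1 else 0)) * v j) = (\<Sum>j<n. A t j * v j) + (\<Sum>j<n. if t = j then v j else 0)"
    unfolding sum.distrib[symmetric] by (intro sum.cong) (auto simp: distrib_right)
  also have "\<dots> = v t" using v(2)[OF t(1)] t(1) by simp
  finally have "m = norm (\<Sum>j<n. (A t j + (if t = j then 1 else 0)) * v j)" using t(2) by simp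
  also have "\<dots> \<le> (\<Sum>j<n. norm (A t j + (if t = j then 1 else 0)) * m)"
    by (intro sum_norm_le) (auto simp: norm_mult intro!: mult_left_mono le)
  also have "\<dots> = (\<Sum>j<n. norm (A t j + (if t = j then 1 else 0))) * m" by (simp add: sum_distrib_right)
  also have "\<dots> \<le> \<theta> * m" using assms(1)[OF t(1)] m by (intro mult_right_mono) auto
  finally show False using assms(2) m by (simp add: mult_less_cancel_right1 not_le[symmetric])
qed

section \<open>Invertibility modulo an operator with values on a finite window\<close>

lemma bounded_l2_operator_sum:
  assumes T: "bounded_l2_operator T" and y: "\<And>k. k \<in> A \<Longrightarrow> y k \<in> l2"
  shows "T (\<lambda>i. \<Sum>k\<in>A. \<alpha> k * y k i) = (\<lambda>i. \<Sum>k\<in>A. \<alpha> k * T (y k) i)"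
  using y
proof (induction A rule: infinite_finite_induct)
  case (insert k A)
  have e: "(\<lambda>i. \<Sum>k\<in>insert k A. \<alpha> k * z k i) = seq_scale (\<alpha> k) (z k) + (\<lambda>i. \<Sum>k\<in>A. \<alpha> k * z k i)" for z
    using insert by (auto simp: fun_eq_iff seq_scale_def)
  have l: "(\<lambda>i. \<Sum>k\<in>A. \<alpha> k * y k i) \<in> l2"
    using l2_sum(1)[of A "\<lambda>k. seq_scale (\<alpha> k) (y k)"] insert.prems l2_scale(1) unfolding seq_scale_def by simp
  have yk: "y k \<in> l2" using insert.prems by simp
  have "T (seq_scale (\<alpha> k) (y k) + (\<lambda>i. \<Sum>k\<in>A. \<alpha> k * y k i)) =
      seq_scale (\<alpha> k) (T (y k)) + T (\<lambda>i. \<Sum>k\<in>A. \<alpha> k * y k i)"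
    using T l2_scale(1)[OF yk, of "\<alpha> k"] yk l unfolding bounded_l2_operator_def by simp
  moreover have "T (\<lambda>i. \<Sum>k\<in>A. \<alpha> k * y k i) = (\<lambda>i. \<Sum>k\<in>A. \<alpha> k * T (y k) i)"
    using insert by simp
  ultimately show ?case unfolding e by (simp only:)
qed (use bounded_l2_operator_0[OF T] in \<open>simp_all add: zero_fun_def\<close>)

text \<open>Solving for \<open>y = K x\<close> on \<open>W\<close> is a finite linear system.\<close>

lemma finite_range_fredholm:
  assumes S: "bounded_l2_operator S" and K: "bounded_l2_operator K"
    and W: "finite W" "\<And>x i. x \<in> l2 \<Longrightarrow> i \<notin> W \<Longrightarrow> K x i = 0"
    and inj: "\<And>x. x \<in> l2 \<Longrightarrow> x + S (K x) = 0 \<Longrightarrow> x = 0"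
  shows "l2_invertible (\<lambda>x. x + S (K x))"
proof -
  define n where "n = card W"
  obtain h where h: "bij_betw h {..<n} W" using ex_bij_betw_nat_finite[OF W(1)] by (auto simp: n_def lessThan_atLeast0)
  have hW: "h r \<in> W" if "r < n" for r using h that by (auto simp: bij_betw_def)
  have hinj: "h r = h s \<longleftrightarrow> r = s" if "r < n" "s < n" for r s using h that by (auto simp: bij_betw_def inj_on_def)
  define E where "E r = (\<lambda>i. if i = h r then 1 else 0 :: complex)" for r
  have El2: "E r \<in> l2" for r by (rule l2_finite_support[of "{h r}"]) (auto simp: E_def)
  define emb where "emb y = (\<lambda>i. \<Sum>r<n. y r * E r i)" for y
  have emb_l2: "emb y \<in> l2" for y
    unfolding emb_def using l2_sum(1)[of "{..<n}" "\<lambda>r. seq_scale (y r) (E r)"] l2_scale(1)[OF El2] unfolding seq_scale_def by simp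
  have emb_h: "emb y (h s) = y s" if "s < n" for y s
  proof -
    have "emb y (h s) = (\<Sum>r<n. if r = s then y r else 0)"
      unfolding emb_def E_def using hinj[OF that] by (intro sum.cong) auto
    then show ?thesis using that by simp
  qed
  have emb_out: "emb y i = 0" if "i \<notin> W" for y i
    unfolding emb_def E_def using that hW by (intro sum.neutral) auto
  have emb_eq: "x = emb (\<lambda>r. x (h r))" if "\<And>i. i \<notin> W \<Longrightarrow> x i = 0" for x
  proof
    fix i show "x i = emb (\<lambda>r. x (h r)) i"
    proof (cases "i \<in> W")
      case True
      then obtain s where "s < n" "i = h s" using h by (auto simp: bij_betw_def)
      then show ?thesis using emb_h by simp
    qed (use that emb_out in auto)
  qed
  \<comment> \<open>The matrix of 1 + K S on sequences supported in \<open>W\<close>. If x + S y = f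
    and y = K x, then y + K S y = K f, and x is recovered as f - S y.\<close>
  define A where "A r s = (if r = s then 1 else 0) + K (S (E s)) (h r)" for r s
  have KS: "bounded_l2_operator (\<lambda>x. K (S x))" by (rule bounded_l2_operator_comp[OF K S])
  have Aemb: "(\<Sum>s<n. A r s * y s) = y r + K (S (emb y)) (h r)" if "r < n" for r y
  proof -
    have "K (S (emb y)) (h r) = (\<Sum>s<n. y s * K (S (E s)) (h r))"
      unfolding emb_def using bounded_l2_operator_sum[OF KS, of "{..<n}" E y] El2 by (simp add: fun_eq_iff)
    moreover have "(\<Sum>s<n. (if r = s then 1 else 0) * y s) = (\<Sum>s<n. if r = s then y s else 0)" by (intro sum.cong) auto
    ultimately show ?thesis using that unfolding A_def distrib_right sum.distrib by (simp add: mult.commute)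
  qed
  have "fdet n A \<noteq> 0"
  proof
    assume "fdet n A = 0"
    then obtain y where y: "\<exists>r<n. y r \<noteq> 0" "\<And>r. r < n \<Longrightarrow> (\<Sum>s<n. A r s * y s) = 0"
      by (rule fdet_eq_0_imp_kernel) blast
    \<comment> \<open>A kernel vector y of the matrix gives K x = y, hence a solution of x + S (K x)
      = 0.\<close>
    define x where "x = - S (emb y)"
    have Sl2: "S (emb y) \<in> l2" by (rule bounded_l2_operator_l2[OF S emb_l2])
    have x: "x \<in> l2" unfolding x_def by (rule l2_uminus(1)[OF Sl2])
    have Kx: "K x = - K (S (emb y))"
      unfolding x_def using bounded_l2_operator_diff[OF K l2_0(1) Sl2] bounded_l2_operator_0[OF K] by simp
    have "K x = emb y"
    proof -
      have "K x = emb (\<lambda>r. K x (h r))" by (rule emb_eq) (rule W(2)[OF x])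
      moreover
      have "K x (h r) = y r" if "r < n" for r
      proof -
        have "y r + K (S (emb y)) (h r) = 0" using y(2)[OF that] Aemb[OF that, of y] by (simp only:)
        then have "y r = - K (S (emb y)) (h r)" by (simp only: eq_neg_iff_add_eq_0)
        then show ?thesis unfolding Kx by simp
      qed
      then have "emb (\<lambda>r. K x (h r)) = emb y" unfolding emb_def by (intro ext sum.cong refl) simp
      ultimately show ?thesis by (simp only:)
    qed
    then have "x + S (K x) = 0" by (simp add: x_def)
    then have "x = 0" by (rule inj[OF x])
    then have "emb y = 0" using \<open>K x = emb y\<close> bounded_l2_operator_0[OF K] by simp
    then show False using y(1) emb_h[of _ y] by (auto simp: fun_eq_iff)
  qed
  then obtain B where B: "\<And>b i. i < n \<Longrightarrow> (\<Sum>j<n. A i j * (\<Sum>k<n. B j k * b k)) = b i"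
    "\<And>b i. i < n \<Longrightarrow> (\<Sum>j<n. B i j * (\<Sum>k<n. A j k * b k)) = b i"
    by (rule fdet_nonzero_inverse) blast
  obtain KK where KK: "KK > 0" "\<And>x. x \<in> l2 \<Longrightarrow> l2_norm (K x) \<le> KK * l2_norm x"
    using bounded_l2_operatorE[OF K] by metis
  obtain SS where SS: "SS > 0" "\<And>x. x \<in> l2 \<Longrightarrow> l2_norm (S x) \<le> SS * l2_norm x"
    using bounded_l2_operatorE[OF S] by metis
  show ?thesis
  proof (rule l2_invertibleI)
    show "bounded_l2_operator (\<lambda>x. x + S (K x))"
      by (rule bounded_l2_operator_add[OF bounded_l2_operator_id bounded_l2_operator_comp[OF S K]])
    fix f assume f: "f \<in> l2"
    define y where "y j = (\<Sum>k<n. B j k * K f (h k))" for j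
    have yr: "y r + K (S (emb y)) (h r) = K f (h r)" if "r < n" for r
      using B(1)[OF that, of "\<lambda>k. K f (h k)"] Aemb[OF that, of y] unfolding y_def by simp
    define x where "x = f - S (emb y)"
    have Sl2: "S (emb y) \<in> l2" by (rule bounded_l2_operator_l2[OF S emb_l2])
    have x: "x \<in> l2" unfolding x_def by (rule l2_diff(1)[OF f Sl2])
    have Kx: "K x = K f - K (S (emb y))" unfolding x_def by (rule bounded_l2_operator_diff[OF K f Sl2])
    have "K x = emb (\<lambda>r. K x (h r))" by (rule emb_eq) (rule W(2)[OF x])
    also have "\<dots> = emb y"
      unfolding emb_def
    proof (intro ext sum.cong refl)
      fix i r assume "r \<in> {..<n}"
      then have "K x (h r) = y r" unfolding Kx using yr[of r] by (simp add: algebra_simps)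
      then show "K x (h r) * E r i = y r * E r i" by simp
    qed
    finally have "x + S (K x) = f" by (simp add: x_def)
    then show "\<exists>x\<in>l2. x + S (K x) = f" using x by blast
  next
    fix x assume x: "x \<in> l2"
    define f where "f = x + S (K x)"
    have Kl2: "K x \<in> l2" by (rule bounded_l2_operator_l2[OF K x])
    have Sl2: "S (K x) \<in> l2" by (rule bounded_l2_operator_l2[OF S Kl2])
    have f: "f \<in> l2" unfolding f_def by (rule l2_add(1)[OF x Sl2])
    have Ke: "K x = emb (\<lambda>r. K x (h r))" by (rule emb_eq) (rule W(2)[OF x])
    have Kf: "K f = K x + K (S (K x))" unfolding f_def using K x Sl2 by (simp add: bounded_l2_operator_def)
    have "K x (h r) = (\<Sum>k<n. B r k * K f (h k))" if "r < n" for r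
    proof -
      have "K f (h k) = (\<Sum>s<n. A k s * K x (h s))" if "k < n" for k
        using Aemb[OF that, of "\<lambda>s. K x (h s)"] unfolding Ke[symmetric] Kf by simp
      then have "(\<Sum>k<n. B r k * K f (h k)) = (\<Sum>k<n. B r k * (\<Sum>s<n. A k s * K x (h s)))" by (intro sum.cong) auto
      then show ?thesis using B(2)[OF that, of "\<lambda>s. K x (h s)"] by simp
    qed
    then have kb: "norm (K x (h r)) \<le> (\<Sum>k<n. norm (B r k)) * (KK * l2_norm f)" if "r < n" for r
    proof -
      have "norm (\<Sum>k<n. B r k * K f (h k)) \<le> (\<Sum>k<n. norm (B r k) * (KK * l2_norm f))"
        using norm_le_l2_norm[OF bounded_l2_operator_l2[OF K f]] KK(2)[OF f]
        by (intro sum_norm_le) (auto simp: norm_mult intro!: mult_left_mono intro: order_trans)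
      then show ?thesis using \<open>\<And>r. r < n \<Longrightarrow> K x (h r) = (\<Sum>k<n. B r k * K f (h k))\<close>[OF that] by (simp add: sum_distrib_right)
    qed
    define Q where "Q = (\<Sum>r<n. (\<Sum>k<n. norm (B r k)) * KK)"
    have "l2_norm (K x) \<le> (\<Sum>r<n. l2_norm (seq_scale (K x (h r)) (E r)))"
      using l2_sum(2)[of "{..<n}" "\<lambda>r. seq_scale (K x (h r)) (E r)"] l2_scale(1)[OF El2] Ke
      unfolding emb_def seq_scale_def by simp
    also have "\<dots> \<le> (\<Sum>r<n. (\<Sum>k<n. norm (B r k)) * KK * l2_norm f)"
    proof (rule sum_mono)
      fix r assume r: "r \<in> {..<n}"
      have "l2_norm (E r) = 1" using l2_finite_support(2)[of "{h r}" "E r"] by (auto simp: E_def)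
      then have "l2_norm (seq_scale (K x (h r)) (E r)) \<le> norm (K x (h r))" using l2_scale(2)[OF El2, of "K x (h r)" r] by simp
      then show "l2_norm (seq_scale (K x (h r)) (E r)) \<le> (\<Sum>k<n. norm (B r k)) * KK * l2_norm f"
        using kb[of r] r by (simp add: mult.assoc)
    qed
    finally have "l2_norm (K x) \<le> Q * l2_norm f" by (simp add: Q_def sum_distrib_right)
    then have "l2_norm (S (K x)) \<le> SS * (Q * l2_norm f)"
      using order_trans[OF SS(2)[OF Kl2] mult_left_mono[of "l2_norm (K x)" "Q * l2_norm f" SS]] SS(1) by simp
    moreover have "x = f - S (K x)" by (simp add: f_def)
    then have "l2_norm x \<le> l2_norm f + l2_norm (S (K x))" using l2_diff(2)[OF f Sl2] by metis
    ultimately show "l2_norm x \<le> (1 + SS * Q) * l2_norm (x + S (K x))"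
      unfolding f_def[symmetric] by (simp add: algebra_simps)
  qed
qed

text \<open>Starting the half-line at a far position N makes the perturbation small enough for the
  contraction. N, \<open>c\<close> and \<open>W\<close> depend only on the decay constants, so the
  same choice serves both ends of the matrix. The value 1/(4 p) leaves p q/(1 - q) at most 1/2,
  which the determinant at \<kappa> = 0 relies on.\<close>

lemma half_line_exists:
  fixes C c0 :: real
  assumes p: "p \<ge> 1" and C: "C > 0" and c0: "c0 > 0"
  shows "\<exists>c W N. c > 0 \<and> (\<forall>v. (\<forall>i d. d \<le> 2 * p \<longrightarrow> norm (v i d) \<le> C * exp (- c0 * sqrt (real (N + i)))) \<longrightarrow>
    half_line p v c (1 / (4 * real p)) W)"
proof -
  \<comment> \<open>As sqrt(2 s) is at most 2 sqrt s, the kernel weight costs at most c0/4 of the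
    decay rate c0/2 reserved for s and leaves c0/4 for summability.\<close>
  define c where "c = c0 / 8"
  define E where "E = exp (c * sqrt (2 * real p))"
  define w where "w s = (real s + 1) * exp (- (c0 / 4) * sqrt (real s))" for s
  have w: "summable w"
  proof (rule summable_comparison_test_bigo)
    show "summable (\<lambda>n. norm (1 / real n ^ 2))" using inverse_power_summable[of 2, where 'a = real] by (simp add: inverse_eq_divide)
    show "w \<in> O(\<lambda>n. 1 / real n ^ 2)" unfolding w_def using c0 by real_asymp
  qed
  have wn: "w s \<ge> 0" for s by (simp add: w_def)
  have "((\<lambda>N. exp (- (c0 / 2) * sqrt (real N))) \<longlongrightarrow> 0) at_top" using c0 by real_asymp
  then have "((\<lambda>N. (2 * real p + 1) * (C * E * suminf w * exp (- (c0 / 2) * sqrt (real N)))) \<longlongrightarrow> 0) at_top"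
    by (intro tendsto_mult_right_zero)
  then have "\<forall>\<^sub>F N in at_top. (2 * real p + 1) * (C * E * suminf w * exp (- (c0 / 2) * sqrt (real N))) < 1 / (4 * real p)"
    by (rule order_tendstoD(2)) (use p in auto)
  then obtain N where N: "(2 * real p + 1) * (C * E * suminf w * exp (- (c0 / 2) * sqrt (real N))) < 1 / (4 * real p)"
    by (auto simp: eventually_at_top_linorder)
  define D where "D = C * E * exp (- (c0 / 2) * sqrt (real N))"
  have D: "D > 0" using C by (simp add: D_def E_def)
  define W where "W s = D * w s" for s
  have "half_line p v c (1 / (4 * real p)) W"
    if v: "\<And>i d. d \<le> 2 * p \<Longrightarrow> norm (v i d) \<le> C * exp (- c0 * sqrt (real (N + i)))" for v
  proof
    show "p \<ge> 1" "c > 0" using p c0 by (auto simp: c_def)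
    show "1 / (4 * real p) < 1" using p by simp
    show "summable W" unfolding W_def by (intro summable_mult w)
    show "(2 * real p + 1) * suminf W \<le> 1 / (4 * real p)"
      using N unfolding W_def suminf_mult[OF w] D_def by (simp add: mult_ac)
    fix s i d :: nat assume d: "d \<le> 2 * p" and si: "s \<le> i"
    \<comment> \<open>The decay is shared: half of the exponent yields the small constant depending
      on N, the other half the decay in s.\<close>
    have "sqrt (real N) + sqrt (real s) \<le> 2 * sqrt (real (N + i))"
    proof -
      have "sqrt (real N) \<le> sqrt (real (N + i))" "sqrt (real s) \<le> sqrt (real (N + i))" using si by auto
      then show ?thesis by linarith
    qed
    from mult_left_mono[OF this, of "c0 / 2"] c0
    have "- c0 * sqrt (real (N + i)) \<le> - (c0 / 2) * sqrt (real N) - (c0 / 2) * sqrt (real s)" by (simp add: field_simps)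
    then have "exp (- c0 * sqrt (real (N + i))) \<le> exp (- (c0 / 2) * sqrt (real N)) * exp (- (c0 / 2) * sqrt (real s))"
      unfolding exp_add[symmetric] by simp
    then have vb: "norm (v i d) \<le> C * (exp (- (c0 / 2) * sqrt (real N)) * exp (- (c0 / 2) * sqrt (real s)))"
      using order_trans[OF v[OF d, of i] mult_left_mono[of _ _ C]] C by simp
    have "sqrt (2 * real s) \<le> sqrt (4 * real s)" by simp
    also have "sqrt (4 * real s) = 2 * sqrt (real s)" by (simp add: real_sqrt_mult)
    finally have "exp (c * sqrt (2 * real s)) \<le> exp ((c0 / 4) * sqrt (real s))" using c0 by (simp add: c_def)
    then have "(real s + 1) * exp (c * sqrt (2 * real s)) * E * norm (v i d) \<le>
        (real s + 1) * exp ((c0 / 4) * sqrt (real s)) * E * (C * (exp (- (c0 / 2) * sqrt (real N)) * exp (- (c0 / 2) * sqrt (real s))))"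
      using vb by (intro mult_mono) (auto simp: E_def)
    also have "\<dots> = D * ((real s + 1) * (exp ((c0 / 4) * sqrt (real s)) * exp (- (c0 / 2) * sqrt (real s))))"
      by (simp only: D_def mult_ac)
    also have "exp ((c0 / 4) * sqrt (real s)) * exp (- (c0 / 2) * sqrt (real s)) = exp (- (c0 / 4) * sqrt (real s))"
      unfolding exp_add[symmetric] by (rule arg_cong[where f = exp]) (simp add: field_simps)
    finally show "(real s + 1) * exp (c * sqrt (2 * real s)) * exp (c * sqrt (2 * real p)) * norm (v i d) \<le> W s"
      unfolding W_def w_def E_def .
  qed
  moreover have "c > 0" using c0 by (simp add: c_def)
  ultimately show ?thesis by (intro exI[of _ c] exI[of _ W] exI[of _ N]) simp
qed

section \<open>Perturbations of the free matrix\<close>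

definition band_op :: "nat \<Rightarrow> bimatrix \<Rightarrow> bisequence \<Rightarrow> bisequence" where
  "band_op p B x i = (\<Sum>d\<le>2 * p. B i (i - int p + int d) * x (i - int p + int d))"

lemma band_op_reverse:
  "band_op p B x i = (\<Sum>d\<le>2 * p. B i (i + int p - int d) * x (i + int p - int d))"
  unfolding band_op_def
  by (rule sum.reindex_bij_witness[of _ "\<lambda>e. 2 * p - e" "\<lambda>d. 2 * p - d"]) (auto simp: of_nat_diff algebra_simps)

lemma band_op_interval:
  "band_op p B x i = (\<Sum>j\<in>{i - int p..i + int p}. B i j * x j)"
  unfolding band_op_def
  by (rule sum.reindex_bij_witness[of _ "\<lambda>j. nat (j - i + int p)" "\<lambda>d. i - int p + int d"]) auto

text \<open>Closeness is only asked within the band that \<open>band_op\<close> reads. The nonzero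
  outermost entries turn the eigenvalue equation into a recurrence solvable in both
  directions.\<close>

locale perturbed_free =
  fixes p :: nat and B :: bimatrix and C c0 :: real
  assumes p: "p \<ge> 1" and C: "C > 0" and c0: "c0 > 0"
    and decay: "\<And>i j. \<bar>i - j\<bar> \<le> int p \<Longrightarrow> norm (B i j - free_matrix p i j) \<le> C * exp (- c0 * sqrt \<bar>real_of_int i\<bar>)"
    and outer: "\<And>i. B i (i + int p) \<noteq> 0" "\<And>i. B i (i - int p) \<noteq> 0"
begin

abbreviation T where "T \<equiv> band_op p B"

lemma linear: "seq_linear T"
  by (auto simp: seq_linear_def fun_eq_iff band_op_def seq_scale_def sum.distrib sum_distrib_left algebra_simps)

lemma entry_bound: "\<exists>K>0. \<forall>i d. d \<le> 2 * p \<longrightarrow> norm (B i (i - int p + int d)) \<le> K"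
proof (intro exI[of _ "C + 1"] conjI allI impI)
  fix i and d :: nat assume "d \<le> 2 * p"
  then have "norm (B i (i - int p + int d) - free_matrix p i (i - int p + int d)) \<le> C * exp (- c0 * sqrt \<bar>real_of_int i\<bar>)"
    by (intro decay) auto
  also have "\<dots> \<le> C * 1" using C c0 by (intro mult_left_mono) auto
  finally have "norm (B i (i - int p + int d) - free_matrix p i (i - int p + int d)) \<le> C" by simp
  moreover have "norm (free_matrix p i (i - int p + int d)) \<le> 1" by (simp add: free_matrix_def)
  ultimately show "norm (B i (i - int p + int d)) \<le> C + 1"
    using norm_triangle_ineq[of "B i (i - int p + int d) - free_matrix p i (i - int p + int d)" "free_matrix p i (i - int p + int d)"] by simp
qed (use C in simp)

lemma bounded_power:
  assumes x: "\<And>i. norm (x i) \<le> M"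
  shows "\<exists>M'. \<forall>i. norm ((minus_scalar T z ^^ k) x i) \<le> M'"
proof (induction k)
  case (Suc k)
  then obtain M' where M': "\<And>i. norm ((minus_scalar T z ^^ k) x i) \<le> M'" by blast
  obtain K where K: "K > 0" "\<And>i d. d \<le> 2 * p \<Longrightarrow> norm (B i (i - int p + int d)) \<le> K" using entry_bound by blast
  have "norm ((minus_scalar T z ^^ Suc k) x i) \<le> (\<Sum>d\<le>2 * p. K * M') + norm z * M'" for i
  proof -
    define y where "y = (minus_scalar T z ^^ k) x"
    have "norm (T y i) \<le> (\<Sum>d\<le>2 * p. K * M')"
      unfolding band_op_def using K M' by (intro sum_norm_le) (auto simp: norm_mult y_def intro!: mult_mono)
    moreover have "norm (z * y i) \<le> norm z * M'" using M' by (auto simp: norm_mult y_def intro!: mult_left_mono)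
    ultimately show ?thesis using norm_triangle_ineq4[of "T y i" "z * y i"]
      by (simp add: minus_scalar_def seq_scale_def y_def)
  qed
  then show ?case by blast
qed (use x in auto)

text \<open>The recurrence has order \<open>2 p\<close>.\<close>

lemma eigenvector_nonzero_in_window:
  assumes e: "T e = seq_scale z e" and e0: "e \<noteq> 0"
  shows "\<exists>s<2 * p. e (a + int s) \<noteq> 0"
proof (rule ccontr)
  assume "\<not> (\<exists>s<2 * p. e (a + int s) \<noteq> 0)"
  then have w: "e m = 0" if "a \<le> m" "m < a + 2 * int p" for m
    using that by (auto dest!: spec[of _ "nat (m - a)"])
  have row: "(\<Sum>j\<in>{i - int p..i + int p}. B i j * e j) = z * e i" for i
    using e unfolding band_op_interval[symmetric] by (simp add: seq_scale_def)
  have right: "\<forall>m. a \<le> m \<and> m < a + 2 * int p + int k \<longrightarrow> e m = 0" for k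
  proof (induction k)
    case (Suc k)
    define m where "m = a + 2 * int p + int k"
    have "(\<Sum>j\<in>{m - int p - int p..m - int p + int p}. B (m - int p) j * e j) = (\<Sum>j\<in>{m}. B (m - int p) j * e j)"
      using Suc by (intro sum.mono_neutral_right) (auto simp: m_def)
    moreover have "e (m - int p) = 0" using Suc p by (auto simp: m_def)
    ultimately have "B (m - int p) m * e m = 0" using row[of "m - int p"] by simp
    then have "e m = 0" using outer(1)[of "m - int p"] by simp
    moreover have "m' < m \<or> m' = m" if "m' < a + 2 * int p + int (Suc k)" for m' using that by (auto simp: m_def)
    ultimately show ?case using Suc unfolding m_def by blast
  qed (use w in auto)
  have left: "\<forall>m. a - int k \<le> m \<and> m < a + 2 * int p \<longrightarrow> e m = 0" for k
  proof (induction k)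
    case (Suc k)
    define m where "m = a - int k - 1"
    have "(\<Sum>j\<in>{m + int p - int p..m + int p + int p}. B (m + int p) j * e j) = (\<Sum>j\<in>{m}. B (m + int p) j * e j)"
      using Suc by (intro sum.mono_neutral_right) (auto simp: m_def)
    moreover have "e (m + int p) = 0" using Suc p by (auto simp: m_def)
    ultimately have "B (m + int p) m * e m = 0" using row[of "m + int p"] by simp
    then have "e m = 0" using outer(2)[of "m + int p"] by simp
    moreover have "m' \<ge> a - int k \<or> m' = m" if "m' \<ge> a - int (Suc k)" for m' using that by (auto simp: m_def)
    ultimately show ?case using Suc by blast
  qed (use w in auto)
  have "e m = 0" for m
  proof (cases "m \<ge> a")
    case True
    then show ?thesis using right[of "nat (m - a) + 1"] by auto
  next
    case False
    then show ?thesis using left[of "nat (a - m)"] by auto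
  qed
  then show False using e0 by auto
qed

text \<open>The conclusion is quantitative: for a bounded u with residual at most \<eta> the
  determinant is small wherever u is not. Exact eigenvectors give zeros of D, families of
  approximate ones give higher order. The position m depends on the eigenvector e alone, not on
  \<kappa>, so that a limit in \<kappa> can be taken later.\<close>

lemma jost_determinant_exists:
  "\<exists>c M D. c > 0 \<and> sqrt_decay_class c M D \<and> D 0 \<noteq> 0 \<and>
    (\<forall>\<rho> e z. 0 < \<rho> \<longrightarrow> \<rho> < 1 \<longrightarrow> T e = seq_scale z e \<longrightarrow> e \<noteq> 0 \<longrightarrow>
      (\<exists>G m. e m \<noteq> 0 \<and> (\<forall>\<kappa> u b \<eta>. \<kappa> \<noteq> 0 \<longrightarrow> norm \<kappa> \<le> \<rho> \<longrightarrow> (\<forall>i. norm (u i) \<le> b) \<longrightarrow>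
         (\<forall>i. norm (minus_scalar T (\<kappa> + 1 / \<kappa>) u i) \<le> \<eta>) \<longrightarrow> norm (u m) * norm (D \<kappa>) \<le> G * \<eta>)))"
proof -
  obtain c W N where c: "c > 0"
    and hl: "\<forall>v. (\<forall>i d. d \<le> 2 * p \<longrightarrow> norm (v i d) \<le> C * exp (- c0 * sqrt (real (N + i)))) \<longrightarrow>
      half_line p v c (1 / (4 * real p)) W"
    using half_line_exists[OF p C c0] by (elim exE conjE) (rule that)
  define q where "q = 1 / (4 * real p)"
  \<comment> \<open>Rows N, N + 1, ... form the right half-line and rows -1 - N, -2 - N, ... the
    reflected left one; the 2 N rows in between stay as they are.\<close>
  define rR where "rR i = int N + int i" for i
  define rL where "rL i = - 1 - int N - int i" for i
  define vR where "vR i d = B (rR i) (rR i - int p + int d) - (if d = 0 \<or> d = 2 * p then 1 else 0)" for i d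
  define vL where "vL i d = B (rL i) (rL i + int p - int d) - (if d = 0 \<or> d = 2 * p then 1 else 0)" for i d
  have fR: "free_matrix p n (n - int p + int d) = (if d = 0 \<or> d = 2 * p then 1 else 0)" if "d \<le> 2 * p" for n d
    using that p by (auto simp: free_matrix_def)
  have fL: "free_matrix p n (n + int p - int d) = (if d = 0 \<or> d = 2 * p then 1 else 0)" if "d \<le> 2 * p" for n d
    using that p by (auto simp: free_matrix_def)
  have R: "half_line p vR c q W"
    unfolding q_def
  proof (rule hl[rule_format])
    fix i d :: nat assume d: "d \<le> 2 * p"
    have "norm (B (rR i) (rR i - int p + int d) - free_matrix p (rR i) (rR i - int p + int d)) \<le> C * exp (- c0 * sqrt \<bar>real_of_int (rR i)\<bar>)"
      using d by (intro decay) auto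
    then show "norm (vR i d) \<le> C * exp (- c0 * sqrt (real (N + i)))" unfolding fR[OF d] vR_def by (simp add: rR_def)
  qed
  have L: "half_line p vL c q W"
    unfolding q_def
  proof (rule hl[rule_format])
    fix i d :: nat assume d: "d \<le> 2 * p"
    have "norm (B (rL i) (rL i + int p - int d) - free_matrix p (rL i) (rL i + int p - int d)) \<le> C * exp (- c0 * sqrt \<bar>real_of_int (rL i)\<bar>)"
      using d by (intro decay) auto
    also have "\<dots> \<le> C * exp (- c0 * sqrt (real (N + i)))"
      using C c0 by (intro mult_left_mono) (auto simp: rL_def)
    finally show "norm (vL i d) \<le> C * exp (- c0 * sqrt (real (N + i)))" unfolding fL[OF d] vL_def .
  qed
  interpret R: half_line p vR c q W by (rule R)
  interpret L: half_line p vL c q W by (rule L)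
  \<comment> \<open>The unknowns are u at -N - p, ..., N + p - 1, all positions met by the middle
    rows or the boundary terms. They are matched by 2 N middle equations and p Jost equations at
    each end.\<close>
  define n where "n = 2 * N + 2 * p"
  define pos where "pos s = int s - int N - int p" for s
  \<comment> \<open>The left equations are numbered in reverse, so that the leading entry -1 of each
    boundary vector falls on the diagonal and the matrix is near minus the identity at \<kappa> =
    0.\<close>
  define A where "A \<kappa> t s =
    (if t < p then (if s < 2 * p then L.bdry (p - 1 - t) (2 * p - 1 - s) \<kappa> else 0)
     else if t < n - p then (if \<bar>pos t - pos s\<bar> \<le> int p then \<kappa> * B (pos t) (pos s) else 0) - (\<kappa>\<^sup>2 + 1) * (if s = t then 1 else 0)
     else (if s \<ge> 2 * N then R.bdry (t - (n - p)) (s - 2 * N) \<kappa> else 0))" for \<kappa> t s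
  define D where "D \<kappa> = fdet n (A \<kappa>)" for \<kappa>
  have cge: "c \<ge> 0" using c by simp
  have Acl: "\<exists>M. sqrt_decay_class c M (\<lambda>\<kappa>. A \<kappa> t s)" for t s
  proof -
    have z: "\<exists>M. sqrt_decay_class c M (\<lambda>\<kappa>. 0)" using sqrt_decay_class_const[of c 0] by blast
    have mid: "\<exists>M. sqrt_decay_class c M (\<lambda>\<kappa>. \<kappa> ^ 1 * X + (\<kappa> ^ 2 + 1) * Y)" for X Y
    proof
      show "sqrt_decay_class c (exp (c * sqrt (real 1)) * norm X + (exp (c * sqrt (real 2)) + norm (1::complex)) * norm Y)
        (\<lambda>\<kappa>. \<kappa> ^ 1 * X + (\<kappa> ^ 2 + 1) * Y)"
        by (intro sqrt_decay_class_add sqrt_decay_class_mult sqrt_decay_class_power sqrt_decay_class_const cge)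
    qed
    have e: "(if \<bar>pos t - pos s\<bar> \<le> int p then \<kappa> * B (pos t) (pos s) else 0) - (\<kappa>\<^sup>2 + 1) * (if s = t then 1 else 0) =
        \<kappa> ^ 1 * (if \<bar>pos t - pos s\<bar> \<le> int p then B (pos t) (pos s) else 0) + (\<kappa> ^ 2 + 1) * (if s = t then - 1 else 0)" for \<kappa>
      by simp
    consider "t < p" "s < 2 * p" | "t < p" "\<not> s < 2 * p" | "\<not> t < p" "t < n - p"
      | "\<not> t < p" "\<not> t < n - p" "s \<ge> 2 * N" | "\<not> t < p" "\<not> t < n - p" "\<not> s \<ge> 2 * N" by blast
    then show ?thesis
    proof cases
      case 1
      then have "(\<lambda>\<kappa>. A \<kappa> t s) = L.bdry (p - 1 - t) (2 * p - 1 - s)" by (simp add: A_def)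
      then show ?thesis using L.bdry_class by simp
    next
      case 2
      then have "(\<lambda>\<kappa>. A \<kappa> t s) = (\<lambda>\<kappa>. 0)" by (simp add: A_def)
      then show ?thesis using z by simp
    next
      case 3
      then have "(\<lambda>\<kappa>. A \<kappa> t s) = (\<lambda>\<kappa>. \<kappa> ^ 1 * (if \<bar>pos t - pos s\<bar> \<le> int p then B (pos t) (pos s) else 0)
          + (\<kappa> ^ 2 + 1) * (if s = t then - 1 else 0))"
        unfolding A_def e by simp
      then show ?thesis by (simp only: mid)
    next
      case 4
      then have "(\<lambda>\<kappa>. A \<kappa> t s) = R.bdry (t - (n - p)) (s - 2 * N)" by (simp add: A_def)
      then show ?thesis using R.bdry_class by simp
    next
      case 5
      then have "(\<lambda>\<kappa>. A \<kappa> t s) = (\<lambda>\<kappa>. 0)" by (simp add: A_def)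
      then show ?thesis using z by simp
    qed
  qed
  then obtain MA where MA: "\<And>t s. sqrt_decay_class c (MA t s) (\<lambda>\<kappa>. A \<kappa> t s)" by metis
  have Dcl: "\<exists>M. sqrt_decay_class c M D"
  proof
    show "sqrt_decay_class c (\<Sum>\<pi> | \<pi> permutes {0..<n}. norm (of_int (sign \<pi>) :: complex) * (\<Prod>i = 0..<n. MA i (\<pi> i))) D"
      unfolding D_def[abs_def] fdet_leibniz
      by (intro sqrt_decay_class_sum sqrt_decay_class_prod sqrt_decay_class_mult sqrt_decay_class_const MA cge)
  qed
  have D0: "D 0 \<noteq> 0"
    unfolding D_def
  proof (rule fdet_diag_dominant[where \<theta> = "1 / 2"])
    fix t assume t: "t < n"
    have q3: "real p * (q / (1 - q)) \<le> 1 / 2"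
    proof -
      have "4 * real p \<ge> 4" using p by simp
      then show ?thesis unfolding q_def by (simp add: field_simps)
    qed
    have qn: "q / (1 - q) \<ge> 0" using R.q R.q_nonneg by simp
    have three: "t < p \<or> (p \<le> t \<and> t < n - p) \<or> (n - p \<le> t)" by linarith
    have cnt: "(\<Sum>s<n. g s) \<le> 1 / 2" if g: "\<And>s. s < n \<Longrightarrow> g s \<le> (if s \<in> S then q / (1 - q) else 0)" and S: "finite S" "card S \<le> p" for g :: "nat \<Rightarrow> real" and S
    proof -
      have "(\<Sum>s<n. g s) \<le> (\<Sum>s<n. if s \<in> S then q / (1 - q) else 0)" by (intro sum_mono g) auto
      also have "\<dots> = (\<Sum>s\<in>{..<n} \<inter> S. q / (1 - q))" by (subst sum.inter_restrict) auto
      also have "\<dots> = real (card ({..<n} \<inter> S)) * (q / (1 - q))" by simp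
      also have "\<dots> \<le> real p * (q / (1 - q))"
        using qn S card_mono[of S "{..<n} \<inter> S"] by (intro mult_right_mono) auto
      finally show ?thesis using q3 by (rule order_trans)
    qed
    show "(\<Sum>s<n. norm (A 0 t s + (if t = s then 1 else 0))) \<le> 1 / 2"
      using three
    proof (elim disjE conjE)
      assume tp: "t < p"
      show ?thesis
      proof (rule cnt[where S = "{..<p}"])
        fix s assume "s < n"
        show "norm (A 0 t s + (if t = s then 1 else 0)) \<le> (if s \<in> {..<p} then q / (1 - q) else 0)"
        proof (cases "s < 2 * p")
          case True
          have 1: "(2 * p - 1 - s = p + (p - 1 - t)) \<longleftrightarrow> t = s" "(2 * p - 1 - s < p) \<longleftrightarrow> \<not> s < p" using True tp by auto
          have "2 * p - 1 - s < 2 * p" "p - 1 - t < p" using p by auto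
          note bd = L.bdry_at_0[OF this, unfolded 1]
          have Ae: "A 0 t s = L.bdry (p - 1 - t) (2 * p - 1 - s) 0" using True tp by (simp add: A_def)
          have "(if \<not> s < p then 0 else q / (1 - q)) = (if s \<in> {..<p} then q / (1 - q) else 0)" by simp
          with bd show ?thesis unfolding Ae by (simp only:)
        next
          case False
          then show ?thesis using tp qn by (auto simp: A_def)
        qed
      qed auto
    next
      assume tm: "p \<le> t" "t < n - p"
      have "A 0 t s + (if t = s then 1 else 0) = 0" for s using tm by (simp add: A_def)
      then show ?thesis by simp
    next
      assume tn: "n - p \<le> t"
      have tp: "\<not> t < p" "\<not> t < n - p" using tn p by (auto simp: n_def)
      show ?thesis
      proof (rule cnt[where S = "{n - p..<n}"])
        fix s assume s: "s < n"
        show "norm (A 0 t s + (if t = s then 1 else 0)) \<le> (if s \<in> {n - p..<n} then q / (1 - q) else 0)"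
        proof (cases "s \<ge> 2 * N")
          case True
          have 1: "(s - 2 * N = p + (t - (n - p))) \<longleftrightarrow> t = s" "(s - 2 * N < p) \<longleftrightarrow> \<not> s \<in> {n - p..<n}"
            using True tn t s by (auto simp: n_def)
          have "s - 2 * N < 2 * p" "t - (n - p) < p" using s t tn p by (auto simp: n_def)
          note bd = R.bdry_at_0[OF this, unfolded 1]
          have Ae: "A 0 t s = R.bdry (t - (n - p)) (s - 2 * N) 0" using True tp by (simp add: A_def)
          have "(if s \<notin> {n - p..<n} then 0 else q / (1 - q)) = (if s \<in> {n - p..<n} then q / (1 - q) else 0)" by simp
          with bd show ?thesis unfolding Ae by (simp only:)
        next
          case False
          then have "s \<notin> {n - p..<n}" "t \<noteq> s" using tn by (auto simp: n_def)
          then show ?thesis using False tp qn by (simp add: A_def)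
        qed
      qed (auto simp: n_def)
    qed
  qed simp
  have "\<exists>G m. e m \<noteq> 0 \<and> (\<forall>\<kappa> u b \<eta>. \<kappa> \<noteq> 0 \<longrightarrow> norm \<kappa> \<le> \<rho> \<longrightarrow> (\<forall>i. norm (u i) \<le> b) \<longrightarrow>
         (\<forall>i. norm (minus_scalar T (\<kappa> + 1 / \<kappa>) u i) \<le> \<eta>) \<longrightarrow> norm (u m) * norm (D \<kappa>) \<le> G * \<eta>)"
    if \<rho>: "0 < \<rho>" "\<rho> < 1" and e: "T e = seq_scale z e" "e \<noteq> 0" for \<rho> e z
  proof -
    \<comment> \<open>The first 2 p unknowns suffice to see a nonzero value of e, because a solution
      vanishing on such a window vanishes everywhere.\<close>
    obtain s0 where s0: "s0 < 2 * p" "e (- int N - int p + int s0) \<noteq> 0"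
      using eigenvector_nonzero_in_window[OF e, of "- int N - int p"] by blast
    have em: "e (pos s0) \<noteq> 0" using s0(2) by (simp add: pos_def algebra_simps)
    have s0n: "s0 < n" using s0 by (simp add: n_def)
    define FR where "FR r G \<longleftrightarrow> (\<forall>\<kappa> u b \<eta>. norm \<kappa> \<le> \<rho> \<longrightarrow> (\<forall>l. norm (u l) \<le> b) \<longrightarrow>
       (\<forall>i. norm (\<Sum>d\<le>2 * p. R.row \<kappa> i d * u (i + d)) \<le> \<eta>) \<longrightarrow> norm (\<Sum>l<2 * p. R.bdry r l \<kappa> * u l) \<le> G * \<eta>)" for r G
    have "\<exists>G. FR r G" for r using R.jost_pairing[OF \<rho>, of r] unfolding FR_def .
    then obtain GR where FR: "\<And>r. FR r (GR r)" by metis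
    have GR: "norm (\<Sum>l<2 * p. R.bdry r l \<kappa> * u l) \<le> GR r * \<eta>"
      if "norm \<kappa> \<le> \<rho>" "\<And>l. norm (u l) \<le> b" "\<And>i. norm (\<Sum>d\<le>2 * p. R.row \<kappa> i d * u (i + d)) \<le> \<eta>" for r \<kappa> u b \<eta>
      using FR[of r, unfolded FR_def, rule_format, of \<kappa> u b \<eta>] that by simp
    define FL where "FL r G \<longleftrightarrow> (\<forall>\<kappa> u b \<eta>. norm \<kappa> \<le> \<rho> \<longrightarrow> (\<forall>l. norm (u l) \<le> b) \<longrightarrow>
       (\<forall>i. norm (\<Sum>d\<le>2 * p. L.row \<kappa> i d * u (i + d)) \<le> \<eta>) \<longrightarrow> norm (\<Sum>l<2 * p. L.bdry r l \<kappa> * u l) \<le> G * \<eta>)" for r G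
    have "\<exists>G. FL r G" for r using L.jost_pairing[OF \<rho>, of r] unfolding FL_def .
    then obtain GL where FL: "\<And>r. FL r (GL r)" by metis
    have GL: "norm (\<Sum>l<2 * p. L.bdry r l \<kappa> * u l) \<le> GL r * \<eta>"
      if "norm \<kappa> \<le> \<rho>" "\<And>l. norm (u l) \<le> b" "\<And>i. norm (\<Sum>d\<le>2 * p. L.row \<kappa> i d * u (i + d)) \<le> \<eta>" for r \<kappa> u b \<eta>
      using FL[of r, unfolded FL_def, rule_format, of \<kappa> u b \<eta>] that by simp
    define Rm where "Rm = 1 + (\<Sum>t<n. \<Sum>s<n. MA t s)"
    have MAn: "MA t s \<ge> 0" for t s by (rule sqrt_decay_class_nonneg[OF MA])
    have Rm: "Rm \<ge> 1" unfolding Rm_def using MAn by (simp add: sum_nonneg)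
    have MAR: "MA t s \<le> Rm" if "t < n" "s < n" for t s
    proof -
      have "MA t s \<le> (\<Sum>s<n. MA t s)" using that MAn by (intro member_le_sum) auto
      also have "\<dots> \<le> (\<Sum>t<n. \<Sum>s<n. MA t s)" using that MAn by (intro member_le_sum[where f = "\<lambda>t. \<Sum>s<n. MA t s"] sum_nonneg) auto
      finally show ?thesis by (simp add: Rm_def)
    qed
    define Gm where "Gm = 1 + (\<Sum>r<p. \<bar>GR r\<bar>) + (\<Sum>r<p. \<bar>GL r\<bar>)"
    have Gm1: "1 \<le> Gm" unfolding Gm_def by (simp add: sum_nonneg)
    have gs: "0 \<le> (\<Sum>r<p. \<bar>GR r\<bar>)" "0 \<le> (\<Sum>r<p. \<bar>GL r\<bar>)" by (simp_all add: sum_nonneg)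
    have GRm: "GR r \<le> Gm" if "r < p" for r
    proof -
      have "\<bar>GR r\<bar> \<le> (\<Sum>r<p. \<bar>GR r\<bar>)" by (rule member_le_sum) (use that in auto)
      then show ?thesis using gs unfolding Gm_def by linarith
    qed
    have GLm: "GL r \<le> Gm" if "r < p" for r
    proof -
      have "\<bar>GL r\<bar> \<le> (\<Sum>r<p. \<bar>GL r\<bar>)" by (rule member_le_sum) (use that in auto)
      then show ?thesis using gs unfolding Gm_def by linarith
    qed
    have "norm (u (pos s0)) * norm (D \<kappa>) \<le> (fact n * Rm ^ n * Gm) * \<eta>"
      if \<kappa>: "\<kappa> \<noteq> 0" "norm \<kappa> \<le> \<rho>" and u: "\<And>i. norm (u i) \<le> b"
        and h: "\<And>i. norm (minus_scalar T (\<kappa> + 1 / \<kappa>) u i) \<le> \<eta>" for \<kappa> u b \<eta>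
    proof -
      have \<kappa>1: "norm \<kappa> \<le> 1" using \<kappa> \<rho> by simp
      have \<eta>: "\<eta> \<ge> 0" using order_trans[OF norm_ge_zero h] .
      have hk: "norm (\<kappa> * T u i - (\<kappa>\<^sup>2 + 1) * u i) \<le> \<eta>" for i
      proof -
        have "\<kappa> * T u i - (\<kappa>\<^sup>2 + 1) * u i = \<kappa> * minus_scalar T (\<kappa> + 1 / \<kappa>) u i"
          using \<kappa>(1) by (simp add: minus_scalar_def seq_scale_def field_simps power2_eq_square)
        moreover have "norm (\<kappa> * minus_scalar T (\<kappa> + 1 / \<kappa>) u i) \<le> 1 * \<eta>"
          unfolding norm_mult using \<kappa>1 h by (intro mult_mono) auto
        ultimately show ?thesis by simp
      qed
      have split3: "(\<Sum>d\<le>2 * p. (\<kappa> * b d - \<beta> * (if d = p then 1 else 0)) * f d) = \<kappa> * (\<Sum>d\<le>2 * p. b d * f d) - \<beta> * f p"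
        for b f :: "nat \<Rightarrow> complex" and \<beta>
      proof -
        have "(\<Sum>d\<le>2 * p. (\<kappa> * b d - \<beta> * (if d = p then 1 else 0)) * f d) =
            (\<Sum>d\<le>2 * p. \<kappa> * (b d * f d)) - (\<Sum>d\<le>2 * p. if d = p then \<beta> * f d else 0)"
          unfolding sum_subtractf[symmetric] by (intro sum.cong) (auto simp: algebra_simps)
        then show ?thesis by (simp add: sum_distrib_left)
      qed
      have rowR: "(\<Sum>d\<le>2 * p. R.row \<kappa> i d * u (rR (i + d) - int p)) = \<kappa> * T u (rR i) - (\<kappa>\<^sup>2 + 1) * u (rR i)" for i
      proof -
        have "R.row \<kappa> i d = \<kappa> * B (rR i) (rR i - int p + int d) - (\<kappa>\<^sup>2 + 1) * (if d = p then 1 else 0)" for d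
          by (simp add: R.row_def vR_def)
        moreover have "rR (i + d) - int p = rR i - int p + int d" for d by (simp add: rR_def)
        ultimately have "(\<Sum>d\<le>2 * p. R.row \<kappa> i d * u (rR (i + d) - int p)) =
            (\<Sum>d\<le>2 * p. (\<kappa> * B (rR i) (rR i - int p + int d) - (\<kappa>\<^sup>2 + 1) * (if d = p then 1 else 0)) * u (rR i - int p + int d))" by (simp only:)
        then show ?thesis unfolding split3 band_op_def by simp
      qed
      have rowL: "(\<Sum>d\<le>2 * p. L.row \<kappa> i d * u (rL (i + d) + int p)) = \<kappa> * T u (rL i) - (\<kappa>\<^sup>2 + 1) * u (rL i)" for i
      proof -
        have "L.row \<kappa> i d = \<kappa> * B (rL i) (rL i + int p - int d) - (\<kappa>\<^sup>2 + 1) * (if d = p then 1 else 0)" for d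
          by (simp add: L.row_def vL_def)
        moreover have "rL (i + d) + int p = rL i + int p - int d" for d by (simp add: rL_def)
        ultimately have "(\<Sum>d\<le>2 * p. L.row \<kappa> i d * u (rL (i + d) + int p)) =
            (\<Sum>d\<le>2 * p. (\<kappa> * B (rL i) (rL i + int p - int d) - (\<kappa>\<^sup>2 + 1) * (if d = p then 1 else 0)) * u (rL i + int p - int d))" by (simp only:)
        then show ?thesis unfolding split3 band_op_reverse by simp
      qed
      define x where "x s = u (pos s)" for s
      have rows: "norm (\<Sum>s<n. A \<kappa> t s * x s) \<le> Gm * \<eta>" if t: "t < n" for t
      proof -
        have three: "t < p \<or> (p \<le> t \<and> t < n - p) \<or> (n - p \<le> t)" by linarith
        then show ?thesis
        proof (elim disjE conjE)
          assume tp: "t < p"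
          have "(\<Sum>s<n. A \<kappa> t s * x s) = (\<Sum>s<2 * p. L.bdry (p - 1 - t) (2 * p - 1 - s) \<kappa> * x s)"
            using tp by (intro sum.mono_neutral_cong_right) (auto simp: A_def n_def)
          also have "\<dots> = (\<Sum>l<2 * p. L.bdry (p - 1 - t) l \<kappa> * u (rL l + int p))"
            by (rule sum.reindex_bij_witness[of _ "\<lambda>l. 2 * p - 1 - l" "\<lambda>s. 2 * p - 1 - s"])
               (auto simp: x_def pos_def rL_def of_nat_diff intro!: arg_cong[where f = u])
          also have "norm \<dots> \<le> GL (p - 1 - t) * \<eta>"
            by (rule GL[where b = b, OF \<kappa>(2)]) (use u hk in \<open>simp_all only: rowL\<close>)
          also have "\<dots> \<le> Gm * \<eta>" using GLm[of "p - 1 - t"] p \<eta> by (intro mult_right_mono) auto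
          finally show ?thesis .
        next
          assume tm: "p \<le> t" "t < n - p"
          have "(\<Sum>s<n. A \<kappa> t s * x s) = (\<Sum>s<n. (if \<bar>pos t - pos s\<bar> \<le> int p then \<kappa> * B (pos t) (pos s) * x s else 0)) - (\<Sum>s<n. if s = t then (\<kappa>\<^sup>2 + 1) * x s else 0)"
            unfolding sum_subtractf[symmetric] using tm by (intro sum.cong) (auto simp: A_def left_diff_distrib)
          also have "(\<Sum>s<n. if s = t then (\<kappa>\<^sup>2 + 1) * x s else 0) = (\<kappa>\<^sup>2 + 1) * u (pos t)" using t by (simp add: x_def)
          also have "(\<Sum>s<n. (if \<bar>pos t - pos s\<bar> \<le> int p then \<kappa> * B (pos t) (pos s) * x s else 0)) =
              (\<Sum>s | s < n \<and> \<bar>pos t - pos s\<bar> \<le> int p. \<kappa> * B (pos t) (pos s) * x s)"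
            by (subst sum.inter_filter[symmetric]) (auto intro!: sum.cong)
          also have "\<dots> = (\<Sum>j\<in>{pos t - int p..pos t + int p}. \<kappa> * (B (pos t) j * u j))"
            using tm by (intro sum.reindex_bij_witness[of _ "\<lambda>j. nat (j + int N + int p)" pos]) (auto simp: pos_def x_def n_def)
          also have "\<dots> = \<kappa> * T u (pos t)" unfolding band_op_interval by (simp add: sum_distrib_left)
          finally have "norm (\<Sum>s<n. A \<kappa> t s * x s) \<le> \<eta>" using hk[of "pos t"] by simp
          then show ?thesis using mult_right_mono[OF Gm1 \<eta>] by simp
        next
          assume tn: "n - p \<le> t"
          have tp: "\<not> t < p" "\<not> t < n - p" using tn p by (auto simp: n_def)
          have "(\<Sum>s<n. A \<kappa> t s * x s) = (\<Sum>s\<in>{2 * N..<n}. R.bdry (t - (n - p)) (s - 2 * N) \<kappa> * x s)"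
            using tp by (intro sum.mono_neutral_cong_right) (auto simp: A_def)
          also have "\<dots> = (\<Sum>l<2 * p. R.bdry (t - (n - p)) l \<kappa> * u (rR l - int p))"
            by (rule sum.reindex_bij_witness[of _ "\<lambda>l. 2 * N + l" "\<lambda>s. s - 2 * N"])
               (auto simp: x_def pos_def rR_def n_def of_nat_diff intro!: arg_cong[where f = u])
          also have "norm \<dots> \<le> GR (t - (n - p)) * \<eta>"
            by (rule GR[where b = b, OF \<kappa>(2)]) (use u hk in \<open>simp_all only: rowR\<close>)
          also have "\<dots> \<le> Gm * \<eta>" using GRm[of "t - (n - p)"] p tn t \<eta> by (intro mult_right_mono) (auto simp: n_def)
          finally show ?thesis .
        qed
      qed
      have "norm (x s0) * norm (fdet n (A \<kappa>)) \<le> fact n * Rm ^ n * (Gm * \<eta>)"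
      proof (rule fdet_cramer_bound[OF s0n Rm])
        show "norm (A \<kappa> t s) \<le> Rm" if "t < n" "s < n" for t s
          using order_trans[OF sqrt_decay_class_norm_le[OF MA cge \<kappa>1] MAR[OF that]] .
        show "0 \<le> Gm * \<eta>" using Gm1 \<eta> by simp
      qed (rule rows)
      then show ?thesis unfolding x_def D_def by (simp only: mult.assoc)
    qed
    then show ?thesis using em by blast
  qed
  then show ?thesis using c D0 Dcl by blast
qed

end

section \<open>The spectrum on and off the arcs\<close>

definition row_cut :: "(int \<Rightarrow> bool) \<Rightarrow> (bisequence \<Rightarrow> bisequence) \<Rightarrow> bisequence \<Rightarrow> bisequence" where
  "row_cut P T x = (\<lambda>i. if P i then T x i else 0)"

text \<open>Cutting rows keeps the Jacobi form, so its norm bounds apply. The test for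
  \<open>c i\<close> reads \<open>i - 1\<close> because that entry stands in row
  \<open>i - 1\<close>.\<close>

lemma row_cut_jacobi:
  "row_cut P (mat_apply (jacobi_matrix a b c)) =
     mat_apply (jacobi_matrix (\<lambda>i. if P i then a i else 0) (\<lambda>i. if P i then b i else 0) (\<lambda>i. if P (i - 1) then c i else 0))"
  by (auto simp: fun_eq_iff row_cut_def mat_apply_jacobi)

text \<open>The perturbation is split by rows into a part K1 of small norm and a part K2 on finitely
  many rows. With R0 the inverse of A0, V = 1 + R0 K1 and S = V^-1 R0, the operator factors as A0 V
  (1 + S K2), and injectivity decides the last factor.\<close>

lemma jacobi_fredholm:
  assumes bd0: "\<And>i. norm (a0 i) \<le> M" "\<And>i. norm (b0 i) \<le> M" "\<And>i. norm (c0 i) \<le> M"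
    and dev: "\<And>\<epsilon>. \<epsilon> > 0 \<Longrightarrow> \<exists>N. \<forall>i. \<bar>i\<bar> > N \<longrightarrow> deviation a b c a0 b0 c0 i \<le> \<epsilon>"
    and devb: "\<And>i. deviation a b c a0 b0 c0 i \<le> M"
    and inv: "l2_invertible (minus_scalar (mat_apply (jacobi_matrix a0 b0 c0)) z)"
    and inj: "\<And>x. x \<in> l2 \<Longrightarrow> minus_scalar (mat_apply (jacobi_matrix a b c)) z x = 0 \<Longrightarrow> x = 0"
  shows "l2_invertible (minus_scalar (mat_apply (jacobi_matrix a b c)) z)"
proof -
  define A0 where "A0 = minus_scalar (mat_apply (jacobi_matrix a0 b0 c0)) z"
  define \<alpha> where "\<alpha> = (\<lambda>i. a i - a0 i)"
  define \<beta> where "\<beta> = (\<lambda>i. b i - b0 i)"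
  define \<gamma> where "\<gamma> = (\<lambda>i. c i - c0 i)"
  define K where "K = mat_apply (jacobi_matrix \<alpha> \<beta> \<gamma>)"
  have le: "norm (\<alpha> i) \<le> deviation a b c a0 b0 c0 i" "norm (\<beta> i) \<le> deviation a b c a0 b0 c0 i"
    "norm (\<gamma> (i + 1)) \<le> deviation a b c a0 b0 c0 i" for i
    by (auto simp: deviation_def \<alpha>_def \<beta>_def \<gamma>_def)
  have le3: "norm (\<gamma> i) \<le> deviation a b c a0 b0 c0 (i - 1)" for i using le(3)[of "i - 1"] by simp
  have A: "minus_scalar (mat_apply (jacobi_matrix a b c)) z x = A0 x + K x" for x
    by (auto simp: fun_eq_iff A0_def K_def minus_scalar_def mat_apply_jacobi \<alpha>_def \<beta>_def \<gamma>_def algebra_simps)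
  have M: "M \<ge> 0" using order_trans[OF norm_ge_zero bd0(1)] .
  have A0b: "bounded_l2_operator A0"
    unfolding A0_def by (intro bounded_l2_operator_minus_scalar bounded_l2_operator_jacobi[of _ M] bd0)
  obtain R0 where R0: "bounded_l2_operator R0" "\<And>x. x \<in> l2 \<Longrightarrow> R0 (A0 x) = x" "\<And>x. x \<in> l2 \<Longrightarrow> A0 (R0 x) = x"
    using inv unfolding l2_invertible_def A0_def[symmetric] by auto
  obtain L where L: "L > 0" "\<And>x. x \<in> l2 \<Longrightarrow> l2_norm (R0 x) \<le> L * l2_norm x"
    by (rule bounded_l2_operatorE[OF R0(1)]) (rule that)
  \<comment> \<open>A Jacobi matrix with entries bounded by \<epsilon> has norm at most 3
    \<epsilon>, so R0 K1 has norm at most 1/2.\<close>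
  define \<epsilon> where "\<epsilon> = 1 / (6 * L)"
  have \<epsilon>: "\<epsilon> > 0" using L by (simp add: \<epsilon>_def)
  obtain N where N: "\<And>i. \<bar>i\<bar> > N \<Longrightarrow> deviation a b c a0 b0 c0 i \<le> \<epsilon>" using dev[OF \<epsilon>] by auto
  define K1 where "K1 = row_cut (\<lambda>i. \<bar>i\<bar> > N) K"
  define K2 where "K2 = row_cut (\<lambda>i. \<bar>i\<bar> \<le> N) K"
  have K12: "K x = K1 x + K2 x" for x by (auto simp: fun_eq_iff K1_def K2_def row_cut_def)
  have le_M: "norm (\<alpha> i) \<le> M" "norm (\<beta> i) \<le> M" "norm (\<gamma> i) \<le> M" for i
    by (rule order_trans[OF le(1) devb], rule order_trans[OF le(2) devb], rule order_trans[OF le3 devb])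
  have le_\<epsilon>: "norm (\<alpha> i) \<le> \<epsilon>" "norm (\<beta> i) \<le> \<epsilon>" if "\<bar>i\<bar> > N" for i
    by (rule order_trans[OF le(1) N[OF that]], rule order_trans[OF le(2) N[OF that]])
  have le_\<epsilon>3: "norm (\<gamma> i) \<le> \<epsilon>" if "\<bar>i - 1\<bar> > N" for i
    by (rule order_trans[OF le3 N[OF that]])
  have K1n: "K1 x \<in> l2" "l2_norm (K1 x) \<le> 3 * \<epsilon> * l2_norm x" if "x \<in> l2" for x
    unfolding K1_def K_def row_cut_jacobi
    by (rule jacobi_norm_le[where M = \<epsilon>, OF that]; use \<epsilon> le_\<epsilon> le_\<epsilon>3 in simp)+
  have K1b: "bounded_l2_operator K1" unfolding K1_def K_def row_cut_jacobi
    by (rule bounded_l2_operator_jacobi[of _ M]) (use M le_M in simp_all)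
  have K2b: "bounded_l2_operator K2" unfolding K2_def K_def row_cut_jacobi
    by (rule bounded_l2_operator_jacobi[of _ M]) (use M le_M in simp_all)
  have V: "l2_invertible (\<lambda>x. x + R0 (K1 x))"
  proof (rule l2_neumann[where q = "1 / 2"])
    show "bounded_l2_operator (\<lambda>x. R0 (K1 x))" by (rule bounded_l2_operator_comp[OF R0(1) K1b])
    fix x assume x: "x \<in> l2"
    have "l2_norm (R0 (K1 x)) \<le> L * l2_norm (K1 x)" by (rule L(2)[OF K1n(1)[OF x]])
    also have "\<dots> \<le> L * (3 * \<epsilon> * l2_norm x)" using L by (intro mult_left_mono K1n x) auto
    also have "\<dots> = 1 / 2 * l2_norm x" using L by (simp add: \<epsilon>_def)
    finally show "l2_norm (R0 (K1 x)) \<le> 1 / 2 * l2_norm x" .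
  qed simp
  define V where "V = (\<lambda>x. x + R0 (K1 x))"
  have Vb: "bounded_l2_operator V"
    unfolding V_def by (rule bounded_l2_operator_add[OF bounded_l2_operator_id bounded_l2_operator_comp[OF R0(1) K1b]])
  obtain V' where V': "bounded_l2_operator V'" "\<And>x. x \<in> l2 \<Longrightarrow> V' (V x) = x" "\<And>x. x \<in> l2 \<Longrightarrow> V (V' x) = x"
    using V unfolding l2_invertible_def V_def[symmetric] by auto
  define S where "S = (\<lambda>x. V' (R0 x))"
  have Sb: "bounded_l2_operator S" unfolding S_def by (rule bounded_l2_operator_comp[OF V'(1) R0(1)])
  have fact: "A0 (V (x + S (K2 x))) = A0 x + K x" if x: "x \<in> l2" for x
  proof -
    have l: "K1 x \<in> l2" "K2 x \<in> l2" using bounded_l2_operator_l2[OF K1b x] bounded_l2_operator_l2[OF K2b x] by auto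
    have lr: "R0 (K1 x) \<in> l2" "R0 (K2 x) \<in> l2" using bounded_l2_operator_l2[OF R0(1)] l by auto
    have ls: "S (K2 x) \<in> l2" by (rule bounded_l2_operator_l2[OF Sb l(2)])
    have "V (x + S (K2 x)) = V x + V (S (K2 x))" using Vb x ls by (simp add: bounded_l2_operator_def)
    also have "V (S (K2 x)) = R0 (K2 x)" unfolding S_def by (rule V'(3)[OF lr(2)])
    finally have "A0 (V (x + S (K2 x))) = A0 (x + R0 (K1 x) + R0 (K2 x))" by (simp only: V_def)
    also have "\<dots> = A0 (x + R0 (K1 x)) + A0 (R0 (K2 x))"
      using A0b l2_add(1)[OF x lr(1)] lr(2) unfolding bounded_l2_operator_def by blast
    also have "A0 (x + R0 (K1 x)) = A0 x + A0 (R0 (K1 x))" using A0b x lr(1) unfolding bounded_l2_operator_def by blast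
    finally show ?thesis unfolding K12 by (simp only: R0(3)[OF l(1)] R0(3)[OF l(2)] add.assoc)
  qed
  have "l2_invertible (\<lambda>x. x + S (K2 x))"
  proof (rule finite_range_fredholm[OF Sb K2b])
    show "finite {- N..N}" by simp
    show "K2 x i = 0" if "i \<notin> {- N..N}" for x i using that by (auto simp: K2_def row_cut_def)
    fix x assume x: "x \<in> l2" "x + S (K2 x) = 0"
    have "A0 x + K x = 0"
      unfolding fact[OF x(1), symmetric] x(2) by (simp only: bounded_l2_operator_0[OF Vb] bounded_l2_operator_0[OF A0b])
    then show "x = 0" using inj[OF x(1)] by (simp only: A)
  qed
  moreover have b2: "bounded_l2_operator (\<lambda>x. x + S (K2 x))"
    by (rule bounded_l2_operator_add[OF bounded_l2_operator_id bounded_l2_operator_comp[OF Sb K2b]])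
  ultimately have "l2_invertible (\<lambda>x. V (x + S (K2 x)))"
    using V Vb unfolding V_def[symmetric] by (intro l2_invertible_comp[where S = V and T = "\<lambda>x. x + S (K2 x)"])
  then have "l2_invertible (\<lambda>x. A0 (V (x + S (K2 x))))"
    using inv A0b bounded_l2_operator_comp[OF Vb b2] unfolding A0_def[symmetric]
    by (intro l2_invertible_comp[where S = A0 and T = "\<lambda>x. V (x + S (K2 x))"])
  then show ?thesis by (rule l2_invertible_cong[rotated]) (simp only: A fact)
qed

text \<open>Weyl sequences: truncations of a Bloch solution to windows far to the right.\<close>

lemma bloch_in_spectrum:
  assumes p: "p \<ge> 1" and u: "u \<noteq> 0" "minus_scalar (mat_apply (jacobi_matrix a0 b0 c0)) z u = 0"
    "\<And>i. norm (u (i + int p)) = norm (u i)"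
    and bd0: "\<And>i. norm (a0 i) \<le> M" "\<And>i. norm (b0 i) \<le> M" "\<And>i. norm (c0 i) \<le> M"
    and dev: "\<And>\<epsilon>. \<epsilon> > 0 \<Longrightarrow> \<exists>N. \<forall>i. \<bar>i\<bar> > N \<longrightarrow> deviation a b c a0 b0 c0 i \<le> \<epsilon>"
  shows "\<not> l2_invertible (minus_scalar (mat_apply (jacobi_matrix a b c)) z)"
proof
  let ?A = "minus_scalar (mat_apply (jacobi_matrix a b c)) z"
  assume "l2_invertible ?A"
  then obtain R where R: "bounded_l2_operator R" "\<And>x. x \<in> l2 \<Longrightarrow> R (?A x) = x"
    unfolding l2_invertible_def by auto
  obtain K where K: "K > 0" "\<And>x. x \<in> l2 \<Longrightarrow> l2_norm (R x) \<le> K * l2_norm x"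
    by (rule bounded_l2_operatorE[OF R(1)]) (rule that)
  have per: "norm (u (i + int p * int k)) = norm (u i)" for i k
  proof (induction k)
    case (Suc k)
    then show ?case using u(3)[of "i + int p * int k"] by (simp add: algebra_simps)
  qed simp
  have per2: "norm (u i) = norm (u (i mod int p))" for i
  proof (cases "i \<ge> 0")
    case True
    have "i div int p \<ge> 0" using True p by (simp add: pos_imp_zdiv_nonneg_iff)
    then have "i = i mod int p + int p * int (nat (i div int p))" by simp
    then show ?thesis using per[of "i mod int p" "nat (i div int p)"] by simp
  next
    case False
    have "i div int p < 0" using False p by (simp add: pos_imp_zdiv_neg_iff)
    then have "i + int p * int (nat (- (i div int p))) = i mod int p" by (simp add: minus_mult_div_eq_mod)
    then show ?thesis using per[of i "nat (- (i div int p))"] by simp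
  qed
  define U where "U = 1 + (\<Sum>j\<in>{0..<int p}. norm (u j))"
  have Ub: "norm (u i) \<le> U" for i
  proof -
    have "i mod int p \<in> {0..<int p}" using p by simp
    then have "norm (u (i mod int p)) \<le> (\<Sum>j\<in>{0..<int p}. norm (u j))" by (intro member_le_sum) auto
    then show ?thesis using per2[of i] by (simp add: U_def)
  qed
  have U: "U \<ge> 1" unfolding U_def by (simp add: sum_nonneg)
  obtain i0 where i0: "u i0 \<noteq> 0" using u(1) by (auto simp: fun_eq_iff)
  define s where "s = (norm (u i0))\<^sup>2"
  have s: "s > 0" using i0 by (simp add: s_def)
  have M: "M \<ge> 0" using order_trans[OF norm_ge_zero bd0(1)] .
  define E where "E = 3 * (M + 1) * U + norm z * U"
  have E: "E \<ge> 0" using M U by (simp add: E_def)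
  \<comment> \<open>L periods contribute at least L s to the squared norm of the truncation, while
    its image stays below 4 E^2 + 1 whatever L is. A bounded inverse of norm K cannot bridge this
    gap.\<close>
  obtain L :: nat where L: "K\<^sup>2 * (4 * E\<^sup>2 + 1) < real L * s"
    using reals_Archimedean3[OF s] by blast
  \<comment> \<open>Fixed after L: the coefficient errors over all rows near the window then add at
    most 1 to the squared norm of the residual.\<close>
  define \<epsilon> where "\<epsilon> = 1 / (U * (real (L * p) + 4))"
  have \<epsilon>: "\<epsilon> > 0" unfolding \<epsilon>_def by (intro divide_pos_pos mult_pos_pos add_nonneg_pos) (use U in auto)
  have \<epsilon>1: "\<epsilon> \<le> 1"
  proof -
    have "1 * 1 \<le> U * (real (L * p) + 4)" using U by (intro mult_mono) auto
    then show ?thesis by (simp add: \<epsilon>_def)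
  qed
  obtain N where N: "\<And>i. \<bar>i\<bar> > N \<Longrightarrow> deviation a b c a0 b0 c0 i \<le> \<epsilon>" using dev[OF \<epsilon>] by auto
  \<comment> \<open>Moving i0 by a multiple of p keeps |u|, so the window starts at a point where u
    has the modulus |u(i0)| and beyond which the deviation is small.\<close>
  define l where "l = i0 + int p * int (nat (\<bar>N\<bar> + \<bar>i0\<bar> + 2))"
  have lN: "l > N + 1" "l > 1"
  proof -
    have "1 * int (nat (\<bar>N\<bar> + \<bar>i0\<bar> + 2)) \<le> int p * int (nat (\<bar>N\<bar> + \<bar>i0\<bar> + 2))"
      using p by (intro mult_right_mono) auto
    then show "l > N + 1" "l > 1" unfolding l_def by auto
  qed
  define r where "r = l + int (L * p)"
  define x where "x i = (if i \<in> {l..<r} then u i else 0)" for i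
  have x: "x \<in> l2" by (rule l2_finite_support(1)[of "{l..<r}"]) (auto simp: x_def)
  have low: "real L * s \<le> (l2_norm x)\<^sup>2"
  proof -
    have "real L * s = (\<Sum>k<L. s)" by simp
    also have "\<dots> = (\<Sum>k<L. (norm (x (l + int p * int k)))\<^sup>2)"
    proof (intro sum.cong refl)
      fix k assume "k \<in> {..<L}"
      then have "k + 1 \<le> L" by simp
      then have "int p * int k + int p \<le> int (L * p)"
        using mult_right_mono[of "int (k + 1)" "int L" "int p"] by (simp add: algebra_simps)
      then have "int p * int k < int (L * p)" using p by linarith
      then have "l + int p * int k \<in> {l..<r}" by (simp only: r_def atLeastLessThan_iff) simp
      moreover have "norm (u (l + int p * int k)) = norm (u i0)"
        using per[of l k] per[of i0 "nat (\<bar>N\<bar> + \<bar>i0\<bar> + 2)"] by (simp add: l_def)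
      ultimately show "s = (norm (x (l + int p * int k)))\<^sup>2" by (simp add: x_def s_def)
    qed
    also have "\<dots> = (\<Sum>i\<in>(\<lambda>k. l + int p * int k) ` {..<L}. (norm (x i))\<^sup>2)"
      using p by (subst sum.reindex) (auto simp: inj_on_def)
    also have "\<dots> \<le> (l2_norm x)\<^sup>2"
    proof -
      have "L2_set (\<lambda>i. cmod (x i)) ((\<lambda>k. l + int p * int k) ` {..<L}) \<le> l2_norm x"
        by (intro L2_set_le_l2_norm x) auto
      then have "(L2_set (\<lambda>i. cmod (x i)) ((\<lambda>k. l + int p * int k) ` {..<L}))\<^sup>2 \<le> (l2_norm x)\<^sup>2"
        by (intro power_mono) (auto simp: L2_set_nonneg)
      then show ?thesis by (simp add: L2_set_def sum_nonneg)
    qed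
    finally show ?thesis .
  qed
  define y where "y = ?A x"
  have yi: "y i = a i * x (i - 1) + b i * x i + c (i + 1) * x (i + 1) - z * x i" for i
    by (simp add: y_def minus_scalar_def mat_apply_jacobi seq_scale_def)
  have eq: "a0 i * u (i - 1) + b0 i * u i + c0 (i + 1) * u (i + 1) - z * u i = 0" for i
    using fun_cong[OF u(2), of i] by (simp add: minus_scalar_def mat_apply_jacobi seq_scale_def)
  have dv: "norm (a i - a0 i) + norm (b i - b0 i) + norm (c (i + 1) - c0 (i + 1)) \<le> \<epsilon>" if "i \<ge> l - 1" for i
    using N[of i] that lN unfolding deviation_def by simp
  have y0: "y i = 0" if "i \<notin> {l - 1..r}" for i using that by (auto simp: yi x_def)
  have y1: "norm (y i) \<le> \<epsilon> * U" if i: "i \<in> {l + 1..<r - 1}" for i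
  proof -
    have "y i = (a i - a0 i) * u (i - 1) + (b i - b0 i) * u i + (c (i + 1) - c0 (i + 1)) * u (i + 1)"
      using i eq[of i] by (simp add: yi x_def algebra_simps)
    then have "norm (y i) \<le> norm (a i - a0 i) * U + norm (b i - b0 i) * U + norm (c (i + 1) - c0 (i + 1)) * U"
      by (simp only:) (intro order_trans[OF norm_triangle_ineq] add_mono; simp add: norm_mult mult_left_mono Ub)
    also have "\<dots> = (norm (a i - a0 i) + norm (b i - b0 i) + norm (c (i + 1) - c0 (i + 1))) * U" by (simp add: algebra_simps)
    also have "\<dots> \<le> \<epsilon> * U" using dv[of i] i U by (intro mult_right_mono) auto
    finally show ?thesis .
  qed
  have y2: "norm (y i) \<le> E" if i: "i \<ge> l - 1" for i
  proof -
    have xb: "norm (x j) \<le> U" for j using Ub U by (simp add: x_def)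
    have cb: "norm (a i) \<le> M + 1" "norm (b i) \<le> M + 1" "norm (c (i + 1)) \<le> M + 1"
      using dv[OF i] \<epsilon>1 bd0(1)[of i] bd0(2)[of i] bd0(3)[of "i + 1"]
        norm_triangle_sub[of "a i" "a0 i"] norm_triangle_sub[of "b i" "b0 i"] norm_triangle_sub[of "c (i + 1)" "c0 (i + 1)"]
        norm_ge_zero[of "a i - a0 i"] norm_ge_zero[of "b i - b0 i"] norm_ge_zero[of "c (i + 1) - c0 (i + 1)"]
      by linarith+
    have "norm (y i) \<le> (M + 1) * U + (M + 1) * U + (M + 1) * U + norm z * U"
      unfolding yi
      by (intro order_trans[OF norm_triangle_ineq4] order_trans[OF norm_triangle_ineq] add_mono)
         (use cb xb M in \<open>auto simp: norm_mult intro!: mult_mono\<close>)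
    then show ?thesis unfolding E_def by (simp add: algebra_simps)
  qed
  have yl: "y \<in> l2" by (rule l2_finite_support(1)[of "{l - 1..r}"]) (use y0 in auto)
  have "l2_norm y = L2_set (\<lambda>i. norm (y i)) {l - 1..r}"
    by (rule l2_finite_support(2)) (use y0 in auto)
  then have "(l2_norm y)\<^sup>2 = (\<Sum>i\<in>{l - 1..r}. (norm (y i))\<^sup>2)" by (simp add: L2_set_def sum_nonneg)
  \<comment> \<open>Truncation is felt only in the two rows at each edge of the window, where the
    crude bound E is used.\<close>
  also have "\<dots> \<le> (\<Sum>i\<in>{l - 1..r}. (if i \<in> {l - 1, l, r - 1, r} then E\<^sup>2 else 0) + (\<epsilon> * U)\<^sup>2)"
  proof (rule sum_mono)
    fix i assume i: "i \<in> {l - 1..r}"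
    show "(norm (y i))\<^sup>2 \<le> (if i \<in> {l - 1, l, r - 1, r} then E\<^sup>2 else 0) + (\<epsilon> * U)\<^sup>2"
    proof (cases "i \<in> {l - 1, l, r - 1, r}")
      case True
      have "(norm (y i))\<^sup>2 \<le> E\<^sup>2" using y2[of i] i by (intro power_mono) auto
      also have "E\<^sup>2 \<le> E\<^sup>2 + (\<epsilon> * U)\<^sup>2" by simp
      finally show ?thesis using True by (simp only: if_True)
    next
      case False
      then have "i \<in> {l + 1..<r - 1}" using i by auto
      then show ?thesis using y1[of i] False by (simp add: power_mono)
    qed
  qed
  also have "\<dots> = (\<Sum>i\<in>{l - 1..r}. if i \<in> {l - 1, l, r - 1, r} then E\<^sup>2 else 0) + real (card {l - 1..r}) * (\<epsilon> * U)\<^sup>2"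
    by (simp add: sum.distrib)
  also have "\<dots> \<le> 4 * E\<^sup>2 + 1"
  proof (rule add_mono)
    have "(\<Sum>i\<in>{l - 1..r}. if i \<in> {l - 1, l, r - 1, r} then E\<^sup>2 else 0) = (\<Sum>i\<in>{l - 1..r} \<inter> {l - 1, l, r - 1, r}. E\<^sup>2)"
      by (rule sum.inter_restrict[symmetric]) simp
    also have "\<dots> \<le> real (card {l - 1, l, r - 1, r}) * E\<^sup>2"
      by (simp only: sum_constant) (intro mult_right_mono of_nat_mono card_mono, auto)
    also have "\<dots> \<le> 4 * E\<^sup>2"
    proof (intro mult_right_mono)
      have "card {l - 1, l, r - 1, r} \<le> 4" using card_length[of "[l - 1, l, r - 1, r]"] by simp
      then show "real (card {l - 1, l, r - 1, r}) \<le> 4" by simp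
    qed auto
    finally show "(\<Sum>i\<in>{l - 1..r}. if i \<in> {l - 1, l, r - 1, r} then E\<^sup>2 else 0) \<le> 4 * E\<^sup>2" .
    define Y where "Y = real (L * p) + 4"
    have Y: "Y \<ge> 1" by (simp add: Y_def)
    have "real (card {l - 1..r}) \<le> Y" by (simp add: r_def Y_def)
    moreover have "\<epsilon> * U = 1 / Y" using U by (simp add: \<epsilon>_def Y_def)
    ultimately have "real (card {l - 1..r}) * (\<epsilon> * U)\<^sup>2 \<le> Y * (1 / Y)\<^sup>2" by (simp only:) (intro mult_right_mono, auto)
    also have "\<dots> \<le> 1" using Y by (simp add: power2_eq_square)
    finally show "real (card {l - 1..r}) * (\<epsilon> * U)\<^sup>2 \<le> 1" .
  qed
  finally have up: "(l2_norm y)\<^sup>2 \<le> 4 * E\<^sup>2 + 1" .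
  have "l2_norm x \<le> K * l2_norm y" using K(2)[OF yl] R(2)[OF x] by (simp add: y_def)
  then have "(l2_norm x)\<^sup>2 \<le> (K * l2_norm y)\<^sup>2" by (intro power_mono) auto
  also have "\<dots> \<le> K\<^sup>2 * (4 * E\<^sup>2 + 1)" using up by (simp add: power_mult_distrib mult_left_mono)
  finally show False using low L by simp
qed

context perturbed_free
begin

text \<open>A Jordan chain of length \<open>k + 1\<close> at \<open>\<kappa>\<^sub>0 + 1/\<kappa>\<^sub>0\<close> extends to the polynomial family \<open>u(\<kappa>)\<close> with
  \<open>(T - \<mu>) u = - (\<mu> - \<mu>\<^sub>0)\<^sup>k\<^sup>+\<^sup>1 x\<close>, so the determinant vanishes to order \<open>k + 1\<close>.\<close>

lemma chain_residual:
  assumes x: "(minus_scalar T z ^^ Suc k) x = 0"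
  shows "minus_scalar T (z + w) (\<lambda>i. \<Sum>j\<le>k. w ^ j * (minus_scalar T z ^^ (k - j)) x i) = (\<lambda>i. - (w ^ Suc k * x i))"
proof -
  define X where "X = minus_scalar T z"
  define Y where "Y m = (X ^^ m) x" for m
  define u where "u = (\<lambda>i. \<Sum>j\<le>k. w ^ j * Y (k - j) i)"
  have Y0: "Y (Suc k) = 0" using x by (simp only: Y_def X_def)
  have "X u = (\<lambda>i. \<Sum>j\<le>k. w ^ j * X (Y (k - j)) i)"
    unfolding u_def X_def by (rule seq_linear_sum[OF seq_linear_minus_scalar[OF linear]])
  then have Xu: "X u i = (\<Sum>j\<le>k. w ^ j * Y (Suc (k - j)) i)" for i by (simp add: Y_def)
  have "minus_scalar T (z + w) u i = - (w ^ Suc k * x i)" for i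
  proof -
    have "(\<Sum>j\<le>k. w ^ j * Y (Suc (k - j)) i) = (\<Sum>j<k. w ^ Suc j * Y (k - j) i)"
    proof (cases k)
      case 0
      then show ?thesis using Y0 by simp
    next
      case (Suc m)
      have "(\<Sum>j\<le>k. w ^ j * Y (Suc (k - j)) i) = w ^ 0 * Y (Suc k) i + (\<Sum>j\<le>m. w ^ Suc j * Y (Suc (k - Suc j)) i)"
        unfolding Suc by (simp only: sum.atMost_Suc_shift diff_zero)
      also have "\<dots> = (\<Sum>j\<le>m. w ^ Suc j * Y (k - j) i)"
        using Y0 by (simp add: Suc Suc_diff_le)
      finally show ?thesis by (simp only: Suc lessThan_Suc_atMost)
    qed
    moreover have "w * u i = (\<Sum>j<k. w ^ Suc j * Y (k - j) i) + w ^ Suc k * x i"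
    proof -
      have "w * u i = (\<Sum>j\<le>k. w ^ Suc j * Y (k - j) i)" by (simp add: u_def sum_distrib_left mult.assoc)
      also have "{..k} = insert k {..<k}" by auto
      finally show ?thesis by (simp add: Y_def)
    qed
    moreover have "minus_scalar T (z + w) u i = X u i - w * u i"
      by (simp add: X_def minus_scalar_def seq_scale_def algebra_simps)
    ultimately show ?thesis using Xu[of i] by simp
  qed
  then show ?thesis unfolding u_def Y_def X_def by blast
qed

text \<open>The polynomial family built from the chain tends to its eigenvector e as \<kappa> tends
  to \<kappa>0, so its value at m stays away from 0 while its residual is of order |\<kappa> -
  \<kappa>0|^(k+1). The pairing estimate moves that order to D.\<close>

lemma determinant_vanishes:
  assumes D: "\<forall>\<rho> e z. 0 < \<rho> \<longrightarrow> \<rho> < 1 \<longrightarrow> T e = seq_scale z e \<longrightarrow> e \<noteq> 0 \<longrightarrow>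
      (\<exists>G m. e m \<noteq> 0 \<and> (\<forall>\<kappa> u b \<eta>. \<kappa> \<noteq> 0 \<longrightarrow> norm \<kappa> \<le> \<rho> \<longrightarrow> (\<forall>i. norm (u i) \<le> b) \<longrightarrow>
         (\<forall>i. norm (minus_scalar T (\<kappa> + 1 / \<kappa>) u i) \<le> \<eta>) \<longrightarrow> norm (u m) * norm (D \<kappa>) \<le> G * \<eta>))"
    and \<kappa>0: "\<kappa>0 \<noteq> 0" "norm \<kappa>0 < 1" and x: "\<And>i. norm (x i) \<le> b0"
    and ch: "(minus_scalar T (\<kappa>0 + 1 / \<kappa>0) ^^ Suc k) x = 0" "(minus_scalar T (\<kappa>0 + 1 / \<kappa>0) ^^ k) x \<noteq> 0"
  shows "\<exists>L. \<forall>\<^sub>F \<kappa> in at \<kappa>0. norm (D \<kappa>) \<le> L * norm (\<kappa> - \<kappa>0) ^ Suc k"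
proof -
  define z where "z = \<kappa>0 + 1 / \<kappa>0"
  define Y where "Y m = (minus_scalar T z ^^ m) x" for m
  define e where "e = Y k"
  have e0: "e \<noteq> 0" using ch(2) by (simp add: e_def Y_def z_def)
  have "minus_scalar T z e = 0" using ch(1) by (simp add: e_def Y_def z_def)
  then have Te: "T e = seq_scale z e" by (simp add: minus_scalar_def)
  define \<rho> where "\<rho> = (1 + norm \<kappa>0) / 2"
  have \<rho>: "0 < \<rho>" "\<rho> < 1" "norm \<kappa>0 < \<rho>" using \<kappa>0 by (auto simp: \<rho>_def add_pos_nonneg)
  obtain G m where em: "e m \<noteq> 0" and G: "\<forall>\<kappa> u b \<eta>. \<kappa> \<noteq> 0 \<longrightarrow> norm \<kappa> \<le> \<rho> \<longrightarrow> (\<forall>i. norm (u i) \<le> b) \<longrightarrow>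
         (\<forall>i. norm (minus_scalar T (\<kappa> + 1 / \<kappa>) u i) \<le> \<eta>) \<longrightarrow> norm (u m) * norm (D \<kappa>) \<le> G * \<eta>"
    using D[rule_format, OF \<rho>(1,2) Te e0] by (elim exE conjE) (rule that)
  have b0: "b0 \<ge> 0" using order_trans[OF norm_ge_zero x] .
  define w where "w \<kappa> = \<kappa> + 1 / \<kappa> - z" for \<kappa>
  define u where "u \<kappa> = (\<lambda>i. \<Sum>j\<le>k. w \<kappa> ^ j * Y (k - j) i)" for \<kappa>
  \<comment> \<open>A Lipschitz constant of the map \<kappa> + 1/\<kappa> at \<kappa>0, from w =
    (\<kappa> - \<kappa>0)(1 - 1/(\<kappa> \<kappa>0)) for |\<kappa>| above |\<kappa>0|/2.\<close>
  define Lc where "Lc = 1 + 2 / (norm \<kappa>0)\<^sup>2"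
  have Lc: "Lc \<ge> 0" by (simp add: Lc_def)
  have w0: "w \<kappa>0 = 0" by (simp add: w_def z_def)
  have wc: "(w \<longlongrightarrow> w \<kappa>0) (at \<kappa>0)" unfolding w_def using \<kappa>0 by (intro tendsto_intros) auto
  have "((\<lambda>\<kappa>. norm (u \<kappa> m)) \<longlongrightarrow> norm (u \<kappa>0 m)) (at \<kappa>0)"
    unfolding u_def by (intro tendsto_norm tendsto_sum tendsto_mult tendsto_power wc tendsto_const)
  moreover have "u \<kappa>0 m = e m"
  proof -
    have "u \<kappa>0 m = (\<Sum>j\<le>k. if j = 0 then Y k m else 0)"
      unfolding u_def w0 by (intro sum.cong) (auto simp: power_0_left)
    then show ?thesis by (simp add: e_def)
  qed
  ultimately have "((\<lambda>\<kappa>. norm (u \<kappa> m)) \<longlongrightarrow> norm (e m)) (at \<kappa>0)" by simp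
  then have ev1: "\<forall>\<^sub>F \<kappa> in at \<kappa>0. norm (e m) / 2 < norm (u \<kappa> m)"
    by (rule order_tendstoD(1)) (use em in simp)
  have nt: "((\<lambda>\<kappa>. norm \<kappa>) \<longlongrightarrow> norm \<kappa>0) (at \<kappa>0)" by (intro tendsto_intros)
  have ev2: "\<forall>\<^sub>F \<kappa> in at \<kappa>0. norm \<kappa> < \<rho>" by (rule order_tendstoD(2)[OF nt \<rho>(3)])
  have ev3: "\<forall>\<^sub>F \<kappa> in at \<kappa>0. norm \<kappa>0 / 2 < norm \<kappa>" by (rule order_tendstoD(1)[OF nt]) (use \<kappa>0 in simp)
  define L where "L = 2 / norm (e m) * \<bar>G\<bar> * (Lc ^ Suc k * b0)"
  have "\<forall>\<^sub>F \<kappa> in at \<kappa>0. norm (D \<kappa>) \<le> L * norm (\<kappa> - \<kappa>0) ^ Suc k"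
    using ev1 ev2 ev3
  proof eventually_elim
    case (elim \<kappa>)
    have \<kappa>: "\<kappa> \<noteq> 0" using elim(3) \<kappa>0 by auto
    have "w \<kappa> = (\<kappa> - \<kappa>0) * (1 - 1 / (\<kappa> * \<kappa>0))"
      using \<kappa> \<kappa>0 by (simp add: w_def z_def field_simps)
    moreover have "norm (1 - 1 / (\<kappa> * \<kappa>0)) \<le> Lc"
    proof -
      have "norm (1 / (\<kappa> * \<kappa>0)) = 1 / (norm \<kappa> * norm \<kappa>0)" by (simp add: norm_divide norm_mult)
      also have "\<dots> \<le> 1 / (norm \<kappa>0 / 2 * norm \<kappa>0)"
        using elim(3) \<kappa>0 by (intro divide_left_mono mult_right_mono mult_pos_pos) auto
      also have "\<dots> = 2 / (norm \<kappa>0)\<^sup>2" by (simp add: power2_eq_square)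
      finally show ?thesis using norm_triangle_ineq4[of 1 "1 / (\<kappa> * \<kappa>0)"] unfolding Lc_def by simp
    qed
    ultimately have wb: "norm (w \<kappa>) \<le> norm (\<kappa> - \<kappa>0) * Lc" by (simp add: norm_mult mult_left_mono)
    define \<eta> where "\<eta> = norm (w \<kappa>) ^ Suc k * b0"
    have zw: "\<kappa> + 1 / \<kappa> = z + w \<kappa>" by (simp add: w_def)
    have res: "minus_scalar T (\<kappa> + 1 / \<kappa>) (u \<kappa>) = (\<lambda>i. - (w \<kappa> ^ Suc k * x i))"
      unfolding zw u_def Y_def by (rule chain_residual) (use ch(1) in \<open>simp only: z_def\<close>)
    have "\<exists>b. \<forall>i. norm (u \<kappa> i) \<le> b"
    proof -
      have "\<exists>M. \<forall>i. norm (Y j i) \<le> M" for j unfolding Y_def by (rule bounded_power[OF x])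
      then obtain M where M: "\<And>j i. norm (Y j i) \<le> M j" by metis
      have "norm (u \<kappa> i) \<le> (\<Sum>j\<le>k. norm (w \<kappa>) ^ j * M (k - j))" for i
        unfolding u_def using M by (intro sum_norm_le) (auto simp: norm_mult norm_power intro!: mult_left_mono)
      then show ?thesis by blast
    qed
    then obtain b where b: "\<forall>i. norm (u \<kappa> i) \<le> b" by blast
    have "\<forall>i. norm (minus_scalar T (\<kappa> + 1 / \<kappa>) (u \<kappa>) i) \<le> \<eta>"
      unfolding res \<eta>_def using x by (auto simp: norm_mult norm_power intro!: mult_left_mono)
    from G[rule_format, OF \<kappa> less_imp_le[OF elim(2)] b[rule_format] this[rule_format]]
    have "norm (u \<kappa> m) * norm (D \<kappa>) \<le> G * \<eta>" .
    moreover have "norm (e m) / 2 * norm (D \<kappa>) \<le> norm (u \<kappa> m) * norm (D \<kappa>)"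
      using elim(1) by (intro mult_right_mono) auto
    moreover have "G * \<eta> \<le> \<bar>G\<bar> * \<eta>" using b0 by (intro mult_right_mono) (auto simp: \<eta>_def)
    moreover have "\<eta> \<le> (norm (\<kappa> - \<kappa>0) * Lc) ^ Suc k * b0"
      unfolding \<eta>_def using wb b0 by (intro mult_right_mono power_mono) auto
    then have "\<bar>G\<bar> * \<eta> \<le> \<bar>G\<bar> * ((norm (\<kappa> - \<kappa>0) * Lc) ^ Suc k * b0)" by (intro mult_left_mono) auto
    ultimately have "norm (e m) / 2 * norm (D \<kappa>) \<le> \<bar>G\<bar> * ((norm (\<kappa> - \<kappa>0) * Lc) ^ Suc k * b0)" by linarith
    then have "2 / norm (e m) * (norm (e m) / 2 * norm (D \<kappa>)) \<le> 2 / norm (e m) * (\<bar>G\<bar> * ((norm (\<kappa> - \<kappa>0) * Lc) ^ Suc k * b0))"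
      by (intro mult_left_mono) auto
    moreover have "2 / norm (e m) * (norm (e m) / 2 * norm (D \<kappa>)) = norm (D \<kappa>)" using em by simp
    moreover have "2 / norm (e m) * (\<bar>G\<bar> * ((norm (\<kappa> - \<kappa>0) * Lc) ^ Suc k * b0)) = L * norm (\<kappa> - \<kappa>0) ^ Suc k"
      unfolding L_def power_mult_distrib by (simp only: mult_ac)
    ultimately show ?case by simp
  qed
  then show ?thesis by blast
qed

text \<open>The zeros of D in the disc cover all eigenvalues off the interval through \<kappa> +
  1/\<kappa>, and the order of vanishing at \<kappa> bounds all Jordan chains at once: one exponent
  K annihilates the whole root subspace.\<close>

lemma finite_spectrum_off_interval:
  "finite {z. z \<notin> complex_of_real ` {-2..2} \<and> (\<exists>x\<in>l2. x \<noteq> 0 \<and> T x = seq_scale z x)}"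
  "z \<notin> complex_of_real ` {-2..2} \<Longrightarrow>
     \<exists>K. \<forall>k. \<forall>x\<in>l2. (minus_scalar T z ^^ k) x = 0 \<longrightarrow> (minus_scalar T z ^^ K) x = 0"
proof -
  obtain c M D where c: "c > 0" and D: "sqrt_decay_class c M D" "D 0 \<noteq> 0"
    and J: "\<forall>\<rho> e z. 0 < \<rho> \<longrightarrow> \<rho> < 1 \<longrightarrow> T e = seq_scale z e \<longrightarrow> e \<noteq> 0 \<longrightarrow>
      (\<exists>G m. e m \<noteq> 0 \<and> (\<forall>\<kappa> u b \<eta>. \<kappa> \<noteq> 0 \<longrightarrow> norm \<kappa> \<le> \<rho> \<longrightarrow> (\<forall>i. norm (u i) \<le> b) \<longrightarrow>
         (\<forall>i. norm (minus_scalar T (\<kappa> + 1 / \<kappa>) u i) \<le> \<eta>) \<longrightarrow> norm (u m) * norm (D \<kappa>) \<le> G * \<eta>))"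
    using jost_determinant_exists by (elim exE conjE) (rule that)
  have Dhol: "D holomorphic_on ball 0 1" by (rule sqrt_decay_class_regular(2)[OF D(1) less_imp_le[OF c]])
  have van: "\<exists>L. \<forall>\<^sub>F \<kappa> in at \<kappa>0. norm (D \<kappa>) \<le> L * norm (\<kappa> - \<kappa>0) ^ Suc k"
    if "\<kappa>0 \<noteq> 0" "norm \<kappa>0 < 1" "x \<in> l2" "(minus_scalar T (\<kappa>0 + 1 / \<kappa>0) ^^ Suc k) x = 0"
      "(minus_scalar T (\<kappa>0 + 1 / \<kappa>0) ^^ k) x \<noteq> 0" for \<kappa>0 x k
    by (rule determinant_vanishes[OF J that(1,2) norm_le_l2_norm[OF that(3)] that(4,5)])
  have zero: "D \<kappa>0 = 0" if \<kappa>0: "\<kappa>0 \<noteq> 0" "norm \<kappa>0 < 1" and x: "x \<in> l2" "x \<noteq> 0" "T x = seq_scale (\<kappa>0 + 1 / \<kappa>0) x" for \<kappa>0 x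
  proof -
    have "(minus_scalar T (\<kappa>0 + 1 / \<kappa>0) ^^ Suc 0) x = 0" using x(3) by (simp add: minus_scalar_def)
    then obtain L where L: "\<forall>\<^sub>F \<kappa> in at \<kappa>0. norm (D \<kappa>) \<le> L * norm (\<kappa> - \<kappa>0) ^ Suc 0"
      using van[OF \<kappa>0 x(1), of 0] x(2) by auto
    have "(D \<longlongrightarrow> D \<kappa>0) (at \<kappa>0)"
      using holomorphic_on_imp_continuous_on[OF Dhol] \<kappa>0(2) continuous_on_eq_continuous_at[of "ball 0 1" D]
      by (auto simp: isCont_def)
    then have "((\<lambda>\<kappa>. norm (D \<kappa>)) \<longlongrightarrow> norm (D \<kappa>0)) (at \<kappa>0)" by (rule tendsto_norm)
    moreover have "((\<lambda>\<kappa>. L * norm (\<kappa> - \<kappa>0) ^ Suc 0) \<longlongrightarrow> L * norm (\<kappa>0 - \<kappa>0) ^ Suc 0) (at \<kappa>0)"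
      by (intro tendsto_intros)
    ultimately have "norm (D \<kappa>0) \<le> L * norm (\<kappa>0 - \<kappa>0) ^ Suc 0"
      using L by (intro tendsto_le[of "at \<kappa>0"]) auto
    then show ?thesis by simp
  qed
  show "finite {z. z \<notin> complex_of_real ` {-2..2} \<and> (\<exists>x\<in>l2. x \<noteq> 0 \<and> T x = seq_scale z x)}"
  proof (rule finite_subset)
    show "finite ((\<lambda>\<kappa>. \<kappa> + 1 / \<kappa>) ` {\<kappa>. norm \<kappa> < 1 \<and> D \<kappa> = 0})"
      by (rule finite_imageI[OF sqrt_decay_class_finite_zeros[OF D(1) c D(2)]])
    show "{z. z \<notin> complex_of_real ` {-2..2} \<and> (\<exists>x\<in>l2. x \<noteq> 0 \<and> T x = seq_scale z x)} \<subseteq>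
        (\<lambda>\<kappa>. \<kappa> + 1 / \<kappa>) ` {\<kappa>. norm \<kappa> < 1 \<and> D \<kappa> = 0}"
    proof
      fix z assume "z \<in> {z. z \<notin> complex_of_real ` {-2..2} \<and> (\<exists>x\<in>l2. x \<noteq> 0 \<and> T x = seq_scale z x)}"
      then obtain x where zx: "z \<notin> complex_of_real ` {-2..2}" "x \<in> l2" "x \<noteq> 0" "T x = seq_scale z x" by auto
      obtain \<kappa> where \<kappa>: "\<kappa> \<noteq> 0" "norm \<kappa> < 1" "z = \<kappa> + 1 / \<kappa>" using joukowski_exists[OF zx(1)] .
      have "D \<kappa> = 0" using zero[OF \<kappa>(1,2) zx(2,3)] zx(4) \<kappa>(3) by simp
      then show "z \<in> (\<lambda>\<kappa>. \<kappa> + 1 / \<kappa>) ` {\<kappa>. norm \<kappa> < 1 \<and> D \<kappa> = 0}" using \<kappa> by blast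
    qed
  qed
  assume z: "z \<notin> complex_of_real ` {-2..2}"
  obtain \<kappa> where \<kappa>: "\<kappa> \<noteq> 0" "norm \<kappa> < 1" "z = \<kappa> + 1 / \<kappa>" using joukowski_exists[OF z] .
  obtain K where K: "\<And>k C. (\<forall>\<^sub>F w in at \<kappa>. norm (D w) \<le> C * norm (w - \<kappa>) ^ k) \<Longrightarrow> k \<le> K"
    using holomorphic_zero_order_bounded[OF Dhol D(2) \<kappa>(2)] by auto
  define X where "X = minus_scalar T z"
  have X00: "X 0 = 0" unfolding X_def by (rule seq_linear_diff(2)[OF seq_linear_minus_scalar[OF linear]])
  have X0: "(X ^^ j) 0 = 0" for j
    by (induction j) (simp_all only: funpow.simps comp_def id_apply X00)
  have "(X ^^ K) x = 0" if x: "x \<in> l2" "(X ^^ k) x = 0" for k x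
  proof -
    define k0 where "k0 = (LEAST k. (X ^^ k) x = 0)"
    have k0: "(X ^^ k0) x = 0" unfolding k0_def by (rule LeastI[of _ k]) (rule x(2))
    have "k0 \<le> K"
    proof (cases k0)
      case (Suc m)
      have "(X ^^ m) x \<noteq> 0" using not_less_Least[of m "\<lambda>k. (X ^^ k) x = 0"] Suc by (auto simp: k0_def)
      moreover have "(X ^^ Suc m) x = 0" using k0 unfolding Suc .
      ultimately obtain L where "\<forall>\<^sub>F w in at \<kappa>. norm (D w) \<le> L * norm (w - \<kappa>) ^ Suc m"
        using van[OF \<kappa>(1,2) x(1), of m] unfolding X_def \<kappa>(3) by blast
      then show ?thesis unfolding Suc by (rule K)
    qed simp
    then have "(X ^^ K) x = (X ^^ (K - k0)) ((X ^^ k0) x)" by (simp flip: funpow_add[THEN fun_cong, unfolded comp_def])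
    then show ?thesis unfolding k0 X0 .
  qed
  then show "\<exists>K. \<forall>k. \<forall>x\<in>l2. (minus_scalar T z ^^ k) x = 0 \<longrightarrow> (minus_scalar T z ^^ K) x = 0"
    unfolding X_def by blast
qed

end

section \<open>Transfer from Q(J) to J\<close>

lemma periodic_seq_bounded:
  assumes "p \<ge> 1" "periodic_seq p a"
  obtains M where "\<And>i. norm (a i) \<le> M"
proof -
  have up: "a (i + int p * int k) = a i" for i k
  proof (induction k)
    case (Suc k)
    then show ?case using periodic_seq_shift(1)[OF assms(2), of "i + int p * int k"] by (simp add: algebra_simps)
  qed simp
  have "a i = a (i mod int p)" for i
  proof (cases "i div int p \<ge> 0")
    case True
    then have "i = i mod int p + int p * int (nat (i div int p))" by simp
    then show ?thesis using up[of "i mod int p" "nat (i div int p)"] by simp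
  next
    case False
    then have "i + int p * int (nat (- (i div int p))) = i mod int p" by (simp add: minus_mult_div_eq_mod)
    then show ?thesis using up[of i "nat (- (i div int p))"] by simp
  qed
  moreover have "norm (a (i mod int p)) \<le> (\<Sum>j\<in>{0..<int p}. norm (a j))" for i
    using assms(1) by (intro member_le_sum) auto
  ultimately show thesis using that by metis
qed

lemma mat_power_bounded:
  assumes b: "\<And>i. norm (a i) \<le> M" "\<And>i. norm (b i) \<le> M" "\<And>i. norm (c i) \<le> M"
  shows "\<exists>L. \<forall>i j. norm (mat_power (jacobi_matrix a b c) k i j) \<le> L"
proof (induction k)
  case 0
  show ?case by (intro exI[of _ 1]) (auto simp: mat_one_def)
next
  case (Suc k)
  then obtain L where L: "\<And>i j. norm (mat_power (jacobi_matrix a b c) k i j) \<le> L" by blast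
  have M: "M \<ge> 0" using order_trans[OF norm_ge_zero b(1)] .
  have "norm (mat_power (jacobi_matrix a b c) (Suc k) i j) \<le> M * L + M * L + M * L" for i j
    unfolding mat_power_Suc_left
    by (intro order_trans[OF norm_triangle_ineq] add_mono; simp only: norm_mult; intro mult_mono b L M norm_ge_zero)
  then show ?case by blast
qed

lemma exp_sqrt_shift:
  assumes "C2 \<ge> 0" "\<bar>i - j\<bar> \<le> 1"
  shows "exp (- C2 * sqrt \<bar>real_of_int j\<bar>) \<le> exp C2 * exp (- C2 * sqrt \<bar>real_of_int i\<bar>)"
proof -
  have "sqrt \<bar>real_of_int i\<bar> \<le> sqrt (\<bar>real_of_int j\<bar> + 1)" using assms(2) by (intro real_sqrt_le_mono) linarith
  also have "\<dots> \<le> sqrt \<bar>real_of_int j\<bar> + sqrt 1" by (rule sqrt_add_le_add_sqrt) auto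
  finally have "C2 * sqrt \<bar>real_of_int i\<bar> \<le> C2 * (sqrt \<bar>real_of_int j\<bar> + 1)" using assms(1) by (intro mult_left_mono) auto
  then show ?thesis unfolding exp_add[symmetric] by (simp add: algebra_simps)
qed

text \<open>The difference of products telescopes into (s - t) P + t (P - R). Each multiplication
  moves the row by at most one site, which changes the decay factor by at most
  \<open>exp C2\<close>; hence the rate survives and only the constant grows with k.\<close>

lemma mat_power_decay:
  assumes b: "\<And>i. norm (a i) \<le> M" "\<And>i. norm (b i) \<le> M" "\<And>i. norm (c i) \<le> M"
    and b0: "\<And>i. norm (a0 i) \<le> M" "\<And>i. norm (b0 i) \<le> M" "\<And>i. norm (c0 i) \<le> M"
    and C: "C1 > 0" "C2 > 0" and dev: "\<And>i. deviation a b c a0 b0 c0 i \<le> C1 * exp (- C2 * sqrt \<bar>real_of_int i\<bar>)"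
  shows "\<exists>C. \<forall>i j. norm (mat_power (jacobi_matrix a b c) k i j - mat_power (jacobi_matrix a0 b0 c0) k i j)
      \<le> C * exp (- C2 * sqrt \<bar>real_of_int i\<bar>)"
proof (induction k)
  case 0
  show ?case by (intro exI[of _ 0]) simp
next
  case (Suc k)
  define P where "P = mat_power (jacobi_matrix a b c) k"
  define R where "R = mat_power (jacobi_matrix a0 b0 c0) k"
  define E where "E i = exp (- C2 * sqrt \<bar>real_of_int i\<bar>)" for i
  obtain C where C: "\<And>i j. norm (P i j - R i j) \<le> C * E i" using Suc unfolding P_def R_def E_def by blast
  have C0: "C * E i \<ge> 0" for i using order_trans[OF norm_ge_zero C] .
  then have C0: "C \<ge> 0" using C0[of 0] by (simp add: E_def)
  obtain L where L: "\<And>i j. norm (P i j) \<le> L" using mat_power_bounded[where a = a and b = b and c = c and M = M and k = k, OF b(1-3)] unfolding P_def by blast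
  have L0: "L \<ge> 0" using order_trans[OF norm_ge_zero L] .
  have M: "M \<ge> 0" using order_trans[OF norm_ge_zero b(1)] .
  have E0: "E i > 0" for i by (simp add: E_def)
  have sh: "E (i - 1) \<le> exp C2 * E i" "E i \<le> exp C2 * E i" "E (i + 1) \<le> exp C2 * E i" for i
    unfolding E_def using \<open>C2 > 0\<close> by (intro exp_sqrt_shift; simp)+
  have term_le: "norm (s * P i' j - t * R i' j) \<le> (C1 * L + M * (C * exp C2)) * E i"
    if "norm (s - t) \<le> C1 * E i" "norm t \<le> M" "E i' \<le> exp C2 * E i" for s t i i' j
  proof -
    have "s * P i' j - t * R i' j = (s - t) * P i' j + t * (P i' j - R i' j)" by (simp add: algebra_simps)
    then have "norm (s * P i' j - t * R i' j) \<le> norm (s - t) * norm (P i' j) + norm t * norm (P i' j - R i' j)"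
      using norm_triangle_ineq[of "(s - t) * P i' j" "t * (P i' j - R i' j)"] by (simp add: norm_mult)
    also have "\<dots> \<le> (C1 * E i) * L + M * (C * (exp C2 * E i))"
      using that L L0 M C0 E0[of i] \<open>C1 > 0\<close> order_trans[OF C mult_left_mono[OF that(3) C0]]
      by (intro add_mono mult_mono) auto
    finally show ?thesis by (simp add: algebra_simps)
  qed
  have d: "norm (a i - a0 i) \<le> C1 * E i" "norm (b i - b0 i) \<le> C1 * E i" "norm (c (i + 1) - c0 (i + 1)) \<le> C1 * E i" for i
    using dev[of i] norm_ge_zero[of "a i - a0 i"] norm_ge_zero[of "b i - b0 i"] norm_ge_zero[of "c (i + 1) - c0 (i + 1)"]
    unfolding deviation_def E_def by linarith+
  define Q where "Q = (C1 * L + M * (C * exp C2))"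
  have "norm (mat_power (jacobi_matrix a b c) (Suc k) i j - mat_power (jacobi_matrix a0 b0 c0) (Suc k) i j) \<le> (3 * Q) * E i" for i j
  proof -
    have "mat_power (jacobi_matrix a b c) (Suc k) i j - mat_power (jacobi_matrix a0 b0 c0) (Suc k) i j =
       (a i * P (i - 1) j - a0 i * R (i - 1) j) + (b i * P i j - b0 i * R i j) + (c (i + 1) * P (i + 1) j - c0 (i + 1) * R (i + 1) j)"
      unfolding mat_power_Suc_left P_def R_def by simp
    also have "norm \<dots> \<le> Q * E i + Q * E i + Q * E i"
      unfolding Q_def
      by (intro order_trans[OF norm_triangle_ineq] add_mono term_le d b0 sh)
    finally show ?thesis by (simp add: algebra_simps)
  qed
  then show ?case unfolding E_def by blast
qed

lemma mat_poly_decay: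
  assumes b: "\<And>i. norm (a i) \<le> M" "\<And>i. norm (b i) \<le> M" "\<And>i. norm (c i) \<le> M"
    and b0: "\<And>i. norm (a0 i) \<le> M" "\<And>i. norm (b0 i) \<le> M" "\<And>i. norm (c0 i) \<le> M"
    and C: "C1 > 0" "C2 > 0" and dev: "\<And>i. deviation a b c a0 b0 c0 i \<le> C1 * exp (- C2 * sqrt \<bar>real_of_int i\<bar>)"
  obtains C where "C > 0" "\<And>i j. norm (mat_poly Q (jacobi_matrix a b c) i j - mat_poly Q (jacobi_matrix a0 b0 c0) i j)
      \<le> C * exp (- C2 * sqrt \<bar>real_of_int i\<bar>)"
proof -
  have "\<forall>k. \<exists>C. \<forall>i j. norm (mat_power (jacobi_matrix a b c) k i j - mat_power (jacobi_matrix a0 b0 c0) k i j)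
      \<le> C * exp (- C2 * sqrt \<bar>real_of_int i\<bar>)"
    using mat_power_decay[OF b b0 C dev] by simp
  then obtain D where D: "\<And>k i j. norm (mat_power (jacobi_matrix a b c) k i j - mat_power (jacobi_matrix a0 b0 c0) k i j)
      \<le> D k * exp (- C2 * sqrt \<bar>real_of_int i\<bar>)"
    by (auto dest!: choice)
  define C where "C = 1 + (\<Sum>k\<le>degree Q. norm (coeff Q k) * \<bar>D k\<bar>)"
  have "C > 0" unfolding C_def by (intro add_pos_nonneg sum_nonneg) auto
  moreover have "norm (mat_poly Q (jacobi_matrix a b c) i j - mat_poly Q (jacobi_matrix a0 b0 c0) i j)
      \<le> C * exp (- C2 * sqrt \<bar>real_of_int i\<bar>)" for i j
  proof -
    define E where "E = exp (- C2 * sqrt \<bar>real_of_int i\<bar>)"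
    have E: "E > 0" by (simp add: E_def)
    have "mat_poly Q (jacobi_matrix a b c) i j - mat_poly Q (jacobi_matrix a0 b0 c0) i j =
       (\<Sum>k\<le>degree Q. coeff Q k * (mat_power (jacobi_matrix a b c) k i j - mat_power (jacobi_matrix a0 b0 c0) k i j))"
      unfolding mat_poly_def by (simp add: sum_subtractf right_diff_distrib)
    also have "norm \<dots> \<le> (\<Sum>k\<le>degree Q. norm (coeff Q k) * (\<bar>D k\<bar> * E))"
    proof (intro sum_norm_le)
      fix k
      have "D k * E \<le> \<bar>D k\<bar> * E" using E by (intro mult_right_mono) auto
      then show "norm (coeff Q k * (mat_power (jacobi_matrix a b c) k i j - mat_power (jacobi_matrix a0 b0 c0) k i j)) \<le> norm (coeff Q k) * (\<bar>D k\<bar> * E)"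
        unfolding norm_mult using order_trans[OF D[of k i j, folded E_def]] by (intro mult_left_mono) auto
    qed
    also have "\<dots> = (\<Sum>k\<le>degree Q. norm (coeff Q k) * \<bar>D k\<bar>) * E" by (simp add: sum_distrib_right mult.assoc)
    also have "\<dots> \<le> C * E" using E by (intro mult_right_mono) (auto simp: C_def)
    finally show ?thesis unfolding E_def .
  qed
  ultimately show thesis using that by blast
qed

section \<open>Finite dimension of root subspaces\<close>

lemma jacobi_homogeneous_zero:
  assumes nz: "\<And>i. a i \<noteq> 0" "\<And>i. c i \<noteq> 0"
    and u: "minus_scalar (mat_apply (jacobi_matrix a b c)) z u = 0" "u 0 = 0" "u 1 = 0"
  shows "u = 0"
proof -
  have eq: "a i * u (i - 1) + b i * u i + c (i + 1) * u (i + 1) = z * u i" for i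
    using fun_cong[OF u(1), of i] by (simp add: minus_scalar_def mat_apply_jacobi seq_scale_def)
  have r: "u (int n) = 0 \<and> u (int n + 1) = 0" for n
  proof (induction n)
    case (Suc n)
    then have "c (int n + 1 + 1) * u (int n + 1 + 1) = 0" using eq[of "int n + 1"] by simp
    then show ?case using Suc nz by (simp add: add_ac)
  qed (use u in auto)
  have l: "u (- int n) = 0 \<and> u (- int n + 1) = 0" for n
  proof (induction n)
    case (Suc n)
    then have "a (- int n) * u (- int n - 1) = 0" using eq[of "- int n"] by simp
    then have "u (- int n - 1) = 0" using nz by simp
    moreover have "- int n - 1 = - int (Suc n)" by simp
    ultimately show ?case using Suc by simp
  qed (use u in auto)
  have "u i = 0" for i using r[of "nat i"] l[of "nat (- i)"] by (cases "i \<ge> 0") auto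
  then show ?thesis by (simp add: fun_eq_iff)
qed

text \<open>A preimage of \<open>span F\<close> consists of particular solutions for the members of
  F and of the homogeneous solutions, which the values at 0 and 1 determine. All this takes place in
  the space of all sequences.\<close>

lemma jacobi_preimage_finite_dim:
  assumes nz: "\<And>i. a i \<noteq> 0" "\<And>i. c i \<noteq> 0" and F: "finite F"
  shows "\<exists>F'. finite F' \<and> {x. minus_scalar (mat_apply (jacobi_matrix a b c)) z x \<in> seq.span F} \<subseteq> seq.span F'"
proof -
  define A where "A = minus_scalar (mat_apply (jacobi_matrix a b c)) z"
  have lin: "seq_linear A" unfolding A_def by (rule seq_linear_minus_scalar[OF seq_linear_jacobi])
  have add: "A (x + y) = A x + A y" and scale: "A (seq_scale w x) = seq_scale w (A x)" for x y w
    using lin unfolding seq_linear_def by auto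
  have ex: "\<exists>u. A u = f \<and> u 0 = x0 \<and> u 1 = x1" for f x0 x1
  proof -
    obtain u where "minus_scalar (mat_apply (jacobi_matrix a b c)) z u = f" "u 0 = x0" "u 1 = x1"
      by (rule jacobi_solution_exists[of a c b z f x0 x1, OF nz]) (rule that)
    then show ?thesis unfolding A_def by blast
  qed
  have "\<forall>f. \<exists>u. A u = f" using ex by blast
  from choice[OF this] obtain s where s: "\<And>f. A (s f) = f" by blast
  obtain C where C: "A C = 0" "C 0 = 1" "C 1 = 0" using ex[of 0 1 0] by auto
  obtain S where S: "A S = 0" "S 0 = 0" "S 1 = 1" using ex[of 0 0 1] by auto
  define F' where "F' = insert C (insert S (s ` F))"
  have "x \<in> seq.span F'" if x: "A x \<in> seq.span F" for x
  proof -
    have "\<exists>y\<in>seq.span (s ` F). A y = v" if "v \<in> seq.span F" for v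
    proof (rule seq.span_induct[OF that, of "\<lambda>v. \<exists>y\<in>seq.span (s ` F). A y = v"])
      show "seq.subspace {v. \<exists>y\<in>seq.span (s ` F). A y = v}"
      proof (rule seq.subspaceI)
        show "0 \<in> {v. \<exists>y\<in>seq.span (s ` F). A y = v}"
          using seq.span_zero seq_linear_diff(2)[OF lin] by blast
        show "v + w \<in> {v. \<exists>y\<in>seq.span (s ` F). A y = v}"
          if "v \<in> {v. \<exists>y\<in>seq.span (s ` F). A y = v}" "w \<in> {v. \<exists>y\<in>seq.span (s ` F). A y = v}" for v w
          using that add seq.span_add by fastforce
        show "seq_scale r v \<in> {v. \<exists>y\<in>seq.span (s ` F). A y = v}"
          if "v \<in> {v. \<exists>y\<in>seq.span (s ` F). A y = v}" for r v
          using that scale seq.span_scale by fastforce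
      qed
      show "\<exists>y\<in>seq.span (s ` F). A y = v" if "v \<in> F" for v
        using s that by (intro bexI[of _ "s v"] seq.span_base) auto
    qed
    then obtain y where y: "y \<in> seq.span (s ` F)" "A y = A x" using x by blast
    define w where "w = x - y"
    define h where "h = w - (seq_scale (w 0) C + seq_scale (w 1) S)"
    have "A w = 0" unfolding w_def seq_linear_diff(1)[OF lin] y(2) by (rule diff_self)
    then have "A h = 0" unfolding h_def seq_linear_diff(1)[OF lin] add scale C(1) S(1) by simp
    moreover have "h 0 = 0" "h 1 = 0" using C S by (simp_all add: h_def seq_scale_def)
    ultimately have "h = 0" unfolding A_def by (rule jacobi_homogeneous_zero[OF nz])
    then have "x = y + (seq_scale (w 0) C + seq_scale (w 1) S)" by (simp add: h_def w_def algebra_simps)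
    moreover have "y \<in> seq.span F'" using y(1) seq.span_mono[of "s ` F" F'] by (auto simp: F'_def)
    moreover have "C \<in> seq.span F'" "S \<in> seq.span F'" by (auto simp: F'_def intro: seq.span_base)
    ultimately show ?thesis by (simp only: seq.span_add seq.span_scale)
  qed
  moreover have "finite F'" using F by (simp add: F'_def)
  ultimately show ?thesis unfolding A_def by blast
qed

text \<open>Over the complex numbers R(T) is a scalar times a product of factors T - w, so the
  second-order case is applied \<open>degree R\<close> times.\<close>

lemma poly_op_preimage_finite_dim:
  assumes nz: "\<And>i. a i \<noteq> 0" "\<And>i. c i \<noteq> 0" and R: "R \<noteq> 0" and F: "finite F"
  shows "\<exists>F'. finite F' \<and> {x. poly_op R (mat_apply (jacobi_matrix a b c)) x \<in> seq.span F} \<subseteq> seq.span F'"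
  using R F
proof (induction "degree R" arbitrary: R F)
  case 0
  then obtain r where r: "R = [:r:]" "r \<noteq> 0" by (metis degree_eq_zeroE pCons_0_0)
  have "x \<in> seq.span F" if "seq_scale r x \<in> seq.span F" for x
    using seq.span_scale[OF that, of "1 / r"] r(2) by simp
  then show ?case using 0(3) unfolding r(1) poly_op_const by blast
next
  case (Suc n)
  obtain w where "poly R w = 0"
    using Suc(2) fundamental_theorem_of_algebra[of R] by (auto simp: constant_degree)
  then obtain R' where R': "R = [:- w, 1:] * R'" by (auto simp: poly_eq_0_iff_dvd)
  have R'0: "R' \<noteq> 0" using Suc(3) R' by auto
  have "degree R = Suc (degree R')" unfolding R' using R'0 by (subst degree_mult_eq) auto
  then have dn: "n = degree R'" using Suc(2) by simp
  obtain F1 where F1: "finite F1" "{x. minus_scalar (mat_apply (jacobi_matrix a b c)) w x \<in> seq.span F} \<subseteq> seq.span F1"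
    using jacobi_preimage_finite_dim[of a c F b w, OF nz Suc(4)] by auto
  obtain F2 where F2: "finite F2" "{x. poly_op R' (mat_apply (jacobi_matrix a b c)) x \<in> seq.span F1} \<subseteq> seq.span F2"
    using Suc(1)[OF dn R'0 F1(1)] by auto
  have "{x. poly_op R (mat_apply (jacobi_matrix a b c)) x \<in> seq.span F} \<subseteq> seq.span F2"
    unfolding R' poly_op_linear_factor[OF seq_linear_jacobi] using F1(2) F2(2) by blast
  then show ?case using F2(1) by blast
qed

lemma poly_op_kernel_finite_dim:
  assumes nz: "\<And>i. a i \<noteq> 0" "\<And>i. c i \<noteq> 0" and Q: "degree Q > 0"
  shows "\<exists>F. finite F \<and> {x. (minus_scalar (poly_op Q (mat_apply (jacobi_matrix a b c))) z ^^ K) x = 0} \<subseteq> seq.span F"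
proof (induction K)
  case 0
  show ?case by (intro exI[of _ "{}"]) (auto intro: seq.span_zero)
next
  case (Suc K)
  let ?T = "mat_apply (jacobi_matrix a b c)"
  obtain F where F: "finite F" "{x. (minus_scalar (poly_op Q ?T) z ^^ K) x = 0} \<subseteq> seq.span F" using Suc by blast
  have e: "minus_scalar (poly_op Q ?T) z x = poly_op (Q - [:z:]) ?T x" for x
  proof -
    have "poly_op Q ?T x = poly_op ((Q - [:z:]) + [:z:]) ?T x" by simp
    then show ?thesis unfolding minus_scalar_def by (simp only: poly_op_add poly_op_const add_diff_cancel_right')
  qed
  obtain F' where F': "finite F'" "{x. poly_op (Q - [:z:]) ?T x \<in> seq.span F} \<subseteq> seq.span F'"
    using poly_op_preimage_finite_dim[of a c "Q - [:z:]" F b, OF nz degree_diff_const(3)[OF Q] F(1)] by auto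
  have "x \<in> seq.span F'" if "(minus_scalar (poly_op Q ?T) z ^^ Suc K) x = 0" for x
  proof -
    have "(minus_scalar (poly_op Q ?T) z ^^ K) (minus_scalar (poly_op Q ?T) z x) = 0"
      using that by (simp only: funpow_Suc_right comp_def)
    then have "minus_scalar (poly_op Q ?T) z x \<in> seq.span F" using F(2) by blast
    then show ?thesis using F'(2) unfolding e by blast
  qed
  then show ?case using F'(1) by blast
qed

section \<open>Assembling the spectrum\<close>

lemma asymptotic_to_deviation_le:
  assumes "asymptotic_to a b c a0 b0 c0" "\<epsilon> > 0"
  shows "\<exists>N. \<forall>i. \<bar>i\<bar> > N \<longrightarrow> deviation a b c a0 b0 c0 i \<le> \<epsilon>"
proof -
  let ?d = "deviation a b c a0 b0 c0"
  have "eventually (\<lambda>n. ?d n < \<epsilon>) at_top" "eventually (\<lambda>n. ?d n < \<epsilon>) at_bot"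
    using assms unfolding asymptotic_to_def by (auto intro: order_tendstoD)
  then obtain A B where "\<And>n. n \<ge> A \<Longrightarrow> ?d n < \<epsilon>" "\<And>n. n \<le> B \<Longrightarrow> ?d n < \<epsilon>"
    unfolding eventually_at_top_linorder eventually_at_bot_linorder by auto
  moreover have "i \<ge> A \<or> i \<le> B" if "\<bar>i\<bar> > max \<bar>A\<bar> \<bar>B\<bar>" for i :: int using that by linarith
  ultimately show ?thesis by (intro exI[of _ "max \<bar>A\<bar> \<bar>B\<bar>"]) (auto intro: less_imp_le)
qed

lemma mem_l2_spectrum: "z \<in> l2_spectrum T \<longleftrightarrow> \<not> l2_invertible (minus_scalar T z)"
  by (simp add: l2_spectrum_def l2_resolvent_set_eq)

text \<open>Stated for the perturbed matrix, so that one Weyl argument serves J and, with zero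
  deviation, also J^0.\<close>

lemma periodic_spectrum_subset:
  assumes p: "p \<ge> 1" and nz: "\<And>i. a0 i \<noteq> 0" "\<And>i. c0 i \<noteq> 0"
    and per: "periodic_seq p a0" "periodic_seq p b0" "periodic_seq p c0"
    and Q: "poly_op Q (mat_apply (jacobi_matrix a0 b0 c0)) = free_op p"
    and bd0: "\<And>i. norm (a0 i) \<le> M" "\<And>i. norm (b0 i) \<le> M" "\<And>i. norm (c0 i) \<le> M"
    and dev: "\<And>\<epsilon>. \<epsilon> > 0 \<Longrightarrow> \<exists>N. \<forall>i. \<bar>i\<bar> > N \<longrightarrow> deviation a b c a0 b0 c0 i \<le> \<epsilon>"
  shows "{z. \<exists>t\<in>{-2..2}. poly Q z = complex_of_real t} \<subseteq> l2_spectrum (mat_apply (jacobi_matrix a b c))"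
proof
  fix z assume "z \<in> {z. \<exists>t\<in>{-2..2}. poly Q z = complex_of_real t}"
  then obtain t where t: "poly Q z = complex_of_real t" "t \<in> {-2..2}" by blast
  obtain u where u: "u \<noteq> 0" "minus_scalar (mat_apply (jacobi_matrix a0 b0 c0)) z u = 0"
    "\<And>i. norm (u (i + int p)) = norm (u i)"
    by (rule bloch_solution_exists[OF p per nz Q t]) (rule that)
  show "z \<in> l2_spectrum (mat_apply (jacobi_matrix a b c))"
    unfolding mem_l2_spectrum by (rule bloch_in_spectrum[OF p u bd0 dev])
qed

lemma periodic_spectrum:
  assumes p: "p \<ge> 1" and nz: "\<And>i. a0 i \<noteq> 0" "\<And>i. c0 i \<noteq> 0"
    and per: "periodic_seq p a0" "periodic_seq p b0" "periodic_seq p c0"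
    and Q: "poly_op Q (mat_apply (jacobi_matrix a0 b0 c0)) = free_op p"
    and bd0: "\<And>i. norm (a0 i) \<le> M" "\<And>i. norm (b0 i) \<le> M" "\<And>i. norm (c0 i) \<le> M"
  shows "l2_spectrum (mat_apply (jacobi_matrix a0 b0 c0)) = {z. \<exists>t\<in>{-2..2}. poly Q z = complex_of_real t}"
proof
  show "l2_spectrum (mat_apply (jacobi_matrix a0 b0 c0)) \<subseteq> {z. \<exists>t\<in>{-2..2}. poly Q z = complex_of_real t}"
    using periodic_resolvent[OF bounded_l2_operator_jacobi[OF bd0] seq_linear_jacobi Q]
    by (fastforce simp: mem_l2_spectrum)
  show "{z. \<exists>t\<in>{-2..2}. poly Q z = complex_of_real t} \<subseteq> l2_spectrum (mat_apply (jacobi_matrix a0 b0 c0))"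
  proof (rule periodic_spectrum_subset[OF p nz per Q bd0])
    show "\<exists>N. \<forall>i. \<bar>i\<bar> > N \<longrightarrow> deviation a0 b0 c0 a0 b0 c0 i \<le> \<epsilon>" if "\<epsilon> > 0" for \<epsilon>
      using that by (auto simp: deviation_def)
  qed
qed

lemma perturbed_free_mat_poly:
  assumes p: "p \<ge> 1" and Q: "degree Q = p" "mat_poly Q (jacobi_matrix a0 b0 c0) = free_matrix p"
    and nz: "\<And>i. a i \<noteq> 0" "\<And>i. c i \<noteq> 0"
    and bd: "\<And>i. norm (a i) \<le> M" "\<And>i. norm (b i) \<le> M" "\<And>i. norm (c i) \<le> M"
    and bd0: "\<And>i. norm (a0 i) \<le> M" "\<And>i. norm (b0 i) \<le> M" "\<And>i. norm (c0 i) \<le> M"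
    and C: "C1 > 0" "C2 > 0" and dev: "\<And>i. deviation a b c a0 b0 c0 i \<le> C1 * exp (- C2 * sqrt \<bar>real_of_int i\<bar>)"
  shows "\<exists>C. perturbed_free p (mat_poly Q (jacobi_matrix a b c)) C C2"
proof -
  obtain C' where C': "C' > 0" "\<And>i j. norm (mat_poly Q (jacobi_matrix a b c) i j - mat_poly Q (jacobi_matrix a0 b0 c0) i j)
      \<le> C' * exp (- C2 * sqrt \<bar>real_of_int i\<bar>)"
    by (rule mat_poly_decay[where Q = Q, OF bd bd0 C dev]) (rule that)
  have l: "lead_coeff Q \<noteq> 0" using p Q(1) by auto
  have "perturbed_free p (mat_poly Q (jacobi_matrix a b c)) C' C2"
  proof
    show "norm (mat_poly Q (jacobi_matrix a b c) i j - free_matrix p i j) \<le> C' * exp (- C2 * sqrt \<bar>real_of_int i\<bar>)" for i j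
      using C'(2)[of i j] unfolding Q(2) .
    show "mat_poly Q (jacobi_matrix a b c) i (i + int p) \<noteq> 0" for i
      using l nz mat_poly_top[of Q a b c i] unfolding Q(1) by simp
    show "mat_poly Q (jacobi_matrix a b c) i (i - int p) \<noteq> 0" for i
      using l nz mat_poly_bottom[of Q a b c i] unfolding Q(1) by simp
  qed (use p C' C in auto)
  then show ?thesis by blast
qed

lemma poly_op_band_op:
  "poly_op Q (mat_apply (jacobi_matrix a b c)) = band_op (degree Q) (mat_poly Q (jacobi_matrix a b c))"
  by (intro ext) (simp only: band_op_interval poly_op_jacobi[OF finite_atLeastAtMost_int order_refl])

lemma finite_poly_vimage:
  fixes Q :: "complex poly"
  assumes Q: "degree Q > 0" and S: "finite S"
  shows "finite {z. poly Q z \<in> S}"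
proof -
  have "finite {z. poly Q z = w}" for w
    using poly_roots_finite[OF degree_diff_const(3)[OF Q, of w]] by simp
  then have "finite (\<Union>w\<in>S. {z. poly Q z = w})" using S by blast
  moreover have "{z. poly Q z \<in> S} = (\<Union>w\<in>S. {z. poly Q z = w})" by auto
  ultimately show ?thesis by simp
qed

theorem theorem6p5:
  fixes p :: nat and a b c a0 b0 c0 :: "int \<Rightarrow> complex"
  assumes "p \<ge> 1"
    and "\<forall>n. a0 n * c0 n \<noteq> 0"
    and "periodic_seq p a0" and "periodic_seq p b0" and "periodic_seq p c0"
    and "quasi_symmetric p a0 c0"
    and "\<forall>n. a n * c n \<noteq> 0"
    and "asymptotic_to a b c a0 b0 c0"
    and "class_P (1/2) a b c a0 b0 c0"
  shows "\<exists>Q \<gamma> E.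
           degree Q = p \<and>
           mat_poly Q (jacobi_matrix a0 b0 c0) = free_matrix p \<and>
           inverse_branches Q \<gamma> \<and>
           l2_spectrum (mat_apply (jacobi_matrix a0 b0 c0)) =
             {z. \<exists>t\<in>{-2..2}. poly Q z = complex_of_real t} \<and>
           l2_spectrum (mat_apply (jacobi_matrix a0 b0 c0)) = (\<Union>k<p. \<gamma> k ` {-2..2}) \<and>
           l2_spectrum (mat_apply (jacobi_matrix a b c)) = (\<Union>k<p. \<gamma> k ` {-2..2}) \<union> E \<and>
           finite E \<and> E \<inter> (\<Union>k<p. \<gamma> k ` {-2..2}) = {} \<and>
           (\<forall>z\<in>E. l2_eigenvalue (mat_apply (jacobi_matrix a b c)) z \<and>
                  finite_algebraic_multiplicity (mat_apply (jacobi_matrix a b c)) z)"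
proof -
  let ?S = "mat_apply (jacobi_matrix a0 b0 c0)" and ?T = "mat_apply (jacobi_matrix a b c)"
  note p = assms(1) and per = assms(3-5)
  have nz0: "\<And>i. a0 i \<noteq> 0" "\<And>i. c0 i \<noteq> 0" and nz: "\<And>i. a i \<noteq> 0" "\<And>i. c i \<noteq> 0"
    using assms(2,7) by auto
  obtain Q where Q: "degree Q = p" "mat_poly Q (jacobi_matrix a0 b0 c0) = free_matrix p"
    using naiman[OF p per nz0 assms(6)] .
  have dQ: "degree Q > 0" using p Q(1) by simp
  note Q0 = poly_op_free[OF p Q]
  obtain \<gamma> where \<gamma>: "inverse_branches Q \<gamma>" using inverse_branches_exist[OF dQ] .
  define \<Sigma> where "\<Sigma> = {z. \<exists>t\<in>{-2..2}. poly Q z = complex_of_real t}"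
  have \<Sigma>\<gamma>: "\<Sigma> = (\<Union>k<p. \<gamma> k ` {-2..2})"
    unfolding \<Sigma>_def using inverse_branches_image[OF \<gamma> dQ] unfolding Q(1) .
  obtain C1 C2 where C: "C1 > 0" "C2 > 0"
    and dev': "\<And>i. deviation a b c a0 b0 c0 i \<le> C1 * exp (- C2 * \<bar>real_of_int i\<bar> powr (1/2))"
    using assms(9) unfolding class_P_def by blast
  have dev: "deviation a b c a0 b0 c0 i \<le> C1 * exp (- C2 * sqrt \<bar>real_of_int i\<bar>)" for i
    using dev'[of i] by (simp add: powr_half_sqrt)
  have dev1: "deviation a b c a0 b0 c0 i \<le> C1" for i
  proof -
    have "exp (- C2 * sqrt \<bar>real_of_int i\<bar>) \<le> 1" using C by simp
    then have "C1 * exp (- C2 * sqrt \<bar>real_of_int i\<bar>) \<le> C1 * 1" using C by (intro mult_left_mono) auto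
    then show ?thesis using dev[of i] by linarith
  qed
  obtain Ma where Ma: "\<And>i. norm (a0 i) \<le> Ma" by (rule periodic_seq_bounded[OF p per(1)]) (rule that)
  obtain Mb where Mb: "\<And>i. norm (b0 i) \<le> Mb" by (rule periodic_seq_bounded[OF p per(2)]) (rule that)
  obtain Mc where Mc: "\<And>i. norm (c0 i) \<le> Mc" by (rule periodic_seq_bounded[OF p per(3)]) (rule that)
  define M where "M = \<bar>Ma\<bar> + \<bar>Mb\<bar> + \<bar>Mc\<bar> + C1"
  have bd0: "norm (a0 i) \<le> M" "norm (b0 i) \<le> M" "norm (c0 i) \<le> M" for i
    using Ma[of i] Mb[of i] Mc[of i] C unfolding M_def by linarith+
  have dp: "norm (a i - a0 i) \<le> C1" "norm (b i - b0 i) \<le> C1" "norm (c (i + 1) - c0 (i + 1)) \<le> C1" for i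
    using dev1[of i] norm_ge_zero[of "a i - a0 i"] norm_ge_zero[of "b i - b0 i"] norm_ge_zero[of "c (i + 1) - c0 (i + 1)"]
    unfolding deviation_def by linarith+
  have dc: "norm (c i - c0 i) \<le> C1" for i using dp(3)[of "i - 1"] by simp
  have bd: "norm (a i) \<le> M" "norm (b i) \<le> M" "norm (c i) \<le> M" for i
    using Ma[of i] Mb[of i] Mc[of i] dp(1,2)[of i] dc[of i] norm_triangle_sub[of "a i" "a0 i"]
      norm_triangle_sub[of "b i" "b0 i"] norm_triangle_sub[of "c i" "c0 i"] unfolding M_def by linarith+
  have devM: "deviation a b c a0 b0 c0 i \<le> M" for i using dev1[of i] unfolding M_def by linarith
  note dev0 = asymptotic_to_deviation_le[OF assms(8)]
  have sp0: "l2_spectrum ?S = \<Sigma>" unfolding \<Sigma>_def by (rule periodic_spectrum[OF p nz0 per Q0 bd0])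
  have sub: "\<Sigma> \<subseteq> l2_spectrum ?T" unfolding \<Sigma>_def by (rule periodic_spectrum_subset[OF p nz0 per Q0 bd0 dev0])
  \<comment> \<open>E is what the spectrum has beyond the arcs. Disjointness is then automatic, and
    the work lies in showing that E consists of finitely many eigenvalues.\<close>
  define E where "E = l2_spectrum ?T - \<Sigma>"
  have off: "poly Q z \<notin> complex_of_real ` {-2..2}" if "z \<in> E" for z
    using that unfolding E_def \<Sigma>_def by auto
  have eig: "\<exists>x\<in>l2. x \<noteq> 0 \<and> ?T x = seq_scale z x" if z: "z \<in> E" for z
  proof (rule ccontr)
    assume neg: "\<not> ?thesis"
    have inv: "l2_invertible (minus_scalar ?S z)"
      using z unfolding E_def sp0[symmetric] Diff_iff mem_l2_spectrum by blast
    have inj: "x = 0" if "x \<in> l2" "minus_scalar ?T z x = 0" for x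
      using neg that unfolding minus_scalar_def by auto
    have "l2_invertible (minus_scalar ?T z)" by (rule jacobi_fredholm[OF bd0 dev0 devM inv inj])
    then show False using z unfolding E_def by (simp add: mem_l2_spectrum)
  qed
  obtain C' where pf: "perturbed_free p (mat_poly Q (jacobi_matrix a b c)) C' C2"
    using perturbed_free_mat_poly[OF p Q nz bd bd0 C dev] by blast
  have QT: "band_op p (mat_poly Q (jacobi_matrix a b c)) = poly_op Q ?T"
    using poly_op_band_op[of Q a b c] unfolding Q(1) by simp
  note fin = perturbed_free.finite_spectrum_off_interval[OF pf, unfolded QT]
  \<comment> \<open>Q maps E into the finite set of eigenvalues of Q(J) off [-2,2], and a
    nonconstant polynomial has finite fibres.\<close>
  have "E \<subseteq> {z. poly Q z \<in> {w. w \<notin> complex_of_real ` {-2..2} \<and> (\<exists>x\<in>l2. x \<noteq> 0 \<and> poly_op Q ?T x = seq_scale w x)}}"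
    using off eig poly_op_eigenvector[OF seq_linear_jacobi] by blast
  then have finE: "finite E" using finite_poly_vimage[OF dQ fin(1)] finite_subset by blast
  have mult: "finite_algebraic_multiplicity ?T z" if z: "z \<in> E" for z
  proof -
    \<comment> \<open>Every root vector of J at z is one of Q(J) at Q(z), so it is annihilated by
      the K-th power of Q(J) - Q(z). The kernel of that power is finite-dimensional already among
      all sequences.\<close>
    obtain K where K: "\<And>k x. x \<in> l2 \<Longrightarrow> (minus_scalar (poly_op Q ?T) (poly Q z) ^^ k) x = 0 \<Longrightarrow>
        (minus_scalar (poly_op Q ?T) (poly Q z) ^^ K) x = 0"
      using fin(2)[OF off[OF z]] by blast
    obtain F where F: "finite F" "{x. (minus_scalar (poly_op Q ?T) (poly Q z) ^^ K) x = 0} \<subseteq> seq.span F"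
      using poly_op_kernel_finite_dim[where a = a and b = b and c = c and z = "poly Q z" and K = K, OF nz dQ] by (elim exE conjE) (rule that)
    have "root_subspace ?T z \<subseteq> seq.span F"
    proof
      fix x assume "x \<in> root_subspace ?T z"
      then obtain k where x: "x \<in> l2" "(minus_scalar ?T z ^^ k) x = 0" unfolding root_subspace_def by blast
      have "(minus_scalar (poly_op Q ?T) (poly Q z) ^^ K) x = 0"
        by (rule K[OF x(1) poly_op_root_vector[OF seq_linear_jacobi x(2)]])
      then show "x \<in> seq.span F" using F(2) by blast
    qed
    then show ?thesis using F(1) unfolding finite_algebraic_multiplicity_def by blast
  qed
  have spT: "l2_spectrum ?T = \<Sigma> \<union> E" and disj: "E \<inter> \<Sigma> = {}" using sub unfolding E_def by auto
  show ?thesis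
  proof (intro exI[of _ Q] exI[of _ \<gamma>] exI[of _ E] conjI ballI)
    show "l2_spectrum ?S = {z. \<exists>t\<in>{-2..2}. poly Q z = complex_of_real t}" using sp0 unfolding \<Sigma>_def .
    show "l2_spectrum ?S = (\<Union>k<p. \<gamma> k ` {-2..2})" using sp0 \<Sigma>\<gamma> by simp
    show "l2_spectrum ?T = (\<Union>k<p. \<gamma> k ` {-2..2}) \<union> E" using spT \<Sigma>\<gamma> by simp
    show "E \<inter> (\<Union>k<p. \<gamma> k ` {-2..2}) = {}" using disj \<Sigma>\<gamma> by simp
    show "l2_eigenvalue ?T z" if "z \<in> E" for z using eig[OF that] unfolding l2_eigenvalue_def .
  qed (use Q \<gamma> finE mult in auto)
qed

end
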